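(* If for every vertex $z\in\mathcal{S}_h$ there exists a local interpolating vertex $r\in\mathcal{L}_h$ and an acceptable path from $z$ to $r$, then $\operatorname{div}{\bf V}_h^3=Q_h^2$.
   Context: $\Omega\subset\mathbb{R}^2$ polygonal, $\mathcal{T}_h$ a conforming triangulation; $\mathcal{S}_h$ vertices, $\mathcal{E}_h$ interior edges. For vertex $x$, $\mathcal{T}_h(x)=\{T_1,\dots,T_N\}$ triangles at $x$ enumerated so consecutive ones share an edge ($T_N,T_1$ too for interior $x$; $T_1,T_N$ have edges on $\partial\Omega$ for boundary $x$); $\Omega_h(x)=\bigcup_jT_j$; $\theta_j$ angle of $T_j$ at $x$; $\Theta(x)=\max_j|\sin(\theta_j+\theta_{j+1})|$ (over $1\le j\le N$, $\theta_{N+1}=\theta_1$, for interior $x$; over $1\le j\le N-1$ for boundary $x$); singular iff $\Theta(x)=0$; $\mathcal{S}_h^2$ = singular vertices. ${\bf V}_h^3$: continuous piecewise cubic vector fields vanishing on $\partial\Omega$; $Q_h^2=\{q\in L^2(\Omega):\int_\Omega q=0,\ q|_T\in P^2(T)\ \forall T,\ \sum_j(-1)^{j-1}q|_{T_j}(x)=0\ \forall x\in\mathcal{S}_h^2\}$. ${\bf V}_{h,00}^3(x)$: fields in ${\bf V}_h^3$ supported in $\Omega_h(x)$ with $\int_T\operatorname{div}{\bf v}=0$ for $T\in\mathcal{T}_h(x)$ and $\operatorname{div}{\bf v}|_T(\sigma)=0$ for all vertices $\sigma\ne x$, $T\ni\sigma$. $W(x)=\mathbb{R}^N$ for nonsingular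 $x$, $\{a\in\mathbb{R}^N:\sum_j(-1)^{j-1}a_j=0\}$ for singular $x$. $x$ is a local interpolating vertex ($x\in\mathcal{L}_h$) if for every $a\in W(x)$ there exists ${\bf v}\in{\bf V}_{h,00}^3(x)$ with $\operatorname{div}{\bf v}|_{T_j}(x)=a_j$ for all $j$. For an interior edge $e$ with endpoint $x$, $M_e^x=\cot\phi+\cot\phi'$, $\phi,\phi'$ the angles at $x$ of the two triangles having $e$ as an edge. A path from $z$ to $r$ is a sequence of distinct vertices $y_0=z,y_1,\dots,y_L=r$ with $e_i=\{y_{i-1},y_i\}\in\mathcal{E}_h$; it is acceptable if $M_{e_i}^{y_{i-1}}\ne0$ for $1\le i\le L$ (the trivial path $L=0$ when $z=r$ is acceptable). *)

theory Defs
  imports "HOL-Analysis.Analysis"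
begin

type_synonym pt = "real \<times> real"

definition poly2 :: "nat \<Rightarrow> (pt \<Rightarrow> real) \<Rightarrow> bool" where
  "poly2 k f \<longleftrightarrow> (\<exists>c :: nat \<Rightarrow> nat \<Rightarrow> real. \<forall>p.
      f p = (\<Sum>i\<le>k. \<Sum>j\<le>k - i. c i j * fst p ^ i * snd p ^ j))"

definition poly2vec :: "nat \<Rightarrow> (pt \<Rightarrow> pt) \<Rightarrow> bool" where
  "poly2vec k g \<longleftrightarrow> poly2 k (\<lambda>p. fst (g p)) \<and> poly2 k (\<lambda>p. snd (g p))"

definition divergence :: "(pt \<Rightarrow> pt) \<Rightarrow> pt \<Rightarrow> real" where
  "divergence g p = deriv (\<lambda>t. fst (g (t, snd p))) (fst p) + deriv (\<lambda>t. snd (g (fst p, t))) (snd p)"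

text \<open>The (polynomial) cubic piece of v on triangle T, and its divergence, extended
  polynomially to the closed triangle (so values at vertices make sense).\<close>
definition cubic_piece :: "(pt \<Rightarrow> pt) \<Rightarrow> pt set \<Rightarrow> (pt \<Rightarrow> pt)" where
  "cubic_piece v T = (SOME g. poly2vec 3 g \<and> (\<forall>y\<in>convex hull T. v y = g y))"

definition div_piece :: "(pt \<Rightarrow> pt) \<Rightarrow> pt set \<Rightarrow> pt \<Rightarrow> real" where
  "div_piece v T = divergence (cubic_piece v T)"

text \<open>Mesh: a set of triangles, each given by its set of three vertices.\<close>
definition conforming_mesh :: "pt set set \<Rightarrow> pt set \<Rightarrow> bool" where
  "conforming_mesh Th \<Omega> \<longleftrightarrow> finite Th \<and> Th \<noteq> {} \<and>
     (\<forall>T\<in>Th. card T = 3 \<and> \<not> collinear T) \<and>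
     (\<forall>T\<in>Th. \<forall>T'\<in>Th. T \<noteq> T' \<longrightarrow> convex hull T \<inter> convex hull T' = convex hull (T \<inter> T')) \<and>
     \<Omega> = interior (\<Union>T\<in>Th. convex hull T) \<and> connected \<Omega>"

definition vertices :: "pt set set \<Rightarrow> pt set" where
  "vertices Th = \<Union>Th"

definition star :: "pt set set \<Rightarrow> pt \<Rightarrow> pt set set" where
  "star Th x = {T\<in>Th. x \<in> T}"

definition patch :: "pt set set \<Rightarrow> pt \<Rightarrow> pt set" where
  "patch Th x = (\<Union>T\<in>star Th x. convex hull T)"

definition interior_edges :: "pt set set \<Rightarrow> pt set \<Rightarrow> pt set set" where
  "interior_edges Th \<Omega> = {{a, b} | a b. a \<noteq> b \<and> (\<exists>T\<in>Th. {a, b} \<subseteq> T) \<and>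
                                  \<not> closed_segment a b \<subseteq> frontier \<Omega>}"

definition vangle :: "pt \<Rightarrow> pt \<Rightarrow> pt \<Rightarrow> real" where
  "vangle x a b = arccos (((a - x) \<bullet> (b - x)) / (norm (a - x) * norm (b - x)))"

definition tri_angle :: "pt set \<Rightarrow> pt \<Rightarrow> real" where
  "tri_angle T x = (SOME \<phi>. \<exists>a b. T = {x, a, b} \<and> x \<noteq> a \<and> x \<noteq> b \<and> a \<noteq> b \<and> \<phi> = vangle x a b)"

definition Mcoef :: "pt set set \<Rightarrow> pt \<Rightarrow> pt \<Rightarrow> real" where
  "Mcoef Th x y = (\<Sum>T\<in>{T\<in>Th. {x, y} \<subseteq> T}. cot (tri_angle T x))"

definition local_enum :: "pt set set \<Rightarrow> pt set \<Rightarrow> pt \<Rightarrow> nat \<Rightarrow> (nat \<Rightarrow> pt set) \<Rightarrow> bool" where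
  "local_enum Th \<Omega> x N Ts \<longleftrightarrow>
     bij_betw Ts {..<N} (star Th x) \<and>
     (\<forall>j. Suc j < N \<longrightarrow> card (Ts j \<inter> Ts (Suc j)) = 2) \<and>
     (x \<in> \<Omega> \<longrightarrow> card (Ts (N - 1) \<inter> Ts 0) = 2) \<and>
     (x \<in> frontier \<Omega> \<longrightarrow>
        (\<exists>a\<in>Ts 0. a \<noteq> x \<and> closed_segment x a \<subseteq> frontier \<Omega>) \<and>
        (\<exists>a\<in>Ts (N - 1). a \<noteq> x \<and> closed_segment x a \<subseteq> frontier \<Omega>))"

definition enum :: "pt set set \<Rightarrow> pt set \<Rightarrow> pt \<Rightarrow> nat \<times> (nat \<Rightarrow> pt set)" where
  "enum Th \<Omega> x = (SOME (N, Ts). local_enum Th \<Omega> x N Ts)"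

definition Theta :: "pt set set \<Rightarrow> pt set \<Rightarrow> pt \<Rightarrow> real" where
  "Theta Th \<Omega> x = (case enum Th \<Omega> x of (N, Ts) \<Rightarrow>
     (let \<theta> = (\<lambda>j. tri_angle (Ts j) x) in
       if x \<in> \<Omega> then Max (insert 0 {\<bar>sin (\<theta> j + \<theta> ((Suc j) mod N))\<bar> | j. j < N})
       else Max (insert 0 {\<bar>sin (\<theta> j + \<theta> (Suc j))\<bar> | j. Suc j < N})))"

definition singular_vertices :: "pt set set \<Rightarrow> pt set \<Rightarrow> pt set" where
  "singular_vertices Th \<Omega> = {x \<in> vertices Th. Theta Th \<Omega> x = 0}"

definition Vh3 :: "pt set set \<Rightarrow> pt set \<Rightarrow> (pt \<Rightarrow> pt) set" where
  "Vh3 Th \<Omega> = {v. continuous_on (closure \<Omega>) v \<and> (\<forall>p. p \<notin> \<Omega> \<longrightarrow> v p = 0) \<and>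
                  (\<forall>T\<in>Th. \<exists>g. poly2vec 3 g \<and> (\<forall>y\<in>convex hull T. v y = g y))}"

text \<open>Q_h^2, elements represented by their polynomial pieces q T on each triangle T.\<close>
definition Qh2 :: "pt set set \<Rightarrow> pt set \<Rightarrow> (pt set \<Rightarrow> pt \<Rightarrow> real) set" where
  "Qh2 Th \<Omega> = {q. (\<forall>T\<in>Th. poly2 2 (q T)) \<and>
                  (\<Sum>T\<in>Th. integral (convex hull T) (q T)) = 0 \<and>
                  (\<forall>x\<in>singular_vertices Th \<Omega>. case enum Th \<Omega> x of (N, Ts) \<Rightarrow>
                      (\<Sum>j<N. (-1) ^ j * q (Ts j) x) = 0)}"

definition V00 :: "pt set set \<Rightarrow> pt set \<Rightarrow> pt \<Rightarrow> (pt \<Rightarrow> pt) set" where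
  "V00 Th \<Omega> x = {v \<in> Vh3 Th \<Omega>. (\<forall>p. p \<notin> patch Th x \<longrightarrow> v p = 0) \<and>
       (\<forall>T\<in>star Th x. integral (convex hull T) (div_piece v T) = 0) \<and>
       (\<forall>T\<in>Th. \<forall>\<sigma>\<in>T. \<sigma> \<noteq> x \<longrightarrow> div_piece v T \<sigma> = 0)}"

definition local_interpolating :: "pt set set \<Rightarrow> pt set \<Rightarrow> pt \<Rightarrow> bool" where
  "local_interpolating Th \<Omega> x \<longleftrightarrow> (case enum Th \<Omega> x of (N, Ts) \<Rightarrow>
     (\<forall>a :: nat \<Rightarrow> real.
        (x \<in> singular_vertices Th \<Omega> \<longrightarrow> (\<Sum>j<N. (-1) ^ j * a j) = 0) \<longrightarrow>
        (\<exists>v\<in>V00 Th \<Omega> x. \<forall>j<N. div_piece v (Ts j) x = a j)))"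

definition acceptable_path :: "pt set set \<Rightarrow> pt set \<Rightarrow> pt list \<Rightarrow> pt \<Rightarrow> pt \<Rightarrow> bool" where
  "acceptable_path Th \<Omega> ys z r \<longleftrightarrow> ys \<noteq> [] \<and> hd ys = z \<and> last ys = r \<and> distinct ys \<and>
     set ys \<subseteq> vertices Th \<and>
     (\<forall>i. Suc i < length ys \<longrightarrow> {ys ! i, ys ! Suc i} \<in> interior_edges Th \<Omega> \<and>
                                Mcoef Th (ys ! i) (ys ! Suc i) \<noteq> 0)"

end

theory Submission
  imports Defs
begin

text \<open>
  \<^emph>\<open>Divergences lie in \<open>Q\<^sub>h\<^sup>2\<close>.\<close> Normal fluxes cancel across edges, which gives the zero mean. At a singular
  vertex the two neighbours of each edge point in opposite directions, so the contribution of each edge to the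
  divergences on its two sides is the same and the alternating sum telescopes.

  \<^emph>\<open>Every \<open>q\<close> in \<open>Q\<^sub>h\<^sup>2\<close> is a divergence.\<close> Write \<open>\<lambda>\<^sub>z\<close> for barycentric coordinates. Edge bubbles
  \<open>\<lambda>\<^sub>z \<lambda>\<^sub>y (\<lambda>\<^sub>z + \<lambda>\<^sub>y) c\<close> move mass between adjacent triangles, so, the domain being connected, they correct
  all triangle means. The values at the vertices are then corrected one vertex at a time, by induction along
  an acceptable path: if \<open>M\<close> does not vanish for the edge from \<open>z\<close> to \<open>y\<close>, the mean-free field
  \<open>(\<lambda>\<^sub>z\<^sup>2 \<lambda>\<^sub>y - \<lambda>\<^sub>z \<lambda>\<^sub>y\<^sup>2) c\<close>, with \<open>c\<close> along an edge at \<open>z\<close>, has nonzero divergence at \<open>z\<close> on exactly one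
  triangle. Its divergence at \<open>y\<close> is compatible, being that of a discrete field, and so can be removed by induction. The tangential
  fields \<open>\<lambda>\<^sub>z\<^sup>2 \<lambda>\<^sub>y (y - z)\<close> spread this single value around \<open>z\<close>. What remains vanishes at the vertices and has zero
  means, and it is the divergence of cubic triangle bubbles.
\<close>

section \<open>Polynomials in two variables\<close>

text \<open>Why a nonvanishing \<open>M\<close> helps: for an edge from \<open>z\<close> to
  \<open>y\<close> with opposite vertices \<open>d\<close>, \<open>d'\<close> put e = y - z, s = d -
  z, s' = d' - z. Since (e.s) det(e,s') - (e.s') det(e,s) = |e|^2 det(s,s'), the two cotangents
  cancel whenever s and s' are collinear. So \<open>M\<close> nonzero gives det(s,s') nonzero. The
  choice c = s kills the divergence at \<open>z\<close> on the triangle of \<open>d\<close>, and on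
  the other triangle it leaves a nonzero multiple of det(s,s'). The obstacle is that such a field
  also disturbs \<open>y\<close>, which may be singular, and there only alternating data can be
  removed. Hence the inclusion of the divergences in \<open>Qh2\<close> is an ingredient of
  surjectivity and is proved before it. All integrals reduce to point values. Products of two
  barycentric coordinates are integrated through the self-similarity of a triangle under midpoint
  subdivision. This yields the midpoint rule for quadratics, and together with Simpson's rule on the
  edges it turns the divergence theorem for cubic fields into finitely many polynomial identities.
  Means are thus read off from the values of a field at vertices and edge midpoints.\<close>

lemma poly2E:
  assumes "poly2 k f"
  obtains c where "f = (\<lambda>p. \<Sum>i\<le>k. \<Sum>j\<le>k - i. c i j * fst p ^ i * snd p ^ j)"
  using assms unfolding poly2_def fun_eq_iff[symmetric] by blast

lemma poly2_add:
  assumes "poly2 k f" "poly2 k g" shows "poly2 k (\<lambda>p. f p + g p)"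
proof -
  obtain c where c: "f = (\<lambda>p. \<Sum>i\<le>k. \<Sum>j\<le>k - i. c i j * fst p ^ i * snd p ^ j)"
    using assms(1) by (rule poly2E)
  obtain d where d: "g = (\<lambda>p. \<Sum>i\<le>k. \<Sum>j\<le>k - i. d i j * fst p ^ i * snd p ^ j)"
    using assms(2) by (rule poly2E)
  show ?thesis unfolding poly2_def c d
    by (intro exI[of _ "\<lambda>i j. c i j + d i j"]) (simp add: sum.distrib algebra_simps)
qed

lemma poly2_cmult:
  assumes "poly2 k f" shows "poly2 k (\<lambda>p. a * f p)"
proof -
  obtain c where c: "f = (\<lambda>p. \<Sum>i\<le>k. \<Sum>j\<le>k - i. c i j * fst p ^ i * snd p ^ j)"
    using assms by (rule poly2E)
  show ?thesis unfolding poly2_def c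
    by (intro exI[of _ "\<lambda>i j. a * c i j"]) (simp add: sum_distrib_left algebra_simps)
qed

lemma poly2_monom:
  assumes "i + j \<le> k" shows "poly2 k (\<lambda>p. a * fst p ^ i * snd p ^ j)"
proof -
  have e: "(if Q then b else 0) * u * w = (if Q then b * u * w else 0)" for Q and b u w :: real by simp
  have s: "(\<Sum>j\<in>J. if Q then h j else 0) = (if Q then sum h J else 0)" for Q J and h :: "nat \<Rightarrow> real" by simp
  have "(\<Sum>i'\<le>k. \<Sum>j'\<le>k - i'. (if i' = i then if j' = j then a else 0 else 0) * x ^ i' * y ^ j')
      = a * x ^ i * y ^ j" for x y :: real
    using assms by (simp add: e s sum.delta cong: if_cong)
  then show ?thesis unfolding poly2_def
    by (intro exI[of _ "\<lambda>i' j'. if i' = i then if j' = j then a else 0 else 0"]) simp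
qed

lemma poly2_const: "poly2 k (\<lambda>p. a)"
  using poly2_monom[of 0 0 k a] by simp

lemma poly2_sum:
  assumes "\<And>i. i \<in> I \<Longrightarrow> poly2 k (f i)" shows "poly2 k (\<lambda>p. \<Sum>i\<in>I. f i p)"
proof (cases "finite I")
  case True then show ?thesis using assms
  proof (induction I)
    case (insert i I)
    then show ?case using poly2_add[of k "f i" "\<lambda>p. \<Sum>i\<in>I. f i p"] by simp
  qed (simp add: poly2_const)
qed (simp add: poly2_const)

lemma poly2_mult:
  assumes "poly2 k f" "poly2 l g" "m = k + l" shows "poly2 m (\<lambda>p. f p * g p)"
proof -
  obtain c where c: "f = (\<lambda>p. \<Sum>i\<le>k. \<Sum>j\<le>k - i. c i j * fst p ^ i * snd p ^ j)"
    using assms(1) by (rule poly2E)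
  obtain d where d: "g = (\<lambda>p. \<Sum>i\<le>l. \<Sum>j\<le>l - i. d i j * fst p ^ i * snd p ^ j)"
    using assms(2) by (rule poly2E)
  have "(\<lambda>p. f p * g p) = (\<lambda>p. \<Sum>i\<le>k. \<Sum>i'\<le>l. \<Sum>j\<le>k - i. \<Sum>j'\<le>l - i'.
       (c i j * d i' j') * fst p ^ (i + i') * snd p ^ (j + j'))"
    unfolding c d sum_product by (intro ext sum.cong refl) (simp add: power_add algebra_simps)
  then show ?thesis using assms(3) by (simp only:) (intro poly2_sum poly2_monom, auto)
qed

lemma poly2_affine: "k \<ge> 1 \<Longrightarrow> poly2 k (\<lambda>p. a + b * fst p + c * snd p)"
  using poly2_add[OF poly2_add[OF poly2_const[of k a] poly2_monom[of 1 0 k b]] poly2_monom[of 0 1 k c]]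
  by simp

lemma poly2_real_polynomial: "poly2 k f \<Longrightarrow> real_polynomial_function f"
proof -
  assume "poly2 k f"
  then obtain c where c: "f = (\<lambda>p. \<Sum>i\<le>k. \<Sum>j\<le>k - i. c i j * fst p ^ i * snd p ^ j)"
    by (rule poly2E)
  have "real_polynomial_function (fst :: pt \<Rightarrow> real)" "real_polynomial_function (snd :: pt \<Rightarrow> real)"
    by (intro real_polynomial_function.intros(1) bounded_linear_fst bounded_linear_snd)+
  then show ?thesis unfolding c
    by (intro real_polynomial_function_sum real_polynomial_function.intros(2,4)
        real_polynomial_function_power) auto
qed

lemma poly2_continuous: "poly2 k f \<Longrightarrow> continuous_on S f"
  by (meson poly2_real_polynomial continuous_real_polymonial_function continuous_at_imp_continuous_on)

lemma poly2_has_derivative: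
  assumes "poly2 (Suc k) f"
  obtains fx fy where "poly2 k fx" "poly2 k fy"
    "\<And>p. (f has_derivative (\<lambda>h. fx p * fst h + fy p * snd h)) (at p)"
proof -
  obtain c where c: "f = (\<lambda>p. \<Sum>i\<le>Suc k. \<Sum>j\<le>Suc k - i. c i j * fst p ^ i * snd p ^ j)"
    using assms by (rule poly2E)
  define fx where "fx p = (\<Sum>i\<le>Suc k. \<Sum>j\<le>Suc k - i. (c i j * real i) * fst p ^ (i - 1) * snd p ^ j)" for p :: pt
  define fy where "fy p = (\<Sum>i\<le>Suc k. \<Sum>j\<le>Suc k - i. (c i j * real j) * fst p ^ i * snd p ^ (j - 1))" for p :: pt
  have "poly2 k (\<lambda>p. (c i j * real i) * fst p ^ (i - 1) * snd p ^ j)"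
    if "i \<le> Suc k" "j \<le> Suc k - i" for i j
    using that by (cases i) (auto simp: poly2_const intro: poly2_monom)
  then have 1: "poly2 k fx" unfolding fx_def by (intro poly2_sum) auto
  have "poly2 k (\<lambda>p. (c i j * real j) * fst p ^ i * snd p ^ (j - 1))"
    if "i \<le> Suc k" "j \<le> Suc k - i" for i j
    using that by (cases j) (auto simp: poly2_const intro!: poly2_monom)
  then have 2: "poly2 k fy" unfolding fy_def by (intro poly2_sum) auto
  have "(f has_derivative (\<lambda>h. fx p * fst h + fy p * snd h)) (at p)" for p
    unfolding c fx_def fy_def sum_distrib_right sum.distrib[symmetric]
    by (intro has_derivative_sum) (auto intro!: derivative_eq_intros simp: algebra_simps)
  then show ?thesis by (rule that[OF 1 2])
qed

section \<open>Divergence of polynomial fields and uniqueness of polynomials\<close>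

lemma divergence_eqI:
  assumes "(g has_derivative D) (at p)"
  shows "divergence g p = fst (D (1, 0)) + snd (D (0, 1))"
proof -
  interpret bounded_linear D using assms has_derivative_bounded_linear by blast
  have 1: "((\<lambda>t. (t, snd p)) has_derivative (\<lambda>t. (t, 0))) (at (fst p))"
    "((\<lambda>t. (fst p, t)) has_derivative (\<lambda>t. (0, t))) (at (snd p))"
    by (auto intro!: derivative_eq_intros)
  have g: "(g has_derivative D) (at (fst p, snd p))" using assms by simp
  have D: "D (t, 0) = t *\<^sub>R D (1, 0)" "D (0, t) = t *\<^sub>R D (0, 1)" for t
    using scaleR[of t "(1, 0)"] scaleR[of t "(0, 1)"] by (simp_all only: scaleR_Pair real_scaleR_def mult_1_right mult_zero_right)
  have e: "(\<lambda>t. fst (D (t, 0))) = (*) (fst (D (1, 0)))" "(\<lambda>t. snd (D (0, t))) = (*) (snd (D (0, 1)))"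
    by (rule ext, subst D, simp)+
  have "((\<lambda>t. fst (g (t, snd p))) has_derivative (\<lambda>t. fst (D (t, 0)))) (at (fst p))"
    by (rule has_derivative_fst[OF has_derivative_compose[OF 1(1) g]])
  then have d1: "((\<lambda>t. fst (g (t, snd p))) has_derivative (*) (fst (D (1, 0)))) (at (fst p))"
    by (subst (asm) e(1))
  have "((\<lambda>t. snd (g (fst p, t))) has_derivative (\<lambda>t. snd (D (0, t)))) (at (snd p))"
    by (rule has_derivative_snd[OF has_derivative_compose[OF 1(2) g]])
  then have d2: "((\<lambda>t. snd (g (fst p, t))) has_derivative (*) (snd (D (0, 1)))) (at (snd p))"
    by (subst (asm) e(2))
  show ?thesis
    unfolding divergence_def DERIV_imp_deriv[OF has_derivative_imp_has_field_derivative[OF d1 mult.commute]]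
      DERIV_imp_deriv[OF has_derivative_imp_has_field_derivative[OF d2 mult.commute]] ..
qed

lemma poly2vec_has_derivative:
  assumes "poly2vec (Suc k) g"
  obtains a b c d where "poly2 k a" "poly2 k b" "poly2 k c" "poly2 k d"
    "\<And>p. (g has_derivative (\<lambda>h. (a p * fst h + b p * snd h, c p * fst h + d p * snd h))) (at p)"
    "\<And>p. divergence g p = a p + d p"
proof -
  have "poly2 (Suc k) (\<lambda>p. fst (g p))" "poly2 (Suc k) (\<lambda>p. snd (g p))"
    using assms by (auto simp: poly2vec_def)
  obtain a b where ab: "poly2 k a" "poly2 k b"
    "\<And>p. ((\<lambda>p. fst (g p)) has_derivative (\<lambda>h. a p * fst h + b p * snd h)) (at p)"
    using poly2_has_derivative[OF \<open>poly2 (Suc k) (\<lambda>p. fst (g p))\<close>] by blast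
  obtain c d where cd: "poly2 k c" "poly2 k d"
    "\<And>p. ((\<lambda>p. snd (g p)) has_derivative (\<lambda>h. c p * fst h + d p * snd h)) (at p)"
    using poly2_has_derivative[OF \<open>poly2 (Suc k) (\<lambda>p. snd (g p))\<close>] by blast
  have D: "(g has_derivative (\<lambda>h. (a p * fst h + b p * snd h, c p * fst h + d p * snd h))) (at p)" for p
    using has_derivative_Pair[OF ab(3) cd(3), of p] by simp
  have "divergence g p = a p + d p" for p
    using divergence_eqI[OF D, of p] by simp
  then show ?thesis by (rule that[OF ab(1,2) cd(1,2) D])
qed

lemma poly2vec3_divergence: "poly2vec 3 g \<Longrightarrow> poly2 2 (divergence g)"
proof -
  assume "poly2vec 3 g"
  then have g: "poly2vec (Suc 2) g" by (simp add: eval_nat_numeral)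
  obtain a d where *: "poly2 2 a" "poly2 2 d" "\<And>p. divergence g p = a p + d p"
    by (rule poly2vec_has_derivative[OF g]) blast
  have "divergence g = (\<lambda>p. a p + d p)" using *(3) by blast
  then show ?thesis using poly2_add[OF *(1,2)] by simp
qed

lemma real_polynomial_function_eq_0:
  assumes "real_polynomial_function (f :: real \<Rightarrow> real)" "infinite {t. f t = 0}"
  shows "f t = 0"
proof -
  obtain a n where an: "f = (\<lambda>x. \<Sum>i\<le>n. a i * x ^ i)"
    using assms(1) real_polynomial_function_iff_sum by metis
  then show ?thesis using assms(2) polyfun_finite_roots[of a n] by auto
qed

text \<open>On the line through a point of \<open>U\<close> and \<open>p\<close> the polynomial
  becomes one in a single variable, with infinitely many zeros near parameter 0; \<open>p\<close> is
  the parameter 1.\<close>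

lemma poly2_eq_0:
  assumes f: "poly2 k f" and "open U" "U \<noteq> {}" and z: "\<And>p. p \<in> U \<Longrightarrow> f p = 0"
  shows "f p = 0"
proof -
  obtain q where q: "q \<in> U" using assms by blast
  let ?l = "\<lambda>t::real. q + t *\<^sub>R (p - q)"
  have "real_polynomial_function (f \<circ> ?l)"
  proof (rule real_polynomial_function_compose)
    show "polynomial_function ?l"
      by (intro polynomial_function_add polynomial_function_const polynomial_function_mult
          polynomial_function_bounded_linear bounded_linear_ident)
    show "real_polynomial_function f" using f by (rule poly2_real_polynomial)
  qed
  moreover have "infinite {t. (f \<circ> ?l) t = 0}"
  proof -
    have "continuous_on UNIV ?l" by (intro continuous_intros)
    then have "open (?l -` U)" using \<open>open U\<close> by (simp add: continuous_on_open_vimage)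
    moreover have "0 \<in> ?l -` U" using q by simp
    ultimately have "infinite (?l -` U)" using finite_imp_not_open by blast
    then show ?thesis by (rule contrapos_nn) (rule finite_subset, auto simp: z)
  qed
  ultimately have "(f \<circ> ?l) 1 = 0" by (rule real_polynomial_function_eq_0)
  then show ?thesis by simp
qed

section \<open>Triangles and barycentric coordinates\<close>

definition det2 :: "pt \<Rightarrow> pt \<Rightarrow> real" where
  "det2 u w = fst u * snd w - snd u * fst w"

definition is_triangle :: "pt set \<Rightarrow> bool" where
  "is_triangle T \<longleftrightarrow> (\<exists>a b c. T = {a, b, c} \<and> det2 (b - a) (c - a) \<noteq> 0)"

text \<open>Barycentric coordinate as a quotient of signed areas. Exchanging \<open>b\<close> and
  \<open>c\<close> changes both signs, so the choice is harmless. The formula makes sense in the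
  whole plane, which is what lets its sign tell the sides of an edge apart.\<close>

definition lam :: "pt set \<Rightarrow> pt \<Rightarrow> pt \<Rightarrow> real" where
  "lam T a p = (SOME r. \<exists>b c. T = {a, b, c} \<and> a \<noteq> b \<and> a \<noteq> c \<and> b \<noteq> c \<and>
      r = det2 (b - p) (c - p) / det2 (b - a) (c - a))"

text \<open>On a triangle \<open>lam T a\<close> is affine, so unit difference quotients give its
  exact gradient.\<close>

definition grad :: "pt set \<Rightarrow> pt \<Rightarrow> pt" where
  "grad T a = (lam T a (1, 0) - lam T a 0, lam T a (0, 1) - lam T a 0)"

lemma det2_distinct:
  assumes "det2 (b - a) (c - a) \<noteq> 0" shows "a \<noteq> b" "a \<noteq> c" "b \<noteq> c"
  using assms by (auto simp: det2_def)

lemma det2_cyclic: "det2 (c - b) (a - b) = det2 (b - a) (c - a)"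
  by (simp add: det2_def algebra_simps)

lemma det2_anti: "det2 u w = - det2 w u"
  by (simp add: det2_def algebra_simps)

lemma lam_eq:
  assumes "det2 (b - a) (c - a) \<noteq> 0"
  shows "lam {a, b, c} a p = det2 (b - p) (c - p) / det2 (b - a) (c - a)"
proof -
  note d = det2_distinct[OF assms]
  have "\<exists>r. \<exists>b' c'. {a, b, c} = {a, b', c'} \<and> a \<noteq> b' \<and> a \<noteq> c' \<and> b' \<noteq> c' \<and>
      r = det2 (b' - p) (c' - p) / det2 (b' - a) (c' - a)"
    using d by blast
  from someI_ex[OF this] obtain b' c' where bc: "{a, b, c} = {a, b', c'}" "a \<noteq> b'" "a \<noteq> c'" "b' \<noteq> c'"
    "lam {a, b, c} a p = det2 (b' - p) (c' - p) / det2 (b' - a) (c' - a)"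
    unfolding lam_def by blast
  then consider "b' = b" "c' = c" | "b' = c" "c' = b" using d by (auto simp: doubleton_eq_iff insert_eq_iff)
  then show ?thesis
  proof cases
    case 2
    then show ?thesis using bc(5) det2_anti[of "c - p"] det2_anti[of "c - a"] by simp
  qed (use bc in simp)
qed

lemma triangle_perm:
  assumes "det2 (b - a) (c - a) \<noteq> 0"
  shows "det2 (c - b) (a - b) \<noteq> 0" "det2 (a - c) (b - c) \<noteq> 0"
    "det2 (c - a) (b - a) \<noteq> 0" "det2 (b - c) (a - c) \<noteq> 0" "det2 (a - b) (c - b) \<noteq> 0"
  using assms by (auto simp: det2_def algebra_simps)

lemma triangleE1:
  assumes "is_triangle T" "a \<in> T"
  obtains b c where "T = {a, b, c}" "det2 (b - a) (c - a) \<noteq> 0"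
proof -
  obtain x y z where T: "T = {x, y, z}" "det2 (y - x) (z - x) \<noteq> 0"
    using assms unfolding is_triangle_def by blast
  consider "a = x" | "a = y" | "a = z" using assms T by auto
  then show ?thesis
  proof cases
    case 1 then show ?thesis using that[of y z] T by auto
  next
    case 2 then show ?thesis using that[of z x] T triangle_perm(1)[OF T(2)] by auto
  next
    case 3 then show ?thesis using that[of x y] T triangle_perm(2)[OF T(2)] by auto
  qed
qed

lemma triangleE2:
  assumes "is_triangle T" "a \<in> T" "b \<in> T" "a \<noteq> b"
  obtains c where "T = {a, b, c}" "det2 (b - a) (c - a) \<noteq> 0"
proof -
  obtain x y where T: "T = {a, x, y}" "det2 (x - a) (y - a) \<noteq> 0"
    using triangleE1[OF assms(1,2)] by blast
  then consider "b = x" | "b = y" using assms by auto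
  then show ?thesis
  proof cases
    case 1 then show ?thesis using that[of y] T by auto
  next
    case 2 then show ?thesis using that[of x] T triangle_perm(3)[OF T(2)] by auto
  qed
qed

lemma triangle_finite: "is_triangle T \<Longrightarrow> finite T"
  unfolding is_triangle_def by auto

lemma triangle_card: "is_triangle T \<Longrightarrow> card T = 3"
  unfolding is_triangle_def using det2_distinct by (elim exE conjE) (simp add: card_insert_if)

lemma lam_vertex:
  assumes "is_triangle T" "a \<in> T" "b \<in> T" shows "lam T a b = (if a = b then 1 else 0)"
proof -
  obtain x y where T: "T = {a, x, y}" "det2 (x - a) (y - a) \<noteq> 0"
    using triangleE1[OF assms(1,2)] by blast
  with lam_eq[OF T(2), of b] assms(3) det2_distinct[OF T(2)] show ?thesis
    by (auto simp: det2_def)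
qed

lemma lam_add:
  assumes "is_triangle T" "a \<in> T" shows "lam T a (p + h) = lam T a p + grad T a \<bullet> h"
proof -
  obtain x y where T: "T = {a, x, y}" "det2 (x - a) (y - a) \<noteq> 0"
    using triangleE1[OF assms(1,2)] by blast
  have "det2 (x - (p + h)) (y - (p + h)) = det2 (x - p) (y - p) +
      (det2 (x - (1, 0)) (y - (1, 0)) - det2 (x - 0) (y - 0)) * fst h +
      (det2 (x - (0, 1)) (y - (0, 1)) - det2 (x - 0) (y - 0)) * snd h"
    by (simp add: det2_def algebra_simps)
  then show ?thesis unfolding grad_def T(1) lam_eq[OF T(2)]
    by (simp add: inner_prod_def add_divide_distrib diff_divide_distrib left_diff_distrib)
qed

lemma lam_diff:
  assumes "is_triangle T" "a \<in> T" shows "lam T a q - lam T a p = grad T a \<bullet> (q - p)"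
  using lam_add[OF assms, of p "q - p"] by simp

lemma lam_form:
  assumes "is_triangle T" "a \<in> T" shows "lam T a = (\<lambda>p. lam T a 0 + grad T a \<bullet> p)"
proof (rule ext)
  show "lam T a p = lam T a 0 + grad T a \<bullet> p" for p using lam_add[OF assms, of 0 p] by simp
qed

lemma lam_affine_comb:
  assumes "is_triangle T" "a \<in> T" "finite I" "sum u I = 1"
  shows "lam T a (\<Sum>i\<in>I. u i *\<^sub>R x i) = (\<Sum>i\<in>I. u i * lam T a (x i))"
proof -
  have l: "lam T a p = lam T a 0 + grad T a \<bullet> p" for p using lam_add[OF assms(1,2), of 0 p] by simp
  have "(\<Sum>i\<in>I. u i * lam T a (x i)) = (\<Sum>i\<in>I. u i) * lam T a 0 + (\<Sum>i\<in>I. u i * (grad T a \<bullet> x i))"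
    by (subst l) (simp add: sum.distrib distrib_left sum_distrib_right)
  also have "\<dots> = lam T a (\<Sum>i\<in>I. u i *\<^sub>R x i)" using assms(4)
    by (subst (2) l) (simp add: inner_sum_right)
  finally show ?thesis by simp
qed

lemma lam_sum_eq:
  assumes "is_triangle T" shows "(\<Sum>a\<in>T. lam T a p) = 1" "(\<Sum>a\<in>T. lam T a p *\<^sub>R a) = p"
proof -
  obtain a b c where T: "T = {a, b, c}" "det2 (b - a) (c - a) \<noteq> 0"
    using assms unfolding is_triangle_def by blast
  note d = det2_distinct[OF T(2)]
  have l: "lam T a p = det2 (b - p) (c - p) / det2 (b - a) (c - a)"
    "lam T b p = det2 (c - p) (a - p) / det2 (b - a) (c - a)"
    "lam T c p = det2 (a - p) (b - p) / det2 (b - a) (c - a)"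
    using lam_eq[OF T(2)] lam_eq[OF triangle_perm(1)[OF T(2)]] lam_eq[OF triangle_perm(2)[OF T(2)]]
    unfolding T(1) by (simp_all add: insert_commute det2_cyclic)
      (simp add: det2_def algebra_simps)
  have "(\<Sum>a\<in>T. lam T a p) = lam T a p + lam T b p + lam T c p"
    unfolding T(1) using d by simp
  also have "\<dots> = (det2 (b - p) (c - p) + det2 (c - p) (a - p) + det2 (a - p) (b - p)) / det2 (b - a) (c - a)"
    unfolding l by (simp add: add_divide_distrib)
  also have "det2 (b - p) (c - p) + det2 (c - p) (a - p) + det2 (a - p) (b - p) = det2 (b - a) (c - a)"
    by (simp add: det2_def algebra_simps)
  finally show "(\<Sum>a\<in>T. lam T a p) = 1" using T(2) by simp
  have "(\<Sum>a\<in>T. lam T a p *\<^sub>R a) = lam T a p *\<^sub>R a + lam T b p *\<^sub>R b + lam T c p *\<^sub>R c"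
    unfolding T(1) using d by simp
  also have "\<dots> = (1 / det2 (b - a) (c - a)) *\<^sub>R
     (det2 (b - p) (c - p) *\<^sub>R a + det2 (c - p) (a - p) *\<^sub>R b + det2 (a - p) (b - p) *\<^sub>R c)"
    unfolding l by (simp add: scaleR_add_right)
  also have "det2 (b - p) (c - p) *\<^sub>R a + det2 (c - p) (a - p) *\<^sub>R b + det2 (a - p) (b - p) *\<^sub>R c
     = det2 (b - a) (c - a) *\<^sub>R p"
    by (rule prod_eqI) (simp_all add: det2_def algebra_simps)
  finally show "(\<Sum>a\<in>T. lam T a p *\<^sub>R a) = p" using T(2) by simp
qed

text \<open>An affine function is determined by its values at the vertices of \<open>T\<close>: this
  is the change of barycentric coordinates between two triangles.\<close>

lemma lam_expand:
  assumes "is_triangle T" "is_triangle T'" "b \<in> T'"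
  shows "lam T' b p = (\<Sum>a\<in>T. lam T a p * lam T' b a)"
  using lam_affine_comb[OF assms(2,3) triangle_finite[OF assms(1)] lam_sum_eq(1)[OF assms(1)], of p "\<lambda>a. a"]
  by (simp add: lam_sum_eq(2)[OF assms(1)])

lemma lam_barycentric:
  assumes "is_triangle T" "a \<in> T" "sum u T = 1"
  shows "lam T a (\<Sum>x\<in>T. u x *\<^sub>R x) = u a"
proof -
  have f: "finite T" using assms(1) by (rule triangle_finite)
  have "lam T a (\<Sum>x\<in>T. u x *\<^sub>R x) = (\<Sum>x\<in>T. u x * lam T a x)"
    by (rule lam_affine_comb[OF assms(1,2) f assms(3)])
  also have "\<dots> = (\<Sum>x\<in>T. if a = x then u x else 0)"
    by (rule sum.cong) (auto simp: lam_vertex[OF assms(1,2)])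
  also have "\<dots> = u a" using f assms(2) by simp
  finally show ?thesis .
qed

lemma in_hull_iff:
  assumes "is_triangle T" shows "p \<in> convex hull T \<longleftrightarrow> (\<forall>a\<in>T. lam T a p \<ge> 0)"
proof
  assume "p \<in> convex hull T"
  then obtain u where u: "\<forall>x\<in>T. 0 \<le> u x" "sum u T = 1" "(\<Sum>x\<in>T. u x *\<^sub>R x) = p"
    using convex_hull_finite[OF triangle_finite[OF assms]] by auto
  have "lam T a p = u a" if "a \<in> T" for a
    using lam_barycentric[OF assms that u(2)] u(3) by simp
  then show "\<forall>a\<in>T. lam T a p \<ge> 0" using u by simp
next
  assume "\<forall>a\<in>T. lam T a p \<ge> 0"
  then show "p \<in> convex hull T"
    unfolding convex_hull_finite[OF triangle_finite[OF assms]] using lam_sum_eq[OF assms, of p]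
    by (intro CollectI exI[of _ "\<lambda>a. lam T a p"] conjI)
qed

lemma lam_continuous: assumes "is_triangle T" "a \<in> T" shows "continuous_on S (lam T a)"
proof -
  show ?thesis by (subst lam_form[OF assms]) (intro continuous_intros)
qed

lemma lam_poly2: assumes "is_triangle T" "a \<in> T" "k \<ge> 1" shows "poly2 k (lam T a)"
proof -
  have l: "lam T a = (\<lambda>p. lam T a 0 + fst (grad T a) * fst p + snd (grad T a) * snd p)"
    by (subst lam_form[OF assms(1,2)]) (simp add: inner_prod_def add.assoc)
  show ?thesis by (subst l) (intro poly2_affine assms)
qed

lemma lam_has_derivative:
  assumes "is_triangle T" "a \<in> T" shows "(lam T a has_derivative (\<lambda>h. grad T a \<bullet> h)) (at p)"
proof -
  show ?thesis by (subst lam_form[OF assms]) (auto intro!: derivative_eq_intros)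
qed

lemma lam_open_pos:
  assumes "is_triangle T" "A \<subseteq> T" shows "open {p. \<forall>a\<in>A. lam T a p > 0}"
proof -
  have "open {p. 0 < lam T a p}" if "a \<in> A" for a
    using lam_continuous[OF assms(1), of a UNIV] that assms(2) by (intro open_Collect_less) auto
  then have "open (\<Inter>a\<in>A. {p. 0 < lam T a p})"
    using triangle_finite[OF assms(1)] finite_subset assms(2) by blast
  also have "(\<Inter>a\<in>A. {p. 0 < lam T a p}) = {p. \<forall>a\<in>A. lam T a p > 0}" by auto
  finally show ?thesis .
qed

lemma triangle_interior:
  assumes "is_triangle T"
  shows "open {p. \<forall>a\<in>T. lam T a p > 0}" "{p. \<forall>a\<in>T. lam T a p > 0} \<noteq> {}"
    "{p. \<forall>a\<in>T. lam T a p > 0} \<subseteq> convex hull T"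
proof -
  show "open {p. \<forall>a\<in>T. lam T a p > 0}" using lam_open_pos[OF assms subset_refl] .
  show "{p. \<forall>a\<in>T. lam T a p > 0} \<subseteq> convex hull T" by (auto simp: in_hull_iff[OF assms] less_imp_le)
  have "lam T a (\<Sum>b\<in>T. (1/3) *\<^sub>R b) = 1 / 3" if "a \<in> T" for a
    using lam_barycentric[OF assms that, of "\<lambda>_. 1/3"] triangle_card[OF assms] by simp
  then have "(\<Sum>b\<in>T. (1/3) *\<^sub>R b) \<in> {p. \<forall>a\<in>T. lam T a p > 0}"
    by (intro CollectI ballI) (simp only: zero_less_divide_1_iff zero_less_numeral)
  then show "{p. \<forall>a\<in>T. lam T a p > 0} \<noteq> {}" by blast
qed

lemma lam_zero_on_face:
  assumes "is_triangle T" "a \<in> T" "S \<subseteq> T" "a \<notin> S" "p \<in> convex hull S"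
  shows "lam T a p = 0"
proof -
  have f: "finite S" using assms triangle_finite finite_subset by blast
  then obtain u where u: "\<forall>x\<in>S. 0 \<le> u x" "sum u S = 1" "(\<Sum>x\<in>S. u x *\<^sub>R x) = p"
    using convex_hull_finite[OF f] assms(5) by auto
  have "lam T a p = (\<Sum>x\<in>S. u x * lam T a x)"
    using lam_affine_comb[OF assms(1,2) f u(2), of "\<lambda>x. x"] u(3) by simp
  also have "\<dots> = 0"
  proof (intro sum.neutral ballI)
    fix x assume "x \<in> S"
    then have "x \<in> T" "a \<noteq> x" using assms by auto
    then show "u x * lam T a x = 0" using lam_vertex[OF assms(1,2)] by simp
  qed
  finally show ?thesis .
qed

section \<open>Collinearity, angles and determinants\<close>

lemma collinear_det2: "collinear {a, b, c} \<longleftrightarrow> det2 (b - a) (c - a) = 0"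
proof -
  have "collinear {a, b, c} \<longleftrightarrow> collinear {0, b - a, c - a}"
    using collinear_3[of b a c] by (simp add: insert_commute)
  also have "\<dots> \<longleftrightarrow> det2 (b - a) (c - a) = 0"
    unfolding collinear_lemma
  proof (cases "b - a = 0 \<or> c - a = 0")
    case True then show "(b - a = 0 \<or> c - a = 0 \<or> (\<exists>k. c - a = k *\<^sub>R (b - a))) = (det2 (b - a) (c - a) = 0)"
      by (auto simp: det2_def)
  next
    case False
    obtain x y z w where xy: "b - a = (x, y)" "c - a = (z, w)" by (metis surj_pair)
    have "x * w = y * z \<longleftrightarrow> (\<exists>k. z = k * x \<and> w = k * y)"
    proof
      assume h: "x * w = y * z"
      show "\<exists>k. z = k * x \<and> w = k * y"
      proof (cases "x = 0")
        case True
        then have "y \<noteq> 0" using False xy by (auto simp: zero_prod_def)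
        then show ?thesis using True h by (intro exI[of _ "w / y"]) auto
      next
        case f: False
        then show ?thesis using h by (intro exI[of _ "z / x"]) (auto simp: field_simps)
      qed
    qed auto
    then show "(b - a = 0 \<or> c - a = 0 \<or> (\<exists>k. c - a = k *\<^sub>R (b - a))) = (det2 (b - a) (c - a) = 0)"
      using False unfolding xy by (auto simp: det2_def scaleR_Pair)
  qed
  finally show ?thesis .
qed

lemma triangleI:
  assumes "card T = 3" "\<not> collinear T" shows "is_triangle T"
proof -
  obtain a b c where "T = {a, b, c}" using assms(1) by (auto simp: card_3_iff)
  then show ?thesis using assms(2) collinear_det2[of a b c] unfolding is_triangle_def by blast
qed

lemma vangle_sym: "vangle x a b = vangle x b a"
  by (simp add: vangle_def inner_commute mult.commute)

lemma tri_angle_eq: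
  assumes "det2 (a - x) (b - x) \<noteq> 0"
  shows "tri_angle {x, a, b} x = vangle x a b"
proof -
  note d = det2_distinct[OF assms]
  have "\<exists>\<phi>. \<exists>a' b'. {x, a, b} = {x, a', b'} \<and> x \<noteq> a' \<and> x \<noteq> b' \<and> a' \<noteq> b' \<and> \<phi> = vangle x a' b'"
    using d by blast
  from someI_ex[OF this] obtain a' b' where ab: "{x, a, b} = {x, a', b'}" "x \<noteq> a'" "x \<noteq> b'" "a' \<noteq> b'"
    "tri_angle {x, a, b} x = vangle x a' b'"
    unfolding tri_angle_def by blast
  then consider "a' = a" "b' = b" | "a' = b" "b' = a" using d by (auto simp: doubleton_eq_iff insert_eq_iff)
  then show ?thesis using ab(5) vangle_sym by cases auto
qed

text \<open>The Lagrange identity in the plane; it turns the sine of \<open>vangle\<close> into a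
  determinant.\<close>

lemma norm_inner_det2: "(norm u * norm w)\<^sup>2 = (u \<bullet> w)\<^sup>2 + (det2 u w)\<^sup>2"
proof -
  have "(norm u * norm w)\<^sup>2 = (u \<bullet> u) * (w \<bullet> w)" by (simp add: power_mult_distrib power2_norm_eq_inner)
  then show ?thesis by (simp add: inner_prod_def det2_def power2_eq_square algebra_simps)
qed

lemma vangle_cos_sin:
  assumes "det2 (a - x) (b - x) \<noteq> 0"
  shows "cos (vangle x a b) = ((a - x) \<bullet> (b - x)) / (norm (a - x) * norm (b - x))"
    "sin (vangle x a b) = \<bar>det2 (a - x) (b - x)\<bar> / (norm (a - x) * norm (b - x))"
    "norm (a - x) * norm (b - x) > 0"
proof -
  define n where "n = norm (a - x) * norm (b - x)"
  define t where "t = ((a - x) \<bullet> (b - x)) / n"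
  show n: "norm (a - x) * norm (b - x) > 0" using det2_distinct[OF assms] by simp
  then have n0: "n > 0" by (simp add: n_def)
  have "\<bar>(a - x) \<bullet> (b - x)\<bar> \<le> n" using Cauchy_Schwarz_ineq2 unfolding n_def by blast
  then have t: "-1 \<le> t" "t \<le> 1" using n0 unfolding t_def by (auto simp: field_simps abs_le_iff)
  then have "cos (arccos t) = t" by (rule cos_arccos)
  then show "cos (vangle x a b) = ((a - x) \<bullet> (b - x)) / (norm (a - x) * norm (b - x))"
    unfolding vangle_def t_def n_def .
  have "1 - t\<^sup>2 = (det2 (a - x) (b - x) / n)\<^sup>2"
  proof -
    have "n\<^sup>2 = ((a - x) \<bullet> (b - x))\<^sup>2 + (det2 (a - x) (b - x))\<^sup>2"
      unfolding n_def by (rule norm_inner_det2)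
    moreover have "n\<^sup>2 / n\<^sup>2 = 1" using n0 by simp
    ultimately have "1 = (((a - x) \<bullet> (b - x))\<^sup>2 + (det2 (a - x) (b - x))\<^sup>2) / n\<^sup>2" by presburger
    then show ?thesis unfolding t_def power_divide by (simp add: add_divide_distrib)
  qed
  then have "sin (arccos t) = \<bar>det2 (a - x) (b - x) / n\<bar>"
    using sin_arccos[OF t] by simp
  then show "sin (vangle x a b) = \<bar>det2 (a - x) (b - x)\<bar> / (norm (a - x) * norm (b - x))"
    unfolding vangle_def t_def n_def using n by (simp add: abs_divide)
qed

lemma tri_angle_cot:
  assumes "det2 (a - x) (b - x) \<noteq> 0"
  shows "cot (tri_angle {x, a, b} x) = ((a - x) \<bullet> (b - x)) / \<bar>det2 (a - x) (b - x)\<bar>"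
  unfolding tri_angle_eq[OF assms] cot_def vangle_cos_sin(1,2)[OF assms] 
  using vangle_cos_sin(3)[OF assms] by simp

text \<open>In the plane \<open>det2 u w *\<^sub>R w' + det2 w w' *\<^sub>R u = det2 u w' *\<^sub>R
  w\<close>, and the right side vanishes here. The sign hypothesis makes the quotient of the other
  two determinants positive.\<close>

lemma collinear_opposite:
  assumes "det2 u w' = 0" "det2 u w * det2 w w' > 0"
  obtains k where "k > 0" "w' = - k *\<^sub>R u"
proof -
  have u0: "det2 u w \<noteq> 0" using assms(2) by auto
  define k where "k = det2 w w' / det2 u w"
  have k: "k > 0" unfolding k_def using assms(2) by (auto simp: zero_less_divide_iff zero_less_mult_iff)
  have "det2 u w *\<^sub>R w' = - det2 w w' *\<^sub>R u"
  proof (rule prod_eqI)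
    show "fst (det2 u w *\<^sub>R w') = fst (- det2 w w' *\<^sub>R u)"
      using assms(1) by (simp add: det2_def) algebra
    show "snd (det2 u w *\<^sub>R w') = snd (- det2 w w' *\<^sub>R u)"
      using assms(1) by (simp add: det2_def) algebra
  qed
  then have "w' = - k *\<^sub>R u" unfolding k_def using u0
    by (metis (no_types, lifting) divide_inverse_commute inverse_eq_divide mult_minus_right right_inverse scaleR_one scaleR_scaleR divide_inverse)
  with k that show ?thesis by blast
qed

text \<open>Cleared of norms, the sine of the sum is
  \<open>det2 u w * (w \<bullet> w') + (u \<bullet> w) * det2 w w'\<close> up to sign, because the
  equal orientations allow both absolute values to be dropped together. That expression equals
  \<open>(w \<bullet> w) * det2 u w'\<close>.\<close>

lemma sin_angle_sum_zero:
  assumes "det2 (a - x) (b - x) * det2 (b - x) (c - x) > 0"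
    and "sin (tri_angle {x, a, b} x + tri_angle {x, b, c} x) = 0"
  shows "det2 (a - x) (c - x) = 0"
proof -
  define u w w' where "u = a - x" "w = b - x" "w' = c - x"
  have d: "det2 (a - x) (b - x) \<noteq> 0" "det2 (b - x) (c - x) \<noteq> 0" using assms(1) by auto
  have pos: "norm u > 0" "norm w > 0" "norm w' > 0"
    using vangle_cos_sin(3)[OF d(1)] vangle_cos_sin(3)[OF d(2)] unfolding u_w_w'_def
    by (auto simp: zero_less_mult_iff)
  have "sin (vangle x a b) * cos (vangle x b c) + cos (vangle x a b) * sin (vangle x b c) = 0"
    using assms(2) unfolding tri_angle_eq[OF d(1)] tri_angle_eq[OF d(2)] sin_add .
  then have "\<bar>det2 u w\<bar> * (w \<bullet> w') + (u \<bullet> w) * \<bar>det2 w w'\<bar> = 0"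
    unfolding vangle_cos_sin(1,2)[OF d(1)] vangle_cos_sin(1,2)[OF d(2)] u_w_w'_def[symmetric]
    using pos by (simp add: field_simps)
  then have "det2 u w * (w \<bullet> w') + (u \<bullet> w) * det2 w w' = 0"
    using assms(1) unfolding u_w_w'_def[symmetric] by (auto simp: abs_if zero_less_mult_iff split: if_splits)
  then have "(w \<bullet> w) * det2 u w' = 0" by (simp add: det2_def inner_prod_def algebra_simps)
  then show ?thesis using pos unfolding u_w_w'_def by simp
qed

section \<open>Conforming meshes\<close>

locale mesh =
  fixes Th :: "pt set set" and \<Omega> :: "pt set"
  assumes conf: "conforming_mesh Th \<Omega>"
begin

lemma tri: "T \<in> Th \<Longrightarrow> is_triangle T"
  by (rule triangleI) (use conf in \<open>simp_all add: conforming_mesh_def\<close>)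

lemma finite_Th: "finite Th" and Th_nonempty: "Th \<noteq> {}" and Omega_eq: "\<Omega> = interior (\<Union>T\<in>Th. convex hull T)"
  and Omega_connected: "connected \<Omega>"
  using conf unfolding conforming_mesh_def by blast+

lemma hull_inter: "\<lbrakk>T \<in> Th; T' \<in> Th; T \<noteq> T'\<rbrakk> \<Longrightarrow> convex hull T \<inter> convex hull T' = convex hull (T \<inter> T')"
  using conf unfolding conforming_mesh_def by blast

lemma Omega_open: "open \<Omega>" by (simp add: Omega_eq)

lemma compact_hull: "T \<in> Th \<Longrightarrow> compact (convex hull T)"
  by (simp add: finite_imp_compact_convex_hull tri triangle_finite)

lemma open_triangle_in_Omega: 
  assumes "T \<in> Th" "\<And>a. a \<in> T \<Longrightarrow> lam T a p > 0" shows "p \<in> \<Omega>"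
proof -
  have "{p. \<forall>a\<in>T. lam T a p > 0} \<subseteq> \<Omega>" unfolding Omega_eq
    using triangle_interior[OF tri[OF assms(1)]] assms(1) by (intro interior_maximal) auto
  then show ?thesis using assms by auto
qed

lemma closure_Omega: "closure \<Omega> = (\<Union>T\<in>Th. convex hull T)"
proof
  have "closed (\<Union>T\<in>Th. convex hull T)"
    using finite_Th compact_hull compact_imp_closed by (intro closed_UN) auto
  then show "closure \<Omega> \<subseteq> (\<Union>T\<in>Th. convex hull T)"
    unfolding Omega_eq by (intro closure_minimal interior_subset)
  show "(\<Union>T\<in>Th. convex hull T) \<subseteq> closure \<Omega>"
  proof (rule UN_least)
    fix T assume T: "T \<in> Th"
    have "interior (convex hull T) \<noteq> {}"
      using triangle_interior[OF tri[OF T]] interior_maximal by blast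
    then have "convex hull T \<subseteq> closure (interior (convex hull T))"
      using convex_closure_interior[OF convex_convex_hull] closure_subset by blast
    also have "\<dots> \<subseteq> closure \<Omega>" unfolding Omega_eq using T by (intro closure_mono interior_mono) auto
    finally show "convex hull T \<subseteq> closure \<Omega>" .
  qed
qed

section \<open>Triangles meeting along an edge; boundary and interior edges\<close>

lemma shared_edge_inter:
  assumes "{a, b, c} \<in> Th" "{a, b, d} \<in> Th" "c \<noteq> d"
    "det2 (b - a) (c - a) \<noteq> 0" "det2 (b - a) (d - a) \<noteq> 0"
  shows "{a, b, c} \<inter> {a, b, d} = {a, b}"
  using assms det2_distinct[OF assms(4)] det2_distinct[OF assms(5)] by auto

text \<open>Both coordinates vanish on the line through \<open>a\<close> and \<open>b\<close>, so
  these affine functions are proportional; evaluation at \<open>d\<close> gives the factor.\<close>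

lemma edge_expand:
  assumes "{a, b, c} \<in> Th" "{a, b, d} \<in> Th"
    "det2 (b - a) (c - a) \<noteq> 0" "det2 (b - a) (d - a) \<noteq> 0"
  shows "lam {a, b, c} c p = lam {a, b, c} c d * lam {a, b, d} d p"
proof -
  have z: "lam {a, b, c} c a = 0" "lam {a, b, c} c b = 0"
    using lam_vertex[OF tri[OF assms(1)], of c] det2_distinct[OF assms(3)] by auto
  show ?thesis
    using lam_expand[OF tri[OF assms(2)] tri[OF assms(1)], of c p] det2_distinct[OF assms(4)] z by simp
qed

text \<open>If \<open>d\<close> lay on the side of \<open>c\<close>, a point slightly off the
  midpoint of the edge in the direction of \<open>d\<close> would belong to both triangles without
  lying on the common edge, against conformity.\<close>

lemma opposite_sides:
  assumes "{a, b, c} \<in> Th" "{a, b, d} \<in> Th" "c \<noteq> d"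
    "det2 (b - a) (c - a) \<noteq> 0" "det2 (b - a) (d - a) \<noteq> 0"
  shows "lam {a, b, c} c d < 0"
proof (rule ccontr)
  let ?T = "{a, b, c}" and ?T' = "{a, b, d}"
  note t = tri[OF assms(1)] and t' = tri[OF assms(2)]
  note dc = det2_distinct[OF assms(4)] and dd = det2_distinct[OF assms(5)]
  have ne: "?T \<noteq> ?T'" using assms(3) dc dd by (auto simp: insert_eq_iff)
  assume "\<not> lam ?T c d < 0"
  moreover have "lam ?T c d \<noteq> 0"
    using edge_expand[OF assms(1,2,4,5), of c] lam_vertex[OF t, of c c] by auto
  ultimately have pos: "lam ?T c d > 0" by simp
  define m where "m = (1/2) *\<^sub>R (a + b)"
  have lm: "lam ?T a m = 1/2" "lam ?T b m = 1/2" "lam ?T c m = 0"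
    using lam_affine_comb[OF t _, of _ "{a, b}" "\<lambda>_. 1/2" "\<lambda>x. x"] dc lam_vertex[OF t]
    unfolding m_def by (simp_all add: scaleR_add_right)
  have lm': "lam ?T' a m = 1/2" "lam ?T' b m = 1/2" "lam ?T' d m = 0"
    using lam_affine_comb[OF t' _, of _ "{a, b}" "\<lambda>_. 1/2" "\<lambda>x. x"] dd lam_vertex[OF t']
    unfolding m_def by (simp_all add: scaleR_add_right)
  \<comment> \<open>At the midpoint the coordinates for \<open>a\<close> and \<open>b\<close> are
    1/2. This step size changes each by at most 1/8 + 1/4, so they stay positive.\<close>
  define e where "e = 1 / (4 * (1 + \<bar>lam ?T a d\<bar> + \<bar>lam ?T b d\<bar>))"
  have e: "0 < e" "e \<le> 1/4" "e * \<bar>lam ?T a d\<bar> \<le> 1/4" "e * \<bar>lam ?T b d\<bar> \<le> 1/4"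
    unfolding e_def by (auto simp: field_simps)
  define p where "p = m + e *\<^sub>R (d - m)"
  have lp: "lam S x p = (1 - e) * lam S x m + e * lam S x d" if "is_triangle S" "x \<in> S" for S x
  proof -
    have "lam S x p = lam S x m + e * (lam S x d - lam S x m)"
      using lam_add[OF that, of m "e *\<^sub>R (d - m)"] lam_diff[OF that, of d m] unfolding p_def by simp
    then show ?thesis by (simp add: algebra_simps)
  qed
  have "e * \<bar>lam ?T a d\<bar> = \<bar>e * lam ?T a d\<bar>" "e * \<bar>lam ?T b d\<bar> = \<bar>e * lam ?T b d\<bar>"
    using e(1) by (simp_all add: abs_mult)
  then have ge: "e * lam ?T a d \<ge> - (1/4)" "e * lam ?T b d \<ge> - (1/4)" using e(3,4) by linarith+
  have "lam ?T a p = 1/2 - e/2 + e * lam ?T a d" using lp[OF t, of a] unfolding lm by (simp add: field_simps)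
  then have "lam ?T a p \<ge> 0" using ge e(2) by linarith
  moreover have "lam ?T b p = 1/2 - e/2 + e * lam ?T b d" using lp[OF t, of b] unfolding lm by (simp add: field_simps)
  then have "lam ?T b p \<ge> 0" using ge e(2) by linarith
  moreover have "lam ?T c p \<ge> 0" using lp[OF t, of c] e pos unfolding lm by simp
  ultimately have "p \<in> convex hull ?T" unfolding in_hull_iff[OF t] by simp
  moreover have "lam ?T' a p = (1 - e) * (1/2)" "lam ?T' b p = (1 - e) * (1/2)" "lam ?T' d p = e"
    using lp[OF t', of a] lp[OF t', of b] lp[OF t', of d] lam_vertex[OF t', of _ d] dd unfolding lm' by simp_all
  then have "p \<in> convex hull ?T'" unfolding in_hull_iff[OF t'] using e by simp
  ultimately have "p \<in> convex hull {a, b}"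
    using hull_inter[OF assms(1,2) ne] shared_edge_inter[OF assms] by auto
  then have "lam ?T c p = 0" using dc by (intro lam_zero_on_face[OF t]) auto
  moreover have "lam ?T c p > 0" using lp[OF t, of c] lm e pos by simp
  ultimately show False by simp
qed

lemma shared_edge_triangles:
  assumes "T \<in> Th" "T' \<in> Th" "T \<noteq> T'" "a \<noteq> b" "{a, b} \<subseteq> T" "{a, b} \<subseteq> T'"
  obtains c d where "T = {a, b, c}" "T' = {a, b, d}" "c \<noteq> d"
    "det2 (b - a) (c - a) \<noteq> 0" "det2 (b - a) (d - a) \<noteq> 0" "lam T c d < 0"
proof -
  obtain c where c: "T = {a, b, c}" "det2 (b - a) (c - a) \<noteq> 0"
    using triangleE2[OF tri[OF assms(1)], of a b] assms by auto
  obtain d where d: "T' = {a, b, d}" "det2 (b - a) (d - a) \<noteq> 0"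
    using triangleE2[OF tri[OF assms(2)], of a b] assms by auto
  have "c \<noteq> d" using assms(3) c d by auto
  then show ?thesis using that[OF c(1) d(1) _ c(2) d(2)] opposite_sides[of a b c d] assms c d by auto
qed

text \<open>The opposite vertices of three triangles on one edge would lie pairwise on opposite
  sides. But \<open>lam T1 c1 c3\<close> is the product of \<open>lam T1 c1 c2\<close> and
  \<open>lam T2 c2 c3\<close>, and the three numbers cannot all be negative.\<close>

lemma at_most_two:
  assumes "T1 \<in> Th" "T2 \<in> Th" "T3 \<in> Th" "a \<noteq> b" "{a, b} \<subseteq> T1" "{a, b} \<subseteq> T2" "{a, b} \<subseteq> T3"
    "T1 \<noteq> T2" "T1 \<noteq> T3"
  shows "T2 = T3"
proof (rule ccontr)
  assume "T2 \<noteq> T3"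
  obtain c1 c2 where 1: "T1 = {a, b, c1}" "T2 = {a, b, c2}" "c1 \<noteq> c2"
    "det2 (b - a) (c1 - a) \<noteq> 0" "det2 (b - a) (c2 - a) \<noteq> 0" "lam T1 c1 c2 < 0"
    using shared_edge_triangles[OF assms(1,2,8,4-6)] by metis
  obtain c3 where 3: "T3 = {a, b, c3}" "det2 (b - a) (c3 - a) \<noteq> 0"
    using triangleE2[OF tri[OF assms(3)], of a b] assms by auto
  have "c1 \<noteq> c3" "c2 \<noteq> c3" using \<open>T2 \<noteq> T3\<close> assms 1 3 by auto
  then have "lam T1 c1 c3 < 0" "lam T2 c2 c3 < 0"
    using opposite_sides[of a b c1 c3] opposite_sides[of a b c2 c3] assms 1 3 by auto
  moreover have "lam T1 c1 c3 = lam T1 c1 c2 * lam T2 c2 c3"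
    using edge_expand[of a b c1 c2 c3] assms 1 by auto
  ultimately show False using 1(6) mult_neg_neg[of "lam T1 c1 c2" "lam T2 c2 c3"] by simp
qed

text \<open>The only delicate points are those on the edge itself, where the two triangles together
  cover a neighbourhood.\<close>

lemma shared_edge_in_Omega:
  assumes "T \<in> Th" "T' \<in> Th" "T \<noteq> T'" "a \<noteq> b" "{a, b} \<subseteq> T" "{a, b} \<subseteq> T'"
    "p \<in> convex hull T" "lam T a p > 0" "lam T b p > 0"
  shows "p \<in> \<Omega>"
proof -
  obtain c d where cd: "T = {a, b, c}" "T' = {a, b, d}" "c \<noteq> d"
    "det2 (b - a) (c - a) \<noteq> 0" "det2 (b - a) (d - a) \<noteq> 0" "lam T c d < 0"
    using shared_edge_triangles[OF assms(1-6)] by metis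
  note t = tri[OF assms(1)] and t' = tri[OF assms(2)]
  note dc = det2_distinct[OF cd(4)] and dd = det2_distinct[OF cd(5)]
  consider "lam T c p > 0" | "lam T c p = 0" using assms(7) cd in_hull_iff[OF t] by fastforce
  then show ?thesis
  proof cases
    case 1
    then have "lam T x p > 0" if "x \<in> T" for x using that assms(8,9) unfolding cd(1) by auto
    then show ?thesis using open_triangle_in_Omega[OF assms(1)] by blast
  next
    case 2
    have ex: "lam T c q = lam T c d * lam T' d q" for q
      using edge_expand[of a b c d q] assms cd by auto
    have "lam T' x p = lam T x p" if "x \<in> {a, b}" for x
    proof -
      have "lam T' x p = (\<Sum>y\<in>{a, b, c}. lam T y p * lam T' x y)"
        using lam_expand[OF t t', of x p] that cd by auto
      also have "\<dots> = lam T a p * lam T' x a + lam T b p * lam T' x b" using 2 dc by simp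
      also have "\<dots> = lam T x p"
        using that dc lam_vertex[OF t', of x a] lam_vertex[OF t', of x b] cd(2) by auto
      finally show ?thesis .
    qed
    then have p': "lam T' a p > 0" "lam T' b p > 0" using assms by auto
    \<comment> \<open>On this open set only the third coordinates can be negative. As
      \<open>lam T c\<close> is a negative multiple of \<open>lam T' d\<close>, every point lies in
      one of the two triangles.\<close>
    define V where "V = {q. \<forall>x\<in>{a, b}. lam T x q > 0} \<inter> {q. \<forall>x\<in>{a, b}. lam T' x q > 0}"
    have "open V" unfolding V_def using lam_open_pos[OF t assms(5)] lam_open_pos[OF t' assms(6)] by (rule open_Int)
    moreover have "V \<subseteq> (\<Union>T\<in>Th. convex hull T)"
    proof
      fix q assume q: "q \<in> V"
      show "q \<in> (\<Union>T\<in>Th. convex hull T)"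
      proof (cases "lam T c q \<ge> 0")
        case True
        then have "q \<in> convex hull T" using q unfolding V_def in_hull_iff[OF t] by (auto simp: cd(1))
        then show ?thesis using assms by auto
      next
        case False
        then have "lam T' d q > 0" using ex[of q] cd(6) by (auto simp: zero_less_mult_iff mult_less_0_iff not_le)
        then have "q \<in> convex hull T'" using q unfolding V_def in_hull_iff[OF t'] by (auto simp: cd(2))
        then show ?thesis using assms by auto
      qed
    qed
    moreover have "p \<in> V" using p' assms unfolding V_def by auto
    ultimately show ?thesis unfolding Omega_eq using interior_maximal by blast
  qed
qed

lemma segment_lam:
  assumes "T \<in> Th" "{a, b} \<subseteq> T" "a \<noteq> b" "p \<in> open_segment a b"
  shows "p \<in> convex hull T" "lam T a p > 0" "lam T b p > 0" "\<And>c. c \<in> T \<Longrightarrow> c \<noteq> a \<Longrightarrow> c \<noteq> b \<Longrightarrow> lam T c p = 0"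
proof -
  note t = tri[OF assms(1)]
  obtain u where u: "0 < u" "u < 1" "p = (1 - u) *\<^sub>R a + u *\<^sub>R b" using assms(4) by (auto simp: in_segment)
  have l: "lam T c p = (1 - u) * lam T c a + u * lam T c b" if "c \<in> T" for c
    using lam_affine_comb[OF t that, of "{a, b}" "\<lambda>x. if x = a then 1 - u else u" "\<lambda>x. x"] assms(3) u(3) by auto
  show "lam T a p > 0" "lam T b p > 0"
    using l[of a] l[of b] assms u lam_vertex[OF t, of a] lam_vertex[OF t, of b] by auto
  show z: "lam T c p = 0" if "c \<in> T" "c \<noteq> a" "c \<noteq> b" for c
    using l[of c] that assms lam_vertex[OF t, of c] by auto
  show "p \<in> convex hull T" unfolding in_hull_iff[OF t]
    using \<open>lam T a p > 0\<close> \<open>lam T b p > 0\<close> z by (metis less_imp_le order_refl)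
qed

text \<open>Near a relative interior point of the edge no other triangle is present. Were that point
  in the open domain, a ball around it would lie in \<open>T\<close>, yet moving away from the
  opposite vertex leaves \<open>T\<close> at once. The endpoints follow by closedness of the
  frontier.\<close>

lemma boundary_edge:
  assumes "T \<in> Th" "{a, b} \<subseteq> T" "a \<noteq> b" "\<And>S. S \<in> Th \<Longrightarrow> {a, b} \<subseteq> S \<Longrightarrow> S = T"
  shows "closed_segment a b \<subseteq> frontier \<Omega>"
proof -
  note t = tri[OF assms(1)]
  obtain c where c: "T = {a, b, c}" "det2 (b - a) (c - a) \<noteq> 0"
    using triangleE2[OF t, of a b] assms(2,3) by auto
  note dc = det2_distinct[OF c(2)]
  have "p \<in> frontier \<Omega>" if p: "p \<in> open_segment a b" for p
  proof -
    note l = segment_lam[OF assms(1-3) p]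
    have other: "p \<notin> convex hull S" if S: "S \<in> Th" "S \<noteq> T" for S
    proof
      assume "p \<in> convex hull S"
      then have pS: "p \<in> convex hull (T \<inter> S)" using hull_inter[OF assms(1) S(1)] S l(1) by auto
      consider "a \<notin> S" | "b \<notin> S" using assms(4)[OF S(1)] S(2) by blast
      then show False
      proof cases
        case 1 then show False using lam_zero_on_face[OF t _ _ _ pS, of a] l(2) assms(2) by auto
      next
        case 2 then show False using lam_zero_on_face[OF t _ _ _ pS, of b] l(3) assms(2) by auto
      qed
    qed
    have "p \<notin> \<Omega>"
    proof
      assume pO: "p \<in> \<Omega>"
      \<comment> \<open>An open neighbourhood of \<open>p\<close> that only \<open>T\<close> can
        cover.\<close>
      define W where "W = \<Omega> - (\<Union>S\<in>Th - {T}. convex hull S)"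
      have "open W" unfolding W_def using Omega_open finite_Th compact_hull compact_imp_closed
        by (intro open_Diff closed_UN) auto
      moreover have "p \<in> W" unfolding W_def using pO other by auto
      moreover have "W \<subseteq> convex hull T"
        unfolding W_def using Omega_eq interior_subset[of "\<Union>T\<in>Th. convex hull T"] by auto
      ultimately obtain e where e: "e > 0" "ball p e \<subseteq> convex hull T"
        by (meson open_contains_ball subset_trans)
      define s where "s = e / (2 * (norm (c - p) + 1))"
      have s: "s > 0" using e unfolding s_def by (simp add: add_nonneg_pos)
      have n1: "norm (c - p) + 1 > 0" by (simp add: add_nonneg_pos)
      have "s * norm (c - p) \<le> s * (norm (c - p) + 1)" using s by simp
      also have "\<dots> = e / 2" unfolding s_def using n1 by (simp add: field_simps)
      also have "\<dots> < e" using e by simp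
      finally have "p + (- s) *\<^sub>R (c - p) \<in> ball p e" using s by (simp add: dist_norm)
      then have "lam T c (p + (- s) *\<^sub>R (c - p)) \<ge> 0" using e in_hull_iff[OF t] c by blast
      moreover have "lam T c (p + (- s) *\<^sub>R (c - p)) = lam T c p - s * (lam T c c - lam T c p)"
        using lam_add[OF t, of c p "(- s) *\<^sub>R (c - p)"] lam_diff[OF t, of c c p] c by simp
      moreover have "lam T c p = 0" "lam T c c = 1" using l(4)[of c] c dc lam_vertex[OF t, of c c] by auto
      ultimately show False using s by simp
    qed
    moreover have "p \<in> closure \<Omega>" unfolding closure_Omega using l(1) assms(1) by auto
    ultimately show ?thesis unfolding frontier_def using Omega_open by (simp add: interior_open)
  qed
  then have "closure (open_segment a b) \<subseteq> frontier \<Omega>" by (intro closure_minimal) auto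
  then show ?thesis using assms(3) by simp
qed

lemma shared_edge_not_frontier:
  assumes "T \<in> Th" "T' \<in> Th" "T \<noteq> T'" "a \<noteq> b" "{a, b} \<subseteq> T" "{a, b} \<subseteq> T'"
  shows "\<not> closed_segment a b \<subseteq> frontier \<Omega>"
proof -
  have m: "midpoint a b \<in> open_segment a b" using assms(4) by simp
  note l = segment_lam[OF assms(1,5,4) m]
  have "midpoint a b \<in> \<Omega>" using shared_edge_in_Omega[OF assms l(1-3)] .
  then have "midpoint a b \<notin> frontier \<Omega>" using Omega_open by (simp add: frontier_def interior_open)
  then show ?thesis using m open_closed_segment by blast
qed

lemma interior_edge_two:
  assumes "{a, b} \<in> interior_edges Th \<Omega>"
  obtains T T' where "a \<noteq> b" "T \<in> Th" "T' \<in> Th" "T \<noteq> T'" "{S \<in> Th. {a, b} \<subseteq> S} = {T, T'}"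
proof -
  have ab: "a \<noteq> b" "\<exists>T\<in>Th. {a, b} \<subseteq> T" "\<not> closed_segment a b \<subseteq> frontier \<Omega>"
    using assms unfolding interior_edges_def by (auto simp: doubleton_eq_iff closed_segment_commute)
  then obtain T where T: "T \<in> Th" "{a, b} \<subseteq> T" by blast
  obtain T' where T': "T' \<in> Th" "{a, b} \<subseteq> T'" "T' \<noteq> T" using boundary_edge[OF T ab(1)] ab(3) by blast
  have "{S \<in> Th. {a, b} \<subseteq> S} = {T, T'}"
  proof
    show "{S \<in> Th. {a, b} \<subseteq> S} \<subseteq> {T, T'}"
      using at_most_two[OF T(1) T'(1) _ ab(1) T(2) T'(2)] T'(3) by blast
  qed (use T T' in auto)
  then show ?thesis using that ab T T' by blast
qed

end

section \<open>Integration over triangles\<close>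

text \<open>Carries the formula \<open>content_triangle\<close>, which is about
  \<open>real^2\<close>, over to pairs of reals.\<close>

lemma lborel_pair_vec2: "(lborel :: pt measure) = distr lborel borel (\<lambda>v::real^2. (v $ 1, v $ 2))"
proof (rule lborel_eqI)
  fix l u :: pt
  assume le: "\<And>b. b \<in> Basis \<Longrightarrow> l \<bullet> b \<le> u \<bullet> b"
  have le': "fst l \<le> fst u" "snd l \<le> snd u" using le[of "(1, 0)"] le[of "(0, 1)"] by (auto simp: Basis_prod_def inner_prod_def)
  have B: "(Basis :: (real^2) set) = {axis 1 1, axis 2 1}" by (auto simp: Basis_vec_def UNIV_2)
  have m: "(\<lambda>v::real^2. (v $ 1, v $ 2)) \<in> borel_measurable lborel"
    by (subst measurable_lborel2) (intro borel_measurable_continuous_onI continuous_intros)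
  have "(\<lambda>v::real^2. (v $ 1, v $ 2)) -` box l u = box (vector [fst l, snd l]) (vector [fst u, snd u])"
    by (auto simp: mem_box_cart mem_box Basis_prod_def forall_2 inner_prod_def)
  then have "emeasure (distr lborel borel (\<lambda>v::real^2. (v $ 1, v $ 2))) (box l u)
     = emeasure lborel (box (vector [fst l, snd l]) (vector [fst u, snd u] :: real^2))"
    using m by (simp add: emeasure_distr)
  also have "\<dots> = (\<Prod>b\<in>Basis. (vector [fst u, snd u] - vector [fst l, snd l] :: real^2) \<bullet> b)"
    using le' by (subst emeasure_lborel_box) (auto simp: B inner_axis)
  also have "(\<Prod>b\<in>Basis. (vector [fst u, snd u] - vector [fst l, snd l] :: real^2) \<bullet> b)
     = (fst u - fst l) * (snd u - snd l)"
    by (simp add: B axis_eq_axis inner_axis)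
  also have "\<dots> = (\<Prod>b\<in>Basis. (u - l) \<bullet> b)"
    by (simp add: Basis_prod_def prod.union_disjoint inner_prod_def prod.reindex) 
  finally show "emeasure (distr lborel borel (\<lambda>v::real^2. (v $ 1, v $ 2))) (box l u) = (\<Prod>b\<in>Basis. (u - l) \<bullet> b)" .
qed simp

lemma content_hull_triangle: "measure lborel (convex hull {a, b, c}) = \<bar>det2 (b - a) (c - a)\<bar> / 2"
proof -
  let ?f = "\<lambda>v::real^2. (v $ 1, v $ 2)" and ?g = "\<lambda>p. vector [fst p, snd p] :: real^2"
  have gf: "?g (?f v) = v" "?f (?g p) = p" for v p by (simp_all add: vec_eq_iff forall_2)
  have lin: "linear ?g" by (intro linearI) (simp_all add: vec_eq_iff forall_2)
  have m: "?f \<in> borel_measurable lborel" by (subst measurable_lborel2) (intro borel_measurable_continuous_onI continuous_intros)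
  have K: "convex hull {a, b, c} \<in> sets borel"
    by (intro borel_closed compact_imp_closed finite_imp_compact_convex_hull) auto
  have "?f -` (convex hull {a, b, c}) = ?g ` (convex hull {a, b, c})"
    using gf by (auto simp: image_iff) (metis gf(1))
  also have "\<dots> = convex hull {?g a, ?g b, ?g c}" using convex_hull_linear_image[OF lin, of "{a, b, c}"] by simp
  finally have "measure lborel (convex hull {a, b, c}) = measure lborel (convex hull {?g a, ?g b, ?g c})"
    using m K by (subst lborel_pair_vec2) (simp add: measure_distr)
  then show ?thesis unfolding content_triangle by (simp add: det2_def algebra_simps abs_minus_commute)
qed

lemma compact_integral_lebesgue:
  fixes F :: "pt \<Rightarrow> real"
  assumes "compact K" "continuous_on K F"
  shows "F integrable_on K" "integral K F = (LINT p|lborel. indicator K p *\<^sub>R F p)"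
  using set_borel_integral_eq_integral[of K F] borel_integrable_compact[OF assms]
  by (simp_all add: set_integrable_def set_lebesgue_integral_def)

text \<open>The factor \<open>m\<close> may be negative, as the reflected central triangle of the
  subdivision requires; the Jacobian in the plane is \<open>m\<^sup>2\<close> either way.\<close>

lemma integral_affine_image:
  fixes F :: "pt \<Rightarrow> real"
  assumes "compact K" "continuous_on UNIV F" "m \<noteq> 0"
  shows "integral ((\<lambda>p. t + m *\<^sub>R p) ` K) F = m\<^sup>2 * integral K (\<lambda>p. F (t + m *\<^sub>R p))"
proof -
  let ?h = "\<lambda>p. t + m *\<^sub>R p"
  have inj: "inj ?h" using assms(3) by (auto intro: injI)
  have cK: "compact (?h ` K)" by (intro compact_continuous_image continuous_intros assms)
  have mK: "?h ` K \<in> sets borel" using cK compact_imp_closed by (intro borel_closed) auto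
  have F: "F \<in> borel_measurable borel" using assms(2) by (rule borel_measurable_continuous_onI)
  have meas: "(\<lambda>p. indicator (?h ` K) p *\<^sub>R F p) \<in> borel_measurable borel" using F mK by measurable
  have "integral (?h ` K) F = (LINT p|lborel. indicator (?h ` K) p *\<^sub>R F p)"
    using compact_integral_lebesgue[OF cK] assms(2) continuous_on_subset by blast
  also have "\<dots> = (LINT p|density (distr lborel borel ?h) (\<lambda>_. ennreal (\<bar>m\<bar> ^ 2)). indicator (?h ` K) p *\<^sub>R F p)"
    by (subst lborel_affine[OF assms(3), of t]) (simp add: power2_eq_square)
  also have "\<dots> = (LINT p|distr lborel borel ?h. (\<bar>m\<bar> ^ 2) *\<^sub>R (indicator (?h ` K) p *\<^sub>R F p))"
    using meas by (intro integral_density) auto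
  also have "\<dots> = (LINT p|lborel. (\<bar>m\<bar> ^ 2) *\<^sub>R (indicator (?h ` K) (?h p) *\<^sub>R F (?h p)))"
    using meas by (intro integral_distr) auto
  also have "\<dots> = m\<^sup>2 * (LINT p|lborel. indicator K p *\<^sub>R F (?h p))"
  proof -
    have "indicator (?h ` K) (?h p) = (indicator K p :: real)" for p
      using inj_image_mem_iff[OF inj, of p K] by (simp add: indicator_def)
    then show ?thesis by simp
  qed
  also have "\<dots> = m\<^sup>2 * integral K (\<lambda>p. F (?h p))"
    using compact_integral_lebesgue(2)[OF assms(1), of "\<lambda>p. F (?h p)"]
      continuous_on_compose2[OF assms(2), of K ?h] by (simp add: continuous_intros)
  finally show ?thesis .
qed

lemma grad_nonzero:
  assumes "is_triangle T" "a \<in> T" shows "grad T a \<noteq> 0"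
proof -
  obtain b c where T: "T = {a, b, c}" "det2 (b - a) (c - a) \<noteq> 0" using triangleE1[OF assms] by blast
  have "grad T a \<bullet> (a - b) = 1"
    using lam_diff[OF assms, of a b] lam_vertex[OF assms, of a] lam_vertex[OF assms, of b] T det2_distinct[OF T(2)] by simp
  then show ?thesis by auto
qed

lemma lam_level_negligible:
  assumes "is_triangle T" "a \<in> T" shows "negligible {p. lam T a p = r}"
proof -
  have "{p. lam T a p = r} = {p. grad T a \<bullet> p = r - lam T a 0}"
    by (subst lam_form[OF assms]) auto
  then show ?thesis using negligible_hyperplane[of "grad T a" "r - lam T a 0"] grad_nonzero[OF assms] by simp
qed

section \<open>Midpoint subdivision and exact integration of quadratics\<close>

lemma lam_homothety:
  assumes "is_triangle T" "a \<in> T" "x \<in> T"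
  shows "lam T a ((1/2) *\<^sub>R x + (1/2) *\<^sub>R p) = ((if a = x then 1 else 0) + lam T a p) / 2"
proof -
  have "(1/2) *\<^sub>R x + (1/2) *\<^sub>R p = x + (1/2) *\<^sub>R (p - x)"
    by (rule prod_eqI) (simp_all add: field_simps)
  then have "lam T a ((1/2) *\<^sub>R x + (1/2) *\<^sub>R p) = lam T a x + (1/2) * (lam T a p - lam T a x)"
    using lam_add[OF assms(1,2), of x "(1/2) *\<^sub>R (p - x)"] lam_diff[OF assms(1,2), of p x] by simp
  then show ?thesis using lam_vertex[OF assms] by (simp add: field_simps)
qed

lemma lam_central:
  assumes "is_triangle T" "a \<in> T"
  shows "lam T a ((1/2) *\<^sub>R (\<Sum>T) + (-1/2) *\<^sub>R p) = (1 - lam T a p) / 2"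
proof -
  have s: "sum (\<lambda>x. 1/2 - lam T x p / 2) T = 1"
    using lam_sum_eq(1)[OF assms(1), of p] triangle_card[OF assms(1)]
    by (simp add: sum_subtractf flip: sum_divide_distrib)
  have "(\<Sum>x\<in>T. (1/2 - lam T x p / 2) *\<^sub>R x) = (1/2) *\<^sub>R (\<Sum>T) + (-1/2) *\<^sub>R (\<Sum>x\<in>T. lam T x p *\<^sub>R x)"
    by (simp add: scaleR_diff_left sum_subtractf scaleR_sum_right sum_negf)
  also have "(\<Sum>x\<in>T. lam T x p *\<^sub>R x) = p" by (rule lam_sum_eq(2)[OF assms(1)])
  finally have "lam T a ((1/2) *\<^sub>R (\<Sum>T) + (-1/2) *\<^sub>R p) = 1/2 - lam T a p / 2"
    using lam_barycentric[OF assms s] by simp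
  then show ?thesis by (simp add: diff_divide_distrib)
qed

lemma homothety_hull:
  assumes "is_triangle T" "x \<in> T"
  shows "(\<lambda>p. (1/2) *\<^sub>R x + (1/2) *\<^sub>R p) ` (convex hull T) = {p \<in> convex hull T. lam T x p \<ge> 1/2}"
proof
  show "(\<lambda>p. (1/2) *\<^sub>R x + (1/2) *\<^sub>R p) ` (convex hull T) \<subseteq> {p \<in> convex hull T. lam T x p \<ge> 1/2}"
  proof
    fix q assume "q \<in> (\<lambda>p. (1/2) *\<^sub>R x + (1/2) *\<^sub>R p) ` (convex hull T)"
    then obtain p where p: "p \<in> convex hull T" "q = (1/2) *\<^sub>R x + (1/2) *\<^sub>R p" by blast
    have q: "lam T a q = ((if a = x then 1 else 0) + lam T a p) / 2" "lam T a p \<ge> 0" if "a \<in> T" for a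
      using lam_homothety[OF assms(1) that assms(2)] p in_hull_iff[OF assms(1)] that by auto
    have "lam T a q \<ge> 0" if "a \<in> T" for a using q[OF that] by (auto split: if_splits)
    then show "q \<in> {p \<in> convex hull T. lam T x p \<ge> 1/2}"
      using q[OF assms(2)] in_hull_iff[OF assms(1), of q] by simp
  qed
  show "{p \<in> convex hull T. lam T x p \<ge> 1/2} \<subseteq> (\<lambda>p. (1/2) *\<^sub>R x + (1/2) *\<^sub>R p) ` (convex hull T)"
  proof
    fix q assume q: "q \<in> {p \<in> convex hull T. lam T x p \<ge> 1/2}"
    define p where "p = 2 *\<^sub>R q - x"
    have qp: "q = (1/2) *\<^sub>R x + (1/2) *\<^sub>R p" unfolding p_def by (simp add: scaleR_diff_right)
    have "lam T a p \<ge> 0" if "a \<in> T" for a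
      using lam_homothety[OF assms(1) that assms(2), of p] q that in_hull_iff[OF assms(1), of q] unfolding qp[symmetric]
      by (auto split: if_splits)
    then show "q \<in> (\<lambda>p. (1/2) *\<^sub>R x + (1/2) *\<^sub>R p) ` (convex hull T)"
      using qp in_hull_iff[OF assms(1), of p] by blast
  qed
qed

lemma central_hull:
  assumes "is_triangle T"
  shows "(\<lambda>p. (1/2) *\<^sub>R (\<Sum>T) + (-1/2) *\<^sub>R p) ` (convex hull T) = {p \<in> convex hull T. \<forall>x\<in>T. lam T x p \<le> 1/2}"
proof
  have key: "lam T a q \<ge> 0 \<and> lam T a q \<le> 1/2 \<longleftrightarrow> lam T a p \<ge> 0 \<and> lam T a p \<le> 1"
    if "a \<in> T" "q = (1/2) *\<^sub>R (\<Sum>T) + (-1/2) *\<^sub>R p" for a p q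
    using lam_central[OF assms that(1), of p] that(2) by auto
  have le1: "lam T a p \<le> 1" if "p \<in> convex hull T" "a \<in> T" for a p
    using lam_sum_eq(1)[OF assms, of p] member_le_sum[of a T "\<lambda>a. lam T a p"] that in_hull_iff[OF assms]
      triangle_finite[OF assms] by auto
  show "(\<lambda>p. (1/2) *\<^sub>R (\<Sum>T) + (-1/2) *\<^sub>R p) ` (convex hull T) \<subseteq> {p \<in> convex hull T. \<forall>x\<in>T. lam T x p \<le> 1/2}"
  proof
    fix q assume "q \<in> (\<lambda>p. (1/2) *\<^sub>R (\<Sum>T) + (-1/2) *\<^sub>R p) ` (convex hull T)"
    then obtain p where p: "p \<in> convex hull T" "q = (1/2) *\<^sub>R (\<Sum>T) + (-1/2) *\<^sub>R p" by blast
    then have "\<forall>a\<in>T. lam T a q \<ge> 0 \<and> lam T a q \<le> 1/2"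
      using key[OF _ p(2)] le1[OF p(1)] in_hull_iff[OF assms, of p] by blast
    then show "q \<in> {p \<in> convex hull T. \<forall>x\<in>T. lam T x p \<le> 1/2}"
      using in_hull_iff[OF assms, of q] by blast
  qed
  show "{p \<in> convex hull T. \<forall>x\<in>T. lam T x p \<le> 1/2} \<subseteq> (\<lambda>p. (1/2) *\<^sub>R (\<Sum>T) + (-1/2) *\<^sub>R p) ` (convex hull T)"
  proof
    fix q assume q: "q \<in> {p \<in> convex hull T. \<forall>x\<in>T. lam T x p \<le> 1/2}"
    define p where "p = \<Sum>T - 2 *\<^sub>R q"
    have qp: "q = (1/2) *\<^sub>R (\<Sum>T) + (-1/2) *\<^sub>R p" unfolding p_def by (simp add: scaleR_diff_right)
    have "lam T a p \<ge> 0" if "a \<in> T" for a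
      using key[OF that qp] q that in_hull_iff[OF assms, of q] by blast
    then show "q \<in> (\<lambda>p. (1/2) *\<^sub>R (\<Sum>T) + (-1/2) *\<^sub>R p) ` (convex hull T)"
      using qp in_hull_iff[OF assms, of p] by blast
  qed
qed

lemma triangle_compact: "is_triangle T \<Longrightarrow> compact (convex hull T)"
  by (simp add: finite_imp_compact_convex_hull triangle_finite)

text \<open>The edge midpoints cut the triangle into four images of itself under maps with factor
  1/2 or -1/2, each with Jacobian 1/4. They overlap only where some coordinate equals 1/2, a null
  set.\<close>

lemma integral_midpoint_subdivision:
  fixes F :: "pt \<Rightarrow> real"
  assumes t: "is_triangle T" and F: "continuous_on UNIV F"
  shows "4 * integral (convex hull T) F = integral (convex hull T)
    (\<lambda>p. (\<Sum>x\<in>T. F ((1/2) *\<^sub>R x + (1/2) *\<^sub>R p)) + F ((1/2) *\<^sub>R (\<Sum>T) + (-1/2) *\<^sub>R p))"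
proof -
  let ?K = "convex hull T"
  note cK = triangle_compact[OF t] and fin = triangle_finite[OF t]
  \<comment> \<open>\<open>None\<close> stands for the reflected central triangle,
    \<open>Some x\<close> for the corner triangle at \<open>x\<close>.\<close>
  define c where "c i = (case i of None \<Rightarrow> (1/2) *\<^sub>R (\<Sum>T) | Some x \<Rightarrow> (1/2) *\<^sub>R x)" for i :: "pt option"
  define m :: "pt option \<Rightarrow> real" where "m i = (case i of None \<Rightarrow> -1/2 | Some x \<Rightarrow> 1/2)" for i
  define S where "S i = (\<lambda>p. c i + m i *\<^sub>R p) ` ?K" for i
  define I where "I = insert None (Some ` T)"
  have m: "m i \<noteq> 0" "(m i)\<^sup>2 = 1/4" for i by (auto simp: m_def power2_eq_square split: option.splits)
  have SN: "S None = {p \<in> ?K. \<forall>x\<in>T. lam T x p \<le> 1/2}"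
    using central_hull[OF t] unfolding S_def c_def m_def by simp
  have SS: "S (Some x) = {p \<in> ?K. lam T x p \<ge> 1/2}" if "x \<in> T" for x
    using homothety_hull[OF t that] unfolding S_def c_def m_def by simp
  have cS: "compact (S i)" for i unfolding S_def by (intro compact_continuous_image continuous_intros cK)
  have cF: "continuous_on A (\<lambda>p. F (c i + m i *\<^sub>R p))" for i A
    by (rule continuous_on_compose2[OF F]) (auto intro!: continuous_intros)
  have U: "?K = (\<Union>i\<in>I. S i)"
  proof
    show "?K \<subseteq> (\<Union>i\<in>I. S i)"
    proof
      fix p assume p: "p \<in> ?K"
      show "p \<in> (\<Union>i\<in>I. S i)"
      proof (cases "\<forall>x\<in>T. lam T x p \<le> 1/2")
        case True then show ?thesis using p SN unfolding I_def by blast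
      next
        case False
        then obtain x where "x \<in> T" "lam T x p > 1/2" by (meson not_le)
        then show ?thesis using p SS[of x] unfolding I_def by (auto intro: less_imp_le)
      qed
    qed
    show "(\<Union>i\<in>I. S i) \<subseteq> ?K" using SN SS unfolding I_def by auto
  qed
  have neg: "pairwise (\<lambda>i i'. negligible (S i \<inter> S i')) I"
  proof (rule pairwiseI)
    have NS: "negligible (S None \<inter> S (Some x))" if "x \<in> T" for x
      using that SN SS[OF that] by (intro negligible_subset[OF lam_level_negligible[OF t that, of "1/2"]]) auto
    have SSn: "negligible (S (Some x) \<inter> S (Some y))" if "x \<in> T" "y \<in> T" "x \<noteq> y" for x y
    proof (rule negligible_subset[OF lam_level_negligible[OF t that(1), of "1/2"]], rule subsetI)
      fix p assume "p \<in> S (Some x) \<inter> S (Some y)"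
      then have p: "p \<in> ?K" "lam T x p \<ge> 1/2" "lam T y p \<ge> 1/2" using SS that by auto
      have "lam T x p + lam T y p = (\<Sum>z\<in>{x, y}. lam T z p)" using that by simp
      also have "\<dots> \<le> (\<Sum>z\<in>T. lam T z p)"
        using that p in_hull_iff[OF t] fin by (intro sum_mono2) auto
      finally show "p \<in> {p. lam T x p = 1/2}" using p lam_sum_eq(1)[OF t, of p] by simp
    qed
    fix i i' assume "i \<in> I" "i' \<in> I" "i \<noteq> i'"
    then consider x where "i = None" "i' = Some x" "x \<in> T" | x where "i' = None" "i = Some x" "x \<in> T"
      | x y where "i = Some x" "i' = Some y" "x \<in> T" "y \<in> T" "x \<noteq> y" unfolding I_def by blast
    then show "negligible (S i \<inter> S i')" using NS SSn by cases (simp_all add: Int_commute)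
  qed
  have "(F has_integral integral (S i) F) (S i)" for i
    using compact_integral_lebesgue(1)[OF cS[of i], of F] F continuous_on_subset integrable_integral by blast
  then have "(F has_integral (\<Sum>i\<in>I. integral (S i) F)) (\<Union>i\<in>I. S i)"
    using neg fin unfolding I_def by (intro has_integral_UN) auto
  then have "integral ?K F = (\<Sum>i\<in>I. integral (S i) F)" unfolding U[symmetric] by (rule integral_unique)
  also have "\<dots> = (\<Sum>i\<in>I. (1/4) * integral ?K (\<lambda>p. F (c i + m i *\<^sub>R p)))"
    unfolding S_def by (rule sum.cong) (simp_all only: integral_affine_image[OF cK F m(1)] m(2))
  finally have "4 * integral ?K F = (\<Sum>i\<in>I. integral ?K (\<lambda>p. F (c i + m i *\<^sub>R p)))"
    by (simp add: sum_divide_distrib[symmetric])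
  also have "\<dots> = integral ?K (\<lambda>p. \<Sum>i\<in>I. F (c i + m i *\<^sub>R p))"
    using fin compact_integral_lebesgue(1)[OF cK cF] unfolding I_def by (intro integral_sum[symmetric]) auto
  also have "(\<lambda>p. \<Sum>i\<in>I. F (c i + m i *\<^sub>R p)) =
      (\<lambda>p. (\<Sum>x\<in>T. F ((1/2) *\<^sub>R x + (1/2) *\<^sub>R p)) + F ((1/2) *\<^sub>R (\<Sum>T) + (-1/2) *\<^sub>R p))"
    using fin unfolding I_def by (simp add: c_def m_def sum.reindex add.commute)
  finally show ?thesis .
qed

lemma triangle_integrable:
  fixes F :: "pt \<Rightarrow> real"
  shows "is_triangle T \<Longrightarrow> continuous_on UNIV F \<Longrightarrow> F integrable_on convex hull T"
  by (meson compact_integral_lebesgue(1) triangle_compact continuous_on_subset top_greatest)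

definition area :: "pt set \<Rightarrow> real" where
  "area T = integral (convex hull T) (\<lambda>p. 1)"

lemma area_eq:
  assumes "det2 (b - a) (c - a) \<noteq> 0" shows "area {a, b, c} = \<bar>det2 (b - a) (c - a)\<bar> / 2"
proof -
  have t: "is_triangle {a, b, c}" using assms unfolding is_triangle_def by blast
  have "convex hull {a, b, c} \<in> sets borel"
    using triangle_compact[OF t] compact_imp_closed by (intro borel_closed) auto
  then have "(LINT p|lborel. indicator (convex hull {a, b, c}) p *\<^sub>R (1::real)) = measure lborel (convex hull {a, b, c})"
    by simp
  then show ?thesis unfolding area_def
    using compact_integral_lebesgue(2)[OF triangle_compact[OF t], of "\<lambda>_. 1"] content_hull_triangle[of a b c] by simp
qed

lemma area_pos: "is_triangle T \<Longrightarrow> area T > 0"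
  unfolding is_triangle_def using area_eq by fastforce

text \<open>Subdivision reproduces this integrand up to a constant. The integral I therefore solves
  4 I = I + k \<open>area T\<close>, with k = 1/2 for a square and k = 1/4 for a mixed
  product.\<close>

lemma integral_lam_lam:
  assumes t: "is_triangle T" and ab: "a \<in> T" "b \<in> T"
  shows "integral (convex hull T) (\<lambda>p. lam T a p * lam T b p) = area T * (if a = b then 2 else 1) / 12"
proof -
  let ?K = "convex hull T" and ?F = "\<lambda>p. lam T a p * lam T b p" and ?d = "if a = b then 1 else (0::real)"
  have cF: "continuous_on UNIV ?F" by (intro continuous_intros lam_continuous t ab)
  have G: "(\<Sum>x\<in>T. ?F ((1/2) *\<^sub>R x + (1/2) *\<^sub>R p)) + ?F ((1/2) *\<^sub>R (\<Sum>T) + (-1/2) *\<^sub>R p)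
      = ?F p + (1 + ?d) / 4" for p
  proof -
    have "(\<Sum>x\<in>T. ?F ((1/2) *\<^sub>R x + (1/2) *\<^sub>R p)) =
      (\<Sum>x\<in>T. (?F p + (if a = x then lam T b p else 0) + (if b = x then lam T a p else 0) +
         (if a = x then ?d else 0)) / 4)"
      by (rule sum.cong) (auto simp: lam_homothety[OF t] ab field_simps)
    also have "\<dots> = (3 * ?F p + lam T b p + lam T a p + ?d) / 4"
      using triangle_finite[OF t] ab triangle_card[OF t] by (simp add: sum.distrib flip: sum_divide_distrib)
    finally show ?thesis unfolding lam_central[OF t ab(1)] lam_central[OF t ab(2)] by (simp add: field_simps)
  qed
  have "4 * integral ?K ?F = integral ?K (\<lambda>p. ?F p + (1 + ?d) / 4)"
    using integral_midpoint_subdivision[OF t cF] unfolding G .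
  also have "\<dots> = integral ?K ?F + integral ?K (\<lambda>p. ((1 + ?d) / 4) * 1)"
    using triangle_integrable[OF t cF] triangle_integrable[OF t, of "\<lambda>_. (1 + ?d) / 4"] by (simp add: Henstock_Kurzweil_Integration.integral_add)
  also have "integral ?K (\<lambda>p. ((1 + ?d) / 4) * 1) = ((1 + ?d) / 4) * area T"
    unfolding area_def by (rule Henstock_Kurzweil_Integration.integral_mult_right)
  finally show ?thesis by auto
qed

definition mid :: "pt set \<Rightarrow> pt" where "mid e = (1/2) *\<^sub>R (\<Sum>e)"

text \<open>The Bernstein form of a quadratic; the coefficient of a mixed product is fixed by the
  value at the edge midpoint, where that product is 1/4.\<close>

lemma poly2_2_bernstein:
  assumes q: "poly2 2 q" and s: "r + s + t = 1"
  shows "q (r *\<^sub>R a + s *\<^sub>R b + t *\<^sub>R c) = r * r * q a + s * s * q b + t * t * q c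
    + r * s * (4 * q ((1/2) *\<^sub>R (a + b)) - q a - q b) + s * t * (4 * q ((1/2) *\<^sub>R (b + c)) - q b - q c)
    + r * t * (4 * q ((1/2) *\<^sub>R (a + c)) - q a - q c)"
proof -
  obtain k where k: "q = (\<lambda>p. \<Sum>i\<le>2. \<Sum>j\<le>2 - i. k i j * fst p ^ i * snd p ^ j)" using q by (rule poly2E)
  have e: "q p = k 0 0 + k 0 1 * snd p + k 0 2 * (snd p * snd p) + k 1 0 * fst p + k 1 1 * (fst p * snd p)
      + k 2 0 * (fst p * fst p)" for p
    unfolding k by (simp add: numeral_2_eq_2 atMost_Suc algebra_simps)
  have r: "r = 1 - s - t" using s by simp
  show ?thesis unfolding e r by (simp add: field_simps)
qed

lemma quadrature:
  assumes t: "is_triangle T" and q: "poly2 2 q"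
  shows "integral (convex hull T) q = area T / 3 * (\<Sum>c\<in>T. q (mid (T - {c})))"
proof -
  let ?K = "convex hull T" 
  obtain a b c where T: "T = {a, b, c}" "det2 (b - a) (c - a) \<noteq> 0" using t unfolding is_triangle_def by blast
  note d = det2_distinct[OF T(2)]
  let ?ab = "4 * q ((1/2) *\<^sub>R (a + b)) - q a - q b" and ?bc = "4 * q ((1/2) *\<^sub>R (b + c)) - q b - q c"
    and ?ac = "4 * q ((1/2) *\<^sub>R (a + c)) - q a - q c"
  define L where "L x y = (\<lambda>p. lam T x p * lam T y p)" for x y
  have J: "(L x y has_integral area T * (if x = y then 2 else 1) / 12) ?K" if "x \<in> T" "y \<in> T" for x y
  proof -
    have "continuous_on UNIV (L x y)" unfolding L_def by (intro continuous_intros lam_continuous t that)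
    then have "L x y integrable_on ?K" by (rule triangle_integrable[OF t])
    then show ?thesis using integral_lam_lam[OF t that] integrable_integral unfolding L_def by metis
  qed
  have qe: "q = (\<lambda>p. L a a p * q a + L b b p * q b + L c c p * q c + L a b p * ?ab + L b c p * ?bc + L a c p * ?ac)"
  proof
    fix p
    have s: "lam T a p + lam T b p + lam T c p = 1" "lam T a p *\<^sub>R a + lam T b p *\<^sub>R b + lam T c p *\<^sub>R c = p"
      using lam_sum_eq[OF t, of p] d unfolding T(1) by (simp_all add: add.assoc)
    show "q p = L a a p * q a + L b b p * q b + L c c p * q c + L a b p * ?ab + L b c p * ?bc + L a c p * ?ac"
      using poly2_2_bernstein[OF q s(1), of a b c] unfolding s(2) L_def by simp
  qed
  \<comment> \<open>Vertex values cancel in the end, since 1/6 - 2/12 = 0, and each midpoint value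
    keeps the weight 4/12.\<close>
  have "(q has_integral area T / 6 * q a + area T / 6 * q b + area T / 6 * q c + area T / 12 * ?ab + area T / 12 * ?bc
     + area T / 12 * ?ac) ?K"
    using J[of a a] J[of b b] J[of c c] J[of a b] J[of b c] J[of a c] T(1) d
    by (subst qe) (intro has_integral_add has_integral_mult_left, auto)
  then have "integral ?K q = area T / 6 * q a + area T / 6 * q b + area T / 6 * q c + area T / 12 * ?ab + area T / 12 * ?bc
     + area T / 12 * ?ac" by (rule integral_unique)
  moreover have "T - {a} = {b, c}" "T - {b} = {a, c}" "T - {c} = {a, b}" using T(1) d by auto
  then have "(\<Sum>c\<in>T. q (mid (T - {c}))) = q ((1/2) *\<^sub>R (b + c)) + q ((1/2) *\<^sub>R (a + c)) + q ((1/2) *\<^sub>R (a + b))"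
    unfolding T(1) mid_def using d by simp
  ultimately show ?thesis by (simp add: field_simps)
qed

section \<open>The divergence theorem for cubic fields on a triangle\<close>

lemma grad_eq:
  assumes "det2 (b - a) (c - a) \<noteq> 0"
  shows "grad {a, b, c} a = (1 / det2 (b - a) (c - a)) *\<^sub>R (snd b - snd c, fst c - fst b)"
  unfolding grad_def lam_eq[OF assms] diff_divide_distrib[symmetric]
  by (simp add: det2_def algebra_simps)

text \<open>Green's formula for a monomial, with the midpoint rule inside and Simpson's rule on the
  edges. The letters stand for half the vertex coordinates, so that vertices are doubles, midpoints
  are sums, and no fractions occur. Only ten monomials have degree at most 3.\<close>

lemma divergence_identity_monom:
  fixes a1 a2 b1 b2 c1 c2 :: real
  assumes "i + j \<le> 3"
  defines "f \<equiv> \<lambda>x y. x ^ i * y ^ j" and "f' \<equiv> \<lambda>x y. real i * x ^ (i - 1) * y ^ j"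
  shows "4 * ((b1 - a1) * (c2 - a2) - (b2 - a2) * (c1 - a1)) *
     (f' (b1 + c1) (b2 + c2) + f' (c1 + a1) (c2 + a2) + f' (a1 + b1) (a2 + b2))
   = - 2 * ((b2 - c2) * (f (2*b1) (2*b2) + f (2*c1) (2*c2) + 4 * f (b1 + c1) (b2 + c2))
      + (c2 - a2) * (f (2*c1) (2*c2) + f (2*a1) (2*a2) + 4 * f (c1 + a1) (c2 + a2))
      + (a2 - b2) * (f (2*a1) (2*a2) + f (2*b1) (2*b2) + 4 * f (a1 + b1) (a2 + b2)))"
proof -
  have "i = 0 \<and> j = 0 \<or> i = 0 \<and> j = 1 \<or> i = 0 \<and> j = 2 \<or> i = 0 \<and> j = 3 \<or> i = 1 \<and> j = 0 \<or> i = 1 \<and> j = 1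
    \<or> i = 1 \<and> j = 2 \<or> i = 2 \<and> j = 0 \<or> i = 2 \<and> j = 1 \<or> i = 3 \<and> j = 0" using assms(1) by presburger
  then consider "i = 0" "j = 0" | "i = 0" "j = 1" | "i = 0" "j = 2" | "i = 0" "j = 3" | "i = 1" "j = 0" | "i = 1" "j = 1"
    | "i = 1" "j = 2" | "i = 2" "j = 0" | "i = 2" "j = 1" | "i = 3" "j = 0" by blast
  note cs = this
  have n: "(3::nat) - 1 = 2" "(2::nat) - 1 = 1" "(1::nat) - 1 = 0" "(0::nat) - 1 = 0" by simp_all
  note n = n power_0 power_one_right of_nat_numeral of_nat_0 of_nat_1
  from cs show ?thesis
  proof cases
    case 1 show ?thesis unfolding f_def f'_def 1 n by algebra
  next case 2 show ?thesis unfolding f_def f'_def 2 n by algebra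
  next case 3 show ?thesis unfolding f_def f'_def 3 n by algebra
  next case 4 show ?thesis unfolding f_def f'_def 4 n by algebra
  next case 5 show ?thesis unfolding f_def f'_def 5 n by algebra
  next case 6 show ?thesis unfolding f_def f'_def 6 n by algebra
  next case 7 show ?thesis unfolding f_def f'_def 7 n by algebra
  next case 8 show ?thesis unfolding f_def f'_def 8 n by algebra
  next case 9 show ?thesis unfolding f_def f'_def 9 n by algebra
  next case 10 show ?thesis unfolding f_def f'_def 10 n by algebra
  qed
qed

lemma poly2_induct:
  assumes f: "poly2 k f" and monom: "\<And>i j. i + j \<le> k \<Longrightarrow> P (\<lambda>p. fst p ^ i * snd p ^ j)"
    and add: "\<And>f g. P f \<Longrightarrow> P g \<Longrightarrow> P (\<lambda>p. f p + g p)" and cmult: "\<And>a f. P f \<Longrightarrow> P (\<lambda>p. a * f p)"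
  shows "P f"
proof -
  obtain c where c: "f = (\<lambda>p. \<Sum>i\<le>k. \<Sum>j\<le>k - i. c i j * fst p ^ i * snd p ^ j)" using f by (rule poly2E)
  have zero: "P (\<lambda>p. 0)" using cmult[OF monom[of 0 0], of 0] by simp
  have sum: "P (\<lambda>p. \<Sum>i\<in>I. h i p)" if "finite I" "\<And>i. i \<in> I \<Longrightarrow> P (h i)" for I :: "nat set" and h
    using that
  proof (induction I)
    case (insert i I)
    then show ?case using add[of "h i" "\<lambda>p. \<Sum>i\<in>I. h i p"] by simp
  qed (simp add: zero)
  have "P (\<lambda>p. c i j * fst p ^ i * snd p ^ j)" if "i \<le> k" "j \<le> k - i" for i j
    using cmult[OF monom[of i j], of "c i j"] that by (simp add: mult.assoc)
  then show ?thesis unfolding c by (intro sum) auto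
qed

definition midpoint_sum :: "(pt \<Rightarrow> real) \<Rightarrow> pt \<Rightarrow> pt \<Rightarrow> pt \<Rightarrow> real" where
  "midpoint_sum f a b c = f ((1/2) *\<^sub>R (b + c)) + f ((1/2) *\<^sub>R (c + a)) + f ((1/2) *\<^sub>R (a + b))"

text \<open>Six times Simpson's value of the closed line integral of \<open>f\<close> against
  \<open>\<pi>\<close>, taken in the order a, c, b; \<open>\<pi>\<close> will be \<open>fst\<close>
  or \<open>snd\<close>.\<close>

definition simpson_sum :: "(pt \<Rightarrow> real) \<Rightarrow> (pt \<Rightarrow> real) \<Rightarrow> pt \<Rightarrow> pt \<Rightarrow> pt \<Rightarrow> real" where
  "simpson_sum \<pi> f a b c = (\<pi> b - \<pi> c) * (f b + f c + 4 * f ((1/2) *\<^sub>R (b + c)))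
     + (\<pi> c - \<pi> a) * (f c + f a + 4 * f ((1/2) *\<^sub>R (c + a)))
     + (\<pi> a - \<pi> b) * (f a + f b + 4 * f ((1/2) *\<^sub>R (a + b)))"

text \<open>Both identities are linear in \<open>f\<close>, so monomials suffice. The one for the
  second partial derivative is the first with the coordinates exchanged, which also reverses the
  orientation and hence the sign.\<close>

lemma divergence_identity:
  assumes "poly2 3 f"
  obtains fx fy where "\<And>p. (f has_derivative (\<lambda>h. fx p * fst h + fy p * snd h)) (at p)"
    "\<And>a b c. det2 (b - a) (c - a) * midpoint_sum fx a b c = - simpson_sum snd f a b c"
    "\<And>a b c. det2 (b - a) (c - a) * midpoint_sum fy a b c = simpson_sum fst f a b c"
proof -
  let ?P = "\<lambda>f. \<exists>fx fy. (\<forall>p. (f has_derivative (\<lambda>h. fx p * fst h + fy p * snd h)) (at p)) \<and>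
    (\<forall>a b c. det2 (b - a) (c - a) * midpoint_sum fx a b c = - simpson_sum snd f a b c) \<and>
    (\<forall>a b c. det2 (b - a) (c - a) * midpoint_sum fy a b c = simpson_sum fst f a b c)"
  have "?P f" using assms
  proof (rule poly2_induct)
    fix i j :: nat assume ij: "i + j \<le> 3"
    let ?fx = "\<lambda>p::pt. real i * fst p ^ (i - 1) * snd p ^ j" and ?fy = "\<lambda>p::pt. real j * snd p ^ (j - 1) * fst p ^ i"
    have D: "((\<lambda>p::pt. fst p ^ i * snd p ^ j) has_derivative (\<lambda>h. ?fx p * fst h + ?fy p * snd h)) (at p)" for p
      by (auto intro!: derivative_eq_intros simp: algebra_simps)
    have h: "2 * ((1/2) * x) = (x::real)" for x by simp
    have m: "fst ((1/2) *\<^sub>R (u + v)) = (1/2) * fst u + (1/2) * fst v"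
      "snd ((1/2) *\<^sub>R (u + v)) = (1/2) * snd u + (1/2) * snd v" for u v :: pt
      by (simp_all add: distrib_left)
    show "?P (\<lambda>p. fst p ^ i * snd p ^ j)"
    proof (rule exI[of _ ?fx], rule exI[of _ ?fy], intro conjI allI D)
      fix a b c :: pt
      show "det2 (b - a) (c - a) * midpoint_sum ?fx a b c = - simpson_sum snd (\<lambda>p. fst p ^ i * snd p ^ j) a b c"
        using divergence_identity_monom[OF ij, of "(1/2) * fst b" "(1/2) * fst a" "(1/2) * snd c" "(1/2) * snd a" "(1/2) * snd b" "(1/2) * fst c"]
        unfolding midpoint_sum_def simpson_sum_def m h det2_def fst_diff snd_diff by (simp add: algebra_simps)
      show "det2 (b - a) (c - a) * midpoint_sum ?fy a b c = simpson_sum fst (\<lambda>p. fst p ^ i * snd p ^ j) a b c"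
        using divergence_identity_monom[of j i, of "(1/2) * snd b" "(1/2) * snd a" "(1/2) * fst c" "(1/2) * fst a" "(1/2) * fst b" "(1/2) * snd c"] ij
        unfolding midpoint_sum_def simpson_sum_def m h det2_def fst_diff snd_diff by (simp add: algebra_simps)
    qed
  next
    fix f g :: "pt \<Rightarrow> real" assume "?P f" "?P g"
    then obtain fx fy gx gy where
      F: "\<And>p. (f has_derivative (\<lambda>h. fx p * fst h + fy p * snd h)) (at p)"
      "\<And>a b c. det2 (b - a) (c - a) * midpoint_sum fx a b c = - simpson_sum snd f a b c"
      "\<And>a b c. det2 (b - a) (c - a) * midpoint_sum fy a b c = simpson_sum fst f a b c"
      and G: "\<And>p. (g has_derivative (\<lambda>h. gx p * fst h + gy p * snd h)) (at p)"
      "\<And>a b c. det2 (b - a) (c - a) * midpoint_sum gx a b c = - simpson_sum snd g a b c"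
      "\<And>a b c. det2 (b - a) (c - a) * midpoint_sum gy a b c = simpson_sum fst g a b c"
      by blast
    have D: "((\<lambda>p. f p + g p) has_derivative (\<lambda>h. (fx p + gx p) * fst h + (fy p + gy p) * snd h)) (at p)" for p
      using has_derivative_add[OF F(1) G(1), of p] by (simp add: algebra_simps)
    have a: "midpoint_sum (\<lambda>p. u p + v p) a b c = midpoint_sum u a b c + midpoint_sum v a b c"
      "simpson_sum w (\<lambda>p. u p + v p) a b c = simpson_sum w u a b c + simpson_sum w v a b c" for u v w a b c
      by (simp_all add: midpoint_sum_def simpson_sum_def algebra_simps)
    show "?P (\<lambda>p. f p + g p)"
      by (rule exI[of _ "\<lambda>p. fx p + gx p"], rule exI[of _ "\<lambda>p. fy p + gy p"])
        (simp add: D a distrib_left F(2,3) G(2,3))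
  next
    fix f :: "pt \<Rightarrow> real" and r assume "?P f"
    then obtain fx fy where
      F: "\<And>p. (f has_derivative (\<lambda>h. fx p * fst h + fy p * snd h)) (at p)"
      "\<And>a b c. det2 (b - a) (c - a) * midpoint_sum fx a b c = - simpson_sum snd f a b c"
      "\<And>a b c. det2 (b - a) (c - a) * midpoint_sum fy a b c = simpson_sum fst f a b c"
      by blast
    have D: "((\<lambda>p. r * f p) has_derivative (\<lambda>h. (r * fx p) * fst h + (r * fy p) * snd h)) (at p)" for p
      using has_derivative_mult_right[OF F(1), of r p] by (simp add: algebra_simps)
    have a: "midpoint_sum (\<lambda>p. r * u p) a b c = r * midpoint_sum u a b c"
      "simpson_sum w (\<lambda>p. r * u p) a b c = r * simpson_sum w u a b c" for u w a b c
      by (simp_all add: midpoint_sum_def simpson_sum_def algebra_simps)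
    show "?P (\<lambda>p. r * f p)"
      by (rule exI[of _ "\<lambda>p. r * fx p"], rule exI[of _ "\<lambda>p. r * fy p"])
        (simp add: D a mult.left_commute[of _ r] F(2,3))
  qed
  then show ?thesis by (elim exE conjE) (rule that, blast+)
qed

definition simpson :: "pt set \<Rightarrow> (pt \<Rightarrow> pt) \<Rightarrow> pt" where
  "simpson e g = (1/6) *\<^sub>R ((\<Sum>x\<in>e. g x) + 4 *\<^sub>R g (mid e))"

text \<open>Simpson's rule is exact for the cubic normal component on each edge, and
  \<^term>\<open>(- 2 * area T) *\<^sub>R grad T c\<close> is the outward normal of the edge opposite to \<^term>\<open>c\<close> scaled by its length.\<close>
lemma triangle_divergence:
  assumes t: "is_triangle T" and g: "poly2vec 3 g"
  shows "integral (convex hull T) (divergence g) = - 2 * area T * (\<Sum>c\<in>T. grad T c \<bullet> simpson (T - {c}) g)"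
proof -
  obtain a b c where T: "T = {a, b, c}" "det2 (b - a) (c - a) \<noteq> 0" using t unfolding is_triangle_def by blast
  note d = det2_distinct[OF T(2)]
  have e: "T - {a} = {b, c}" "T - {b} = {c, a}" "T - {c} = {a, b}" using T(1) d by auto
  let ?D = "det2 (b - a) (c - a)" and ?g1 = "\<lambda>p. fst (g p)" and ?g2 = "\<lambda>p. snd (g p)"
  have "poly2 3 ?g1" "poly2 3 ?g2" using g by (auto simp: poly2vec_def)
  obtain ux uy where u: "\<And>p. (?g1 has_derivative (\<lambda>h. ux p * fst h + uy p * snd h)) (at p)"
    "\<And>a b c. det2 (b - a) (c - a) * midpoint_sum ux a b c = - simpson_sum snd ?g1 a b c"
    by (rule divergence_identity[OF \<open>poly2 3 ?g1\<close>], rule that)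
  obtain vx vy where v: "\<And>p. (?g2 has_derivative (\<lambda>h. vx p * fst h + vy p * snd h)) (at p)"
    "\<And>a b c. det2 (b - a) (c - a) * midpoint_sum vy a b c = simpson_sum fst ?g2 a b c"
    by (rule divergence_identity[OF \<open>poly2 3 ?g2\<close>], rule that)
  have div: "divergence g p = ux p + vy p" for p
    using divergence_eqI[OF has_derivative_Pair[OF u(1) v(1), of p, simplified]] by simp
  have "integral (convex hull T) (divergence g) = area T / 3 * (\<Sum>c\<in>T. divergence g (mid (T - {c})))"
    by (rule quadrature[OF t poly2vec3_divergence[OF g]])
  also have "(\<Sum>c\<in>T. divergence g (mid (T - {c}))) = midpoint_sum ux a b c + midpoint_sum vy a b c"
    unfolding T(1) using d e[unfolded T(1)] by (simp add: midpoint_sum_def div mid_def)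
  also have "\<dots> = (- simpson_sum snd ?g1 a b c + simpson_sum fst ?g2 a b c) / ?D"
    using u(2)[of b a c] v(2)[of b a c] T(2) by (simp add: field_simps)
  also have "\<dots> = - 6 * (\<Sum>c\<in>T. grad T c \<bullet> simpson (T - {c}) g)"
  proof -
    have "grad T a = (1 / ?D) *\<^sub>R (snd b - snd c, fst c - fst b)"
      "grad T b = (1 / ?D) *\<^sub>R (snd c - snd a, fst a - fst c)"
      "grad T c = (1 / ?D) *\<^sub>R (snd a - snd b, fst b - fst a)"
      using grad_eq[OF T(2)] grad_eq[OF triangle_perm(1)[OF T(2)]] grad_eq[OF triangle_perm(2)[OF T(2)]]
        det2_cyclic[of c b a] det2_cyclic[of b a c]
      unfolding T(1) by (simp_all add: insert_commute)
    moreover have "(\<Sum>c\<in>T. grad T c \<bullet> simpson (T - {c}) g) =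
        grad T a \<bullet> simpson {b, c} g + grad T b \<bullet> simpson {c, a} g + grad T c \<bullet> simpson {a, b} g"
      using d e unfolding T(1) by simp
    ultimately have "(\<Sum>c\<in>T. grad T c \<bullet> simpson (T - {c}) g) = (1 / ?D) *
        (((snd b - snd c, fst c - fst b) \<bullet> simpson {b, c} g + (snd c - snd a, fst a - fst c) \<bullet> simpson {c, a} g)
         + (snd a - snd b, fst b - fst a) \<bullet> simpson {a, b} g)" by (simp only: inner_scaleR_left distrib_left)
    also have "((snd b - snd c, fst c - fst b) \<bullet> simpson {b, c} g + (snd c - snd a, fst a - fst c) \<bullet> simpson {c, a} g)
         + (snd a - snd b, fst b - fst a) \<bullet> simpson {a, b} g
       = (simpson_sum snd ?g1 a b c - simpson_sum fst ?g2 a b c) / 6"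
      using d by (simp add: simpson_def simpson_sum_def mid_def inner_prod_def) (simp add: algebra_simps add_divide_distrib diff_divide_distrib)
    finally show ?thesis using T(2) by (simp add: field_simps)
  qed
  finally show ?thesis by simp
qed

section \<open>Discrete fields\<close>

lemma divergence_scaleR_field:
  assumes "(\<phi> has_derivative (\<lambda>h. G \<bullet> h)) (at p)"
  shows "divergence (\<lambda>p. \<phi> p *\<^sub>R c) p = G \<bullet> c"
  using divergence_eqI[OF has_derivative_scaleR_left[OF assms, of c]]
  by (simp add: inner_prod_def)

lemma poly2vec_scaleR_field: "poly2 k \<phi> \<Longrightarrow> poly2vec k (\<lambda>p. \<phi> p *\<^sub>R c)"
  unfolding poly2vec_def using poly2_cmult[of k \<phi> "fst c"] poly2_cmult[of k \<phi> "snd c"] by (simp add: mult.commute)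

lemma poly2vec_add: "poly2vec k f \<Longrightarrow> poly2vec k g \<Longrightarrow> poly2vec k (\<lambda>p. f p + g p)"
  unfolding poly2vec_def by (simp add: poly2_add)

lemma poly2vec_scaleR: "poly2vec k f \<Longrightarrow> poly2vec k (\<lambda>p. r *\<^sub>R f p)"
  unfolding poly2vec_def by (simp add: poly2_cmult)

lemma poly2vec_zero: "poly2vec k (\<lambda>p. 0)"
  unfolding poly2vec_def by (simp add: poly2_const)

lemma poly2vec_continuous: "poly2vec k g \<Longrightarrow> continuous_on S g"
proof -
  assume "poly2vec k g"
  then have "continuous_on S (\<lambda>p. (fst (g p), snd (g p)))"
    unfolding poly2vec_def by (intro continuous_on_Pair) (auto intro: poly2_continuous)
  then show ?thesis by simp
qed

lemma poly2vec3_differentiable: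
  assumes "poly2vec 3 g" obtains D where "(g has_derivative D) (at p)"
proof -
  have g: "poly2vec (Suc 2) g" using assms by (simp add: eval_nat_numeral)
  show ?thesis by (rule poly2vec_has_derivative[OF g]) (rule that)
qed

lemma divergence_add:
  assumes "poly2vec 3 f" "poly2vec 3 g"
  shows "divergence (\<lambda>p. f p + g p) p = divergence f p + divergence g p"
proof -
  obtain D where D: "(f has_derivative D) (at p)" using poly2vec3_differentiable[OF assms(1)] .
  obtain E where E: "(g has_derivative E) (at p)" using poly2vec3_differentiable[OF assms(2)] .
  show ?thesis unfolding divergence_eqI[OF D] divergence_eqI[OF E] divergence_eqI[OF has_derivative_add[OF D E]] by simp
qed

lemma divergence_scaleR:
  assumes "poly2vec 3 f"
  shows "divergence (\<lambda>p. r *\<^sub>R f p) p = r * divergence f p"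
proof -
  obtain D where D: "(f has_derivative D) (at p)" using poly2vec3_differentiable[OF assms(1)] .
  show ?thesis unfolding divergence_eqI[OF D] divergence_eqI[OF has_derivative_scaleR_right[OF D]]
    by (simp add: distrib_left)
qed

lemma poly2vec_unique:
  assumes "poly2vec k f" "poly2vec k g" and U: "open U" "U \<noteq> {}" and eq: "\<And>p. p \<in> U \<Longrightarrow> f p = g p"
  shows "f = g"
proof
  fix p
  have d: "poly2vec k (\<lambda>p. f p + (-1) *\<^sub>R g p)" by (intro poly2vec_add poly2vec_scaleR assms)
  have z: "f p + (-1) *\<^sub>R g p = 0" if "p \<in> U" for p using eq[of p] that by auto
  have "poly2 k (\<lambda>p. fst (f p + (-1) *\<^sub>R g p))" "poly2 k (\<lambda>p. snd (f p + (-1) *\<^sub>R g p))"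
    using d unfolding poly2vec_def by auto
  from poly2_eq_0[OF this(1) U] poly2_eq_0[OF this(2) U]
  have "fst (f p + (-1) *\<^sub>R g p) = 0" "snd (f p + (-1) *\<^sub>R g p) = 0"
    using z by (simp_all only: fst_zero snd_zero)
  then show "f p = g p" by (intro prod_eqI) auto
qed

section \<open>Linear structure of \<open>Vh3\<close> and gluing of polynomial pieces\<close>

context mesh
begin

lemma Vh3I:
  assumes "\<And>T. T \<in> Th \<Longrightarrow> poly2vec 3 (g T)"
    and "\<And>T p. T \<in> Th \<Longrightarrow> p \<in> convex hull T \<Longrightarrow> v p = g T p"
    and "\<And>p. p \<notin> \<Omega> \<Longrightarrow> v p = 0"
  shows "v \<in> Vh3 Th \<Omega>"
proof -
  have "continuous_on (\<Union>T\<in>Th. convex hull T) v"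
  proof (rule continuous_on_closed_Union[OF finite_Th])
    fix T assume T: "T \<in> Th"
    show "closed (convex hull T)" using compact_hull[OF T] compact_imp_closed by blast
    have "continuous_on (convex hull T) (g T)" by (rule poly2vec_continuous[OF assms(1)[OF T]])
    then show "continuous_on (convex hull T) v"
      using assms(2)[OF T] by (simp cong: continuous_on_cong)
  qed
  then show ?thesis unfolding Vh3_def closure_Omega using assms by blast
qed

lemma cubic_piece:
  assumes "v \<in> Vh3 Th \<Omega>" "T \<in> Th"
  shows "poly2vec 3 (cubic_piece v T)" "\<And>p. p \<in> convex hull T \<Longrightarrow> v p = cubic_piece v T p"
proof -
  have "\<exists>g. poly2vec 3 g \<and> (\<forall>y\<in>convex hull T. v y = g y)" using assms unfolding Vh3_def by blast
  from someI_ex[OF this]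
  show "poly2vec 3 (cubic_piece v T)" "\<And>p. p \<in> convex hull T \<Longrightarrow> v p = cubic_piece v T p"
    unfolding cubic_piece_def by blast+
qed

text \<open>Since \<open>cubic_piece\<close> is a choice, its value is known only because cubics
  that agree on a triangle, a set with interior, are equal. This is what allows divergences to be
  computed from explicit formulas.\<close>

lemma cubic_piece_eqI:
  assumes "T \<in> Th" "poly2vec 3 g" "\<And>p. p \<in> convex hull T \<Longrightarrow> v p = g p"
  shows "cubic_piece v T = g"
proof -
  have "\<exists>g. poly2vec 3 g \<and> (\<forall>y\<in>convex hull T. v y = g y)" using assms by blast
  from someI_ex[OF this]
  have "poly2vec 3 (cubic_piece v T)" "\<And>p. p \<in> convex hull T \<Longrightarrow> v p = cubic_piece v T p"
    unfolding cubic_piece_def by blast+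
  then show ?thesis using assms triangle_interior[OF tri[OF assms(1)]]
    by (intro poly2vec_unique[of 3 _ _ "{p. \<forall>a\<in>T. lam T a p > 0}"]) (auto simp del: split_paired_All)
qed

lemma div_piece_poly2: "v \<in> Vh3 Th \<Omega> \<Longrightarrow> T \<in> Th \<Longrightarrow> poly2 2 (div_piece v T)"
  unfolding div_piece_def by (rule poly2vec3_divergence[OF cubic_piece(1)])

lemma div_piece_integrable: "v \<in> Vh3 Th \<Omega> \<Longrightarrow> T \<in> Th \<Longrightarrow> div_piece v T integrable_on convex hull T"
  by (intro triangle_integrable[OF tri] poly2_continuous[OF div_piece_poly2])

lemma Vh3_add:
  assumes "v \<in> Vh3 Th \<Omega>" "w \<in> Vh3 Th \<Omega>"
  shows "(\<lambda>p. v p + w p) \<in> Vh3 Th \<Omega>"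
    and "T \<in> Th \<Longrightarrow> div_piece (\<lambda>p. v p + w p) T p = div_piece v T p + div_piece w T p"
    and "T \<in> Th \<Longrightarrow> integral (convex hull T) (div_piece (\<lambda>p. v p + w p) T)
      = integral (convex hull T) (div_piece v T) + integral (convex hull T) (div_piece w T)"
proof -
  show "(\<lambda>p. v p + w p) \<in> Vh3 Th \<Omega>"
    using assms cubic_piece
    by (intro Vh3I[of "\<lambda>T p. cubic_piece v T p + cubic_piece w T p"] poly2vec_add) (auto simp: Vh3_def)
  have e: "div_piece (\<lambda>p. v p + w p) T = (\<lambda>p. div_piece v T p + div_piece w T p)" if T: "T \<in> Th" for T
  proof -
    have "cubic_piece (\<lambda>p. v p + w p) T = (\<lambda>p. cubic_piece v T p + cubic_piece w T p)"
      using assms cubic_piece[OF _ T] by (intro cubic_piece_eqI[OF T] poly2vec_add) auto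
    then show ?thesis unfolding div_piece_def using divergence_add assms cubic_piece(1)[OF _ T] by auto
  qed
  show "div_piece (\<lambda>p. v p + w p) T p = div_piece v T p + div_piece w T p" if T: "T \<in> Th"
    using e[OF T] by simp
  show "integral (convex hull T) (div_piece (\<lambda>p. v p + w p) T)
      = integral (convex hull T) (div_piece v T) + integral (convex hull T) (div_piece w T)" if T: "T \<in> Th"
    unfolding e[OF T] using div_piece_integrable[OF _ T] assms
    by (simp add: Henstock_Kurzweil_Integration.integral_add)
qed

lemma Vh3_scaleR:
  assumes "v \<in> Vh3 Th \<Omega>"
  shows "(\<lambda>p. r *\<^sub>R v p) \<in> Vh3 Th \<Omega>"
    and "T \<in> Th \<Longrightarrow> div_piece (\<lambda>p. r *\<^sub>R v p) T p = r * div_piece v T p"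
    and "T \<in> Th \<Longrightarrow> integral (convex hull T) (div_piece (\<lambda>p. r *\<^sub>R v p) T)
      = r * integral (convex hull T) (div_piece v T)"
proof -
  show "(\<lambda>p. r *\<^sub>R v p) \<in> Vh3 Th \<Omega>"
    using assms cubic_piece
    by (intro Vh3I[of "\<lambda>T p. r *\<^sub>R cubic_piece v T p"] poly2vec_scaleR) (auto simp: Vh3_def)
  have e: "div_piece (\<lambda>p. r *\<^sub>R v p) T = (\<lambda>p. r * div_piece v T p)" if T: "T \<in> Th" for T
  proof -
    have "cubic_piece (\<lambda>p. r *\<^sub>R v p) T = (\<lambda>p. r *\<^sub>R cubic_piece v T p)"
      using assms cubic_piece[OF _ T] by (intro cubic_piece_eqI[OF T] poly2vec_scaleR) auto
    then show ?thesis unfolding div_piece_def using divergence_scaleR assms cubic_piece(1)[OF _ T] by auto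
  qed
  show "div_piece (\<lambda>p. r *\<^sub>R v p) T p = r * div_piece v T p" if T: "T \<in> Th"
    using e[OF T] by simp
  show "integral (convex hull T) (div_piece (\<lambda>p. r *\<^sub>R v p) T)
      = r * integral (convex hull T) (div_piece v T)" if T: "T \<in> Th"
    unfolding e[OF T] by simp
qed

lemma Vh3_zero:
  shows "(\<lambda>p. 0) \<in> Vh3 Th \<Omega>" and "T \<in> Th \<Longrightarrow> div_piece (\<lambda>p. 0) T p = 0"
    and "T \<in> Th \<Longrightarrow> integral (convex hull T) (div_piece (\<lambda>p. 0) T) = 0"
proof -
  show z: "(\<lambda>p. 0) \<in> Vh3 Th \<Omega>" by (rule Vh3I[of "\<lambda>_ p. 0"]) (auto simp: poly2vec_zero)
  show "div_piece (\<lambda>p. 0) T p = 0" if "T \<in> Th" using Vh3_scaleR(2)[OF z that, of 0] by simp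
  show "integral (convex hull T) (div_piece (\<lambda>p. 0) T) = 0" if "T \<in> Th" using Vh3_scaleR(3)[OF z that, of 0] by simp
qed

lemma Vh3_sum:
  assumes "finite I" "\<And>i. i \<in> I \<Longrightarrow> v i \<in> Vh3 Th \<Omega>"
  shows "(\<lambda>p. \<Sum>i\<in>I. v i p) \<in> Vh3 Th \<Omega> \<and> (\<forall>T\<in>Th. \<forall>p. div_piece (\<lambda>p. \<Sum>i\<in>I. v i p) T p = (\<Sum>i\<in>I. div_piece (v i) T p)) \<and>
     (\<forall>T\<in>Th. integral (convex hull T) (div_piece (\<lambda>p. \<Sum>i\<in>I. v i p) T) = (\<Sum>i\<in>I. integral (convex hull T) (div_piece (v i) T)))"
  using assms
proof (induction I)
  case empty
  then show ?case by (simp add: Vh3_zero)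
next
  case (insert i I)
  then have "v i \<in> Vh3 Th \<Omega>" "(\<lambda>p. \<Sum>i\<in>I. v i p) \<in> Vh3 Th \<Omega>" by auto
  note a = Vh3_add[OF this]
  have IH: "div_piece (\<lambda>p. \<Sum>i\<in>I. v i p) T p = (\<Sum>i\<in>I. div_piece (v i) T p)"
    "integral (convex hull T) (div_piece (\<lambda>p. \<Sum>i\<in>I. v i p) T) = (\<Sum>i\<in>I. integral (convex hull T) (div_piece (v i) T))"
    if "T \<in> Th" for T p
    using insert.IH insert.prems that by blast+
  have e: "(\<lambda>p. \<Sum>i\<in>insert i I. v i p) = (\<lambda>p. v i p + (\<Sum>i\<in>I. v i p))" using insert by simp
  show ?case unfolding e
  proof (intro conjI ballI allI)
    show "(\<lambda>p. v i p + (\<Sum>i\<in>I. v i p)) \<in> Vh3 Th \<Omega>" by (rule a(1))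
    fix T assume T: "T \<in> Th"
    show "div_piece (\<lambda>p. v i p + (\<Sum>i\<in>I. v i p)) T p = (\<Sum>i\<in>insert i I. div_piece (v i) T p)" for p
      using insert.hyps by (simp add: a(2)[OF T] IH(1)[OF T])
    show "integral (convex hull T) (div_piece (\<lambda>p. v i p + (\<Sum>i\<in>I. v i p)) T)
      = (\<Sum>i\<in>insert i I. integral (convex hull T) (div_piece (v i) T))"
      using insert.hyps by (simp add: a(3)[OF T] IH(2)[OF T])
  qed
qed

text \<open>On the common face the coordinates of vertices outside it vanish, so the pieces
  \<open>lam T a\<close> fit together to a continuous hat function; any product of them glues as
  well.\<close>

lemma lam_on_shared:
  assumes "T \<in> Th" "T' \<in> Th" "p \<in> convex hull T" "p \<in> convex hull T'" "a \<in> T"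
  shows "lam T a p = (if a \<in> T' then lam T' a p else 0)"
proof (cases "T = T'")
  case False
  have p: "p \<in> convex hull (T \<inter> T')" using hull_inter[OF assms(1,2) False] assms by blast
  show ?thesis
  proof (cases "a \<in> T'")
    case True
    have z: "lam T x p = 0" if "x \<in> T - T'" for x
      using lam_zero_on_face[OF tri[OF assms(1)] _ _ _ p] that by auto
    have z': "lam T' a x * lam T x p = (if x = a then lam T a p else 0)" if "x \<in> T" for x
      using z[of x] lam_vertex[OF tri[OF assms(2)] True, of x] that by (cases "x \<in> T'") auto
    have "lam T' a p = (\<Sum>x\<in>T. lam T x p * lam T' a x)"
      by (rule lam_expand[OF tri[OF assms(1)] tri[OF assms(2)] True])
    also have "\<dots> = (\<Sum>x\<in>T. if x = a then lam T a p else 0)" using z' by (intro sum.cong) (auto simp: mult.commute)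
    also have "\<dots> = lam T a p" using assms triangle_finite[OF tri[OF assms(1)]] by simp
    finally show ?thesis using True by simp
  next
    case False
    then show ?thesis using lam_zero_on_face[OF tri[OF assms(1)] assms(5) _ _ p] by auto
  qed
qed (use assms in auto)

lemma Vh3_glue:
  assumes "\<And>T. T \<in> Th \<Longrightarrow> poly2vec 3 (g T)"
    and "\<And>T T' p. T \<in> Th \<Longrightarrow> T' \<in> Th \<Longrightarrow> p \<in> convex hull T \<Longrightarrow> p \<in> convex hull T' \<Longrightarrow> g T p = g T' p"
    and "\<And>T p. T \<in> Th \<Longrightarrow> p \<in> convex hull T \<Longrightarrow> p \<notin> \<Omega> \<Longrightarrow> g T p = 0"
  obtains v where "v \<in> Vh3 Th \<Omega>" "\<And>T. T \<in> Th \<Longrightarrow> div_piece v T = divergence (g T)"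
proof -
  define v where "v p = (if p \<in> \<Omega> then g (SOME T. T \<in> Th \<and> p \<in> convex hull T) p else 0)" for p
  have v: "v p = g T p" if T: "T \<in> Th" "p \<in> convex hull T" for T p
  proof (cases "p \<in> \<Omega>")
    case True
    have "\<exists>T. T \<in> Th \<and> p \<in> convex hull T" using T by blast
    from someI_ex[OF this] have "g (SOME T. T \<in> Th \<and> p \<in> convex hull T) p = g T p"
      using T by (intro assms(2)) blast+
    then show ?thesis using True by (simp add: v_def)
  qed (simp add: v_def assms(3)[OF T])
  have "v \<in> Vh3 Th \<Omega>" using assms(1) v by (rule Vh3I) (auto simp: v_def)
  moreover have "div_piece v T = divergence (g T)" if "T \<in> Th" for T
    unfolding div_piece_def using cubic_piece_eqI[OF that assms(1)[OF that] v[OF that]] by simp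
  ultimately show ?thesis using that by blast
qed

end

section \<open>Cubic fields attached to one edge\<close>

lemma mid_doubleton: "b \<noteq> c \<Longrightarrow> mid {b, c} = (1/2) *\<^sub>R b + (1/2) *\<^sub>R c"
  by (simp add: mid_def scaleR_add_right)

lemma lam_mid:
  assumes "is_triangle T" "a \<in> T" "b \<in> T" "c \<in> T" "b \<noteq> c"
  shows "lam T a (mid {b, c}) = ((if a = b then 1 else 0) + (if a = c then 1 else 0)) / 2"
  using lam_homothety[OF assms(1-3), of c] lam_vertex[OF assms(1,2,4)] mid_doubleton[OF assms(5)] by simp

text \<open>One family serves three purposes: parameters 1, 1 move mass across the edge, 1, 0 with a
  tangential direction give equal values on both sides, and 1, -1 give zero means for every
  direction.\<close>

definition edge_poly :: "pt set \<Rightarrow> pt \<Rightarrow> pt \<Rightarrow> real \<Rightarrow> real \<Rightarrow> pt \<Rightarrow> real" where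
  "edge_poly T z y \<alpha> \<beta> p = lam T z p * lam T y p * (\<alpha> * lam T z p + \<beta> * lam T y p)"

lemma edge_poly_poly2:
  assumes "is_triangle T" "z \<in> T" "y \<in> T" shows "poly2 3 (edge_poly T z y \<alpha> \<beta>)"
proof -
  have "poly2 1 (lam T z)" "poly2 1 (lam T y)" using assms by (auto intro: lam_poly2)
  then have "poly2 2 (\<lambda>p. lam T z p * lam T y p)" "poly2 1 (\<lambda>p. \<alpha> * lam T z p + \<beta> * lam T y p)"
    by (auto intro!: poly2_mult[of 1 _ 1] poly2_add poly2_cmult)
  then show ?thesis unfolding edge_poly_def[abs_def] by (rule poly2_mult) simp
qed

lemma edge_poly_has_derivative:
  assumes "is_triangle T" "z \<in> T" "y \<in> T"
  shows "(edge_poly T z y \<alpha> \<beta> has_derivative (\<lambda>h. ((lam T y p * (2 * \<alpha> * lam T z p + \<beta> * lam T y p)) *\<^sub>R grad T z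
     + (lam T z p * (\<alpha> * lam T z p + 2 * \<beta> * lam T y p)) *\<^sub>R grad T y) \<bullet> h)) (at p)"
  unfolding edge_poly_def[abs_def]
  by (auto intro!: derivative_eq_intros lam_has_derivative assms simp: inner_add_left algebra_simps)

lemma edge_poly_divergence:
  assumes "is_triangle T" "z \<in> T" "y \<in> T"
  shows "divergence (\<lambda>p. edge_poly T z y \<alpha> \<beta> p *\<^sub>R c) p = lam T y p * (2 * \<alpha> * lam T z p + \<beta> * lam T y p) * (grad T z \<bullet> c)
     + lam T z p * (\<alpha> * lam T z p + 2 * \<beta> * lam T y p) * (grad T y \<bullet> c)"
  using divergence_scaleR_field[OF edge_poly_has_derivative[OF assms]] by (simp add: inner_add_left)

text \<open>The scalar factor vanishes on the two other edges and at the vertices, and equals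
  (\<alpha> + \<beta>)/8 at the midpoint of the edge from \<open>z\<close> to \<open>y\<close>.
  Simpson's weight 4/6 makes this (\<alpha> + \<beta>)/12.\<close>

lemma edge_poly_integral:
  assumes t: "is_triangle T" and T: "T = {z, y, d}" "z \<noteq> y" "z \<noteq> d" "y \<noteq> d"
  shows "integral (convex hull T) (divergence (\<lambda>p. edge_poly T z y \<alpha> \<beta> p *\<^sub>R c)) = - area T / 6 * (\<alpha> + \<beta>) * (grad T d \<bullet> c)"
proof -
  let ?g = "\<lambda>p. edge_poly T z y \<alpha> \<beta> p *\<^sub>R c"
  have m: "z \<in> T" "y \<in> T" "d \<in> T" using T by auto
  have g: "poly2vec 3 ?g" by (intro poly2vec_scaleR_field edge_poly_poly2 t m)
  have e: "T - {z} = {y, d}" "T - {y} = {z, d}" "T - {d} = {z, y}" using T by auto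
  let ?\<phi> = "edge_poly T z y \<alpha> \<beta>"
  have "?\<phi> z = 0" "?\<phi> y = 0" "?\<phi> d = 0"
    using lam_vertex[OF t, of z] lam_vertex[OF t, of y] m T(2-4) by (simp_all add: edge_poly_def)
  moreover have l: "lam T z (mid {y, d}) = 0" "lam T y (mid {z, d}) = 0" "lam T z (mid {z, y}) = 1/2" "lam T y (mid {z, y}) = 1/2"
    using lam_mid[OF t m(1) m(2) m(3)] lam_mid[OF t m(2) m(1) m(3)]
      lam_mid[OF t m(1) m(1) m(2)] lam_mid[OF t m(2) m(1) m(2)] T(2-4) by simp_all
  then have "?\<phi> (mid {y, d}) = 0" "?\<phi> (mid {z, d}) = 0" "?\<phi> (mid {z, y}) = (\<alpha> + \<beta>) / 8"
    unfolding edge_poly_def l by (simp_all add: field_simps)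
  ultimately have s: "simpson {y, d} ?g = 0" "simpson {z, d} ?g = 0" "simpson {z, y} ?g = ((\<alpha> + \<beta>) / 12) *\<^sub>R c"
    using T(2-4) by (simp_all add: simpson_def)
  have "(\<Sum>x\<in>T. grad T x \<bullet> simpson (T - {x}) ?g) = grad T z \<bullet> simpson (T - {z}) ?g
     + grad T y \<bullet> simpson (T - {y}) ?g + grad T d \<bullet> simpson (T - {d}) ?g"
    using T(2-4) by (subst T(1)) simp
  then have "(\<Sum>x\<in>T. grad T x \<bullet> simpson (T - {x}) ?g) = (\<alpha> + \<beta>) / 12 * (grad T d \<bullet> c)"
    unfolding e s by simp
  then show ?thesis unfolding triangle_divergence[OF t g] by simp
qed

text \<open>Two neighbouring pieces agree only along their edge, so just the derivative in the edge
  direction is shared; it is taken one-sidedly along the segment.\<close>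

lemma directional_derivative_unique:
  fixes x y :: pt and g h :: "pt \<Rightarrow> pt"
  assumes "(g has_derivative D) (at x)" "(h has_derivative E) (at x)"
    and eq: "\<And>p. p \<in> closed_segment x y \<Longrightarrow> g p = h p"
  shows "D (y - x) = E (y - x)"
proof -
  have *: "((\<lambda>t. g (x + t *\<^sub>R (y - x))) has_vector_derivative D (y - x)) (at 0 within {0..1})"
    if "(g has_derivative D) (at x)" for g D
  proof -
    interpret bounded_linear D using that has_derivative_bounded_linear by blast
    have "((\<lambda>t::real. x + t *\<^sub>R (y - x)) has_derivative (\<lambda>t. t *\<^sub>R (y - x))) (at 0 within {0..1})"
      by (auto intro!: derivative_eq_intros)
    from has_derivative_compose[OF this, of g D] that show ?thesis
      by (simp add: has_vector_derivative_def scaleR)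
  qed
  have "x + t *\<^sub>R (y - x) \<in> closed_segment x y" if "t \<in> {0..1}" for t
    using that by (auto simp: in_segment algebra_simps intro!: exI[of _ t])
  then have e: "h (x + t *\<^sub>R (y - x)) = g (x + t *\<^sub>R (y - x))" if "t \<in> {0..1}" for t
    using that eq by simp
  have "((\<lambda>t. h (x + t *\<^sub>R (y - x))) has_vector_derivative D (y - x)) (at 0 within {0..1})"
    by (rule has_vector_derivative_transform[OF _ _ *[OF assms(1)]]) (use e in auto)
  from vector_derivative_unique_within[OF _ this *[OF assms(2)]] show ?thesis
    by (simp add: trivial_limit_within islimpt_Icc)
qed

text \<open>The trace is the infinitesimal change of area. For edge directions \<open>u\<close> and
  \<open>w\<close> this splits a divergence into one contribution per edge.\<close>

lemma trace_det2:
  assumes "bounded_linear D"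
  shows "det2 (D u) w + det2 u (D w) = (fst (D (1, 0)) + snd (D (0, 1))) * det2 u w"
proof -
  interpret bounded_linear D by fact
  have D: "D p = fst p *\<^sub>R D (1, 0) + snd p *\<^sub>R D (0, 1)" for p
  proof -
    have "p = fst p *\<^sub>R (1, 0) + snd p *\<^sub>R (0, 1)" by (simp add: scaleR_Pair)
    then show ?thesis by (metis add scaleR)
  qed
  show ?thesis by (subst (1 2) D) (simp add: det2_def algebra_simps)
qed

context mesh
begin

text \<open>At each endpoint one of the two coordinates is 1 and the other 0, so the divergence
  there keeps a single term: \<alpha> governs the value at \<open>z\<close> and \<beta> the value at
  \<open>y\<close>. The second triangle on the edge is what makes the field vanish outside the open
  domain.\<close>

lemma edge_field:
  assumes "T1 \<in> Th" "T2 \<in> Th" "T1 \<noteq> T2" "z \<noteq> y" "{z, y} \<subseteq> T1" "{z, y} \<subseteq> T2"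
  obtains v where "v \<in> Vh3 Th \<Omega>"
    "\<And>T. T \<in> Th \<Longrightarrow> {z, y} \<subseteq> T \<Longrightarrow> div_piece v T z = \<alpha> * (grad T y \<bullet> c)"
    "\<And>T. T \<in> Th \<Longrightarrow> {z, y} \<subseteq> T \<Longrightarrow> div_piece v T y = \<beta> * (grad T z \<bullet> c)"
    "\<And>T d. T \<in> Th \<Longrightarrow> d \<in> T \<Longrightarrow> d \<noteq> z \<Longrightarrow> d \<noteq> y \<Longrightarrow> div_piece v T d = 0"
    "\<And>T d. T \<in> Th \<Longrightarrow> T = {z, y, d} \<Longrightarrow> integral (convex hull T) (div_piece v T) = - area T / 6 * (\<alpha> + \<beta>) * (grad T d \<bullet> c)"
    "\<And>T p. T \<in> Th \<Longrightarrow> \<not> {z, y} \<subseteq> T \<Longrightarrow> div_piece v T p = 0"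
    "\<And>T. T \<in> Th \<Longrightarrow> \<not> {z, y} \<subseteq> T \<Longrightarrow> integral (convex hull T) (div_piece v T) = 0"
proof -
  define g where "g T = (if {z, y} \<subseteq> T then (\<lambda>p. edge_poly T z y \<alpha> \<beta> p *\<^sub>R c) else (\<lambda>p. 0))" for T
  have poly: "poly2vec 3 (g T)" if "T \<in> Th" for T
    unfolding g_def using tri[OF that] by (auto intro!: poly2vec_scaleR_field edge_poly_poly2 poly2vec_zero)
  have comp: "g T p = g T' p" if h: "T \<in> Th" "T' \<in> Th" "p \<in> convex hull T" "p \<in> convex hull T'" for T T' p
  proof -
    have z0: "edge_poly S z y \<alpha> \<beta> p = 0" if "{z, y} \<subseteq> S" "\<not> {z, y} \<subseteq> S'" "S \<in> Th" "S' \<in> Th" "p \<in> convex hull S" "p \<in> convex hull S'" for S S'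
      using that lam_on_shared[OF that(3,4,5,6), of z] lam_on_shared[OF that(3,4,5,6), of y] by (auto simp: edge_poly_def)
    show ?thesis
    proof (cases "{z, y} \<subseteq> T \<and> {z, y} \<subseteq> T'")
      case True
      then have "lam T z p = lam T' z p" "lam T y p = lam T' y p"
        using lam_on_shared[OF h, of z] lam_on_shared[OF h, of y] by auto
      then show ?thesis unfolding g_def edge_poly_def using True by simp
    qed (use z0[of T T'] z0[of T' T] h in \<open>auto simp: g_def\<close>)
  qed
  have bd: "g T p = 0" if h: "T \<in> Th" "p \<in> convex hull T" "p \<notin> \<Omega>" for T p
  proof (cases "{z, y} \<subseteq> T")
    case True
    obtain T' where T': "T' \<in> Th" "T' \<noteq> T" "{z, y} \<subseteq> T'" using assms by metis
    \<comment> \<open>A point with both coordinates positive belongs to the open domain because the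
      edge is shared; outside, one factor of the edge polynomial must vanish.\<close>
    have "\<not> (lam T z p > 0 \<and> lam T y p > 0)"
      using shared_edge_in_Omega[OF h(1) T'(1) _ assms(4) True T'(3) h(2)] T' h(3) by auto
    moreover have "lam T z p \<ge> 0" "lam T y p \<ge> 0" using in_hull_iff[OF tri[OF h(1)]] h(2) True by auto
    ultimately have "lam T z p = 0 \<or> lam T y p = 0" by linarith
    then show ?thesis unfolding g_def edge_poly_def by auto
  next
    case False
    then show ?thesis unfolding g_def by (simp only: if_False)
  qed
  obtain v where v: "v \<in> Vh3 Th \<Omega>" "\<And>T. T \<in> Th \<Longrightarrow> div_piece v T = divergence (g T)"
    using Vh3_glue[of g, OF poly comp bd] by blast
  have 0: "divergence (\<lambda>p. 0) p = 0" for p by (simp add: divergence_def)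
  have n: "div_piece v T = (\<lambda>p. 0)" if "T \<in> Th" "\<not> {z, y} \<subseteq> T" for T
    using v(2)[OF that(1)] that 0 by (auto simp: g_def)
  have y: "div_piece v T = divergence (\<lambda>p. edge_poly T z y \<alpha> \<beta> p *\<^sub>R c)" if "T \<in> Th" "{z, y} \<subseteq> T" for T
    using v(2)[OF that(1)] that(2) by (simp add: g_def)
  have dv: "div_piece v T p = lam T y p * (2 * \<alpha> * lam T z p + \<beta> * lam T y p) * (grad T z \<bullet> c)
     + lam T z p * (\<alpha> * lam T z p + 2 * \<beta> * lam T y p) * (grad T y \<bullet> c)" if "T \<in> Th" "{z, y} \<subseteq> T" for T p
    unfolding y[OF that] using that by (intro edge_poly_divergence tri) auto
  show ?thesis
  proof (rule that[OF v(1)])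
    fix T assume T: "T \<in> Th" "{z, y} \<subseteq> T"
    then have m: "z \<in> T" "y \<in> T" by auto
    note l = lam_vertex[OF tri[OF T(1)]]
    show "div_piece v T z = \<alpha> * (grad T y \<bullet> c)" unfolding dv[OF T] using l[of z z] l[of y z] m assms(4) by simp
    show "div_piece v T y = \<beta> * (grad T z \<bullet> c)" unfolding dv[OF T] using l[of z y] l[of y y] m assms(4) by simp
  next
    fix T d assume T: "T \<in> Th" "d \<in> T" "d \<noteq> z" "d \<noteq> y"
    show "div_piece v T d = 0"
    proof (cases "{z, y} \<subseteq> T")
      case True
      show ?thesis unfolding dv[OF T(1) True] using lam_vertex[OF tri[OF T(1)], of _ d] T True by simp
    qed (simp add: n[OF T(1)])
  next
    fix T d assume T: "T \<in> Th" "T = {z, y, d}"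
    then have "z \<noteq> d" "y \<noteq> d" using triangle_card[OF tri[OF T(1)]] by (auto simp: card_insert_if split: if_splits)
    then show "integral (convex hull T) (div_piece v T) = - area T / 6 * (\<alpha> + \<beta>) * (grad T d \<bullet> c)"
      using y[OF T(1)] edge_poly_integral[OF tri[OF T(1)] T(2) assms(4)] T(2) by simp
  qed (use n in auto)
qed

text \<open>The two outward normals of a common edge, scaled by its length, cancel. The gradients
  are proportional with a negative factor whose absolute value is the quotient of the areas.\<close>

lemma area_grad_opposite:
  assumes "{a, b, c} \<in> Th" "{a, b, d} \<in> Th" "c \<noteq> d"
    "det2 (b - a) (c - a) \<noteq> 0" "det2 (b - a) (d - a) \<noteq> 0"
  shows "area {a, b, c} *\<^sub>R grad {a, b, c} c + area {a, b, d} *\<^sub>R grad {a, b, d} d = 0"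
proof -
  let ?k = "lam {a, b, c} c d"
  have k: "?k < 0" by (rule opposite_sides[OF assms])
  have g: "grad {a, b, c} c = ?k *\<^sub>R grad {a, b, d} d"
    unfolding grad_def edge_expand[OF assms(1,2,4,5), of "(1, 0)"] edge_expand[OF assms(1,2,4,5), of "(0, 1)"]
      edge_expand[OF assms(1,2,4,5), of 0] by (simp add: right_diff_distrib)
  have "?k = det2 (a - d) (b - d) / det2 (a - c) (b - c)"
    using lam_eq[OF triangle_perm(2)[OF assms(4)], of d] by (simp add: insert_commute)
  moreover have "det2 (a - x) (b - x) = det2 (b - a) (x - a)" for x by (simp add: det2_def algebra_simps)
  ultimately have "?k = det2 (b - a) (d - a) / det2 (b - a) (c - a)" by (simp only:)
  then have "\<bar>?k\<bar> * \<bar>det2 (b - a) (c - a)\<bar> = \<bar>det2 (b - a) (d - a)\<bar>" using assms(4) by (simp add: abs_divide)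
  then have "area {a, b, c} * ?k = - area {a, b, d}"
    unfolding area_eq[OF assms(4)] area_eq[OF assms(5)] using k by (simp add: field_simps)
  then show ?thesis unfolding g by (metis scaleR_scaleR scaleR_minus_left add.left_inverse)
qed

section \<open>Zero total mean of a divergence\<close>

lemma Vh3_frontier: "v \<in> Vh3 Th \<Omega> \<Longrightarrow> p \<in> frontier \<Omega> \<Longrightarrow> v p = 0"
proof -
  assume "v \<in> Vh3 Th \<Omega>" "p \<in> frontier \<Omega>"
  then have "\<forall>p. p \<notin> \<Omega> \<longrightarrow> v p = 0" "p \<notin> \<Omega>" using Omega_open by (simp_all add: Vh3_def frontier_def interior_open)
  then show ?thesis by blast
qed

text \<open>Fluxes are indexed by a triangle and the vertex opposite to the edge, then regrouped by
  edge. A shared edge carries two cancelling fluxes; on a boundary edge the field vanishes at the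
  three Simpson nodes.\<close>

lemma total_mean_zero:
  assumes v: "v \<in> Vh3 Th \<Omega>"
  shows "(\<Sum>T\<in>Th. integral (convex hull T) (div_piece v T)) = 0"
proof -
  define F where "F = (\<lambda>(T, c). (area T *\<^sub>R grad T c) \<bullet> simpson (T - {c}) v)"
  define P where "P = Sigma Th (\<lambda>T. T)"
  define edge where "edge = (\<lambda>(T, c). T - {c :: pt})"
  have fin: "finite P" unfolding P_def using finite_Th triangle_finite tri by blast
  have I: "integral (convex hull T) (div_piece v T) = - 2 * (\<Sum>c\<in>T. F (T, c))" if T: "T \<in> Th" for T
  proof -
    \<comment> \<open>Simpson's nodes lie in the closed triangle, so the piece can be replaced by
      \<open>v\<close> itself; the two sides of an edge then use the same data.\<close>
    have "simpson (T - {c}) (cubic_piece v T) = simpson (T - {c}) v" if c: "c \<in> T" for c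
    proof -
      obtain a b where ab: "T = {c, a, b}" "det2 (a - c) (b - c) \<noteq> 0" using triangleE1[OF tri[OF T] c] by blast
      note d = det2_distinct[OF ab(2)]
      have e: "T - {c} = {a, b}" using ab d by auto
      have "mid {a, b} \<in> convex hull T" unfolding in_hull_iff[OF tri[OF T]]
      proof
        fix x assume "x \<in> T"
        then show "lam T x (mid {a, b}) \<ge> 0" using lam_mid[OF tri[OF T], of x a b] d ab(1) by (auto simp del: split_paired_All)
      qed
      moreover have "a \<in> convex hull T" "b \<in> convex hull T" using ab by (auto intro: hull_inc)
      ultimately show ?thesis unfolding e simpson_def using d cubic_piece(2)[OF v T] by simp
    qed
    then show ?thesis unfolding div_piece_def triangle_divergence[OF tri[OF T] cubic_piece(1)[OF v T]] F_def
      by (simp add: sum_distrib_left mult.assoc)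
  qed
  have "(\<Sum>x\<in>{x \<in> P. edge x = e}. F x) = 0" if e: "e \<in> edge ` P" for e
  proof -
    obtain T c where T: "T \<in> Th" "c \<in> T" "e = T - {c}" using e unfolding P_def edge_def by auto
    obtain a b where ab: "T = {c, a, b}" "det2 (a - c) (b - c) \<noteq> 0" using triangleE1[OF tri[OF T(1)] T(2)] by blast
    note d = det2_distinct[OF ab(2)]
    have e': "e = {a, b}" using ab d T by auto
    show ?thesis
    proof (cases "\<exists>T'\<in>Th. T' \<noteq> T \<and> {a, b} \<subseteq> T'")
      case True
      then obtain T' where T': "T' \<in> Th" "T' \<noteq> T" "{a, b} \<subseteq> T'" by blast
      have "{a, b} \<subseteq> T" using ab by auto
      obtain c' d' where cd: "T = {a, b, c'}" "T' = {a, b, d'}" "c' \<noteq> d'"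
        "det2 (b - a) (c' - a) \<noteq> 0" "det2 (b - a) (d' - a) \<noteq> 0"
        using shared_edge_triangles[OF T(1) T'(1) T'(2)[symmetric] d(3) \<open>{a, b} \<subseteq> T\<close> T'(3)] by metis
      note dd = det2_distinct[OF cd(4)] det2_distinct[OF cd(5)]
      have c': "c' = c" using ab cd d dd by auto
      have "{x \<in> P. edge x = e} = {(T, c'), (T', d')}"
      proof (intro set_eqI iffI)
        fix x assume "x \<in> {x \<in> P. edge x = e}"
        then obtain S s where x: "x = (S, s)" "S \<in> Th" "s \<in> S" "S - {s} = {a, b}" unfolding P_def edge_def e' by auto
        then have "S = T \<or> S = T'" using at_most_two[OF T(1) T'(1) x(2) d(3) \<open>{a, b} \<subseteq> T\<close> T'(3)] T'(2) by blast
        then show "x \<in> {(T, c'), (T', d')}" using x cd dd by auto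
      next
        fix x assume "x \<in> {(T, c'), (T', d')}"
        moreover have "{a, b, c'} - {c'} = {a, b}" "{a, b, d'} - {d'} = {a, b}" using dd by auto
        ultimately show "x \<in> {x \<in> P. edge x = e}" unfolding P_def edge_def e' using T T' cd by auto
      qed
      moreover have "{a, b, c'} - {c'} = {a, b}" "{a, b, d'} - {d'} = {a, b}" using dd by auto
      ultimately have "(\<Sum>x\<in>{x \<in> P. edge x = e}. F x)
         = (area {a, b, c'} *\<^sub>R grad {a, b, c'} c' + area {a, b, d'} *\<^sub>R grad {a, b, d'} d') \<bullet> simpson {a, b} v"
        using T'(2) unfolding F_def inner_add_left by (simp add: cd(1,2))
      also have "\<dots> = 0" using area_grad_opposite[of a b c' d'] T(1) T'(1) cd by simp
      finally show ?thesis .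
    next
      case False
      then have "closed_segment a b \<subseteq> frontier \<Omega>" using boundary_edge[OF T(1), of a b] ab d by auto
      moreover have "a \<in> closed_segment a b" "b \<in> closed_segment a b" "mid {a, b} \<in> closed_segment a b"
        using midpoint_in_closed_segment[of a b] d by (auto simp: mid_def midpoint_def)
      ultimately have "v a = 0" "v b = 0" "v (mid {a, b}) = 0" using Vh3_frontier[OF v] by blast+
      then have "simpson {a, b} v = 0" unfolding simpson_def using d by simp
      then show ?thesis by (intro sum.neutral) (auto simp: F_def edge_def e')
    qed
  qed
  then have "(\<Sum>x\<in>P. F x) = 0" using sum.image_gen[OF fin, of F edge] by simp
  moreover have "(\<Sum>x\<in>P. F x) = (\<Sum>T\<in>Th. \<Sum>c\<in>T. F (T, c))"
    unfolding P_def using finite_Th triangle_finite tri by (subst sum.Sigma) auto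
  ultimately show ?thesis using I by (simp add: sum_negf flip: sum_distrib_left)
qed

end

section \<open>The fan of triangles at a vertex\<close>

lemma triangle_three:
  assumes "is_triangle T" "x \<in> T" "a \<in> T" "b \<in> T" "x \<noteq> a" "x \<noteq> b" "a \<noteq> b"
  shows "T = {x, a, b}" "det2 (a - x) (b - x) \<noteq> 0"
proof -
  obtain c where c: "T = {x, a, c}" "det2 (a - x) (c - x) \<noteq> 0" using triangleE2[OF assms(1-3,5)] by blast
  then have "b = c" using assms by auto
  with c show "T = {x, a, b}" "det2 (a - x) (b - x) \<noteq> 0" by auto
qed

lemma mod_Suc_neq: "2 \<le> N \<Longrightarrow> j mod N \<noteq> Suc j mod N" for N :: nat
  by (auto simp: mod_Suc)

lemma mod_Suc_Suc_neq: "3 \<le> N \<Longrightarrow> j mod N \<noteq> Suc (Suc j) mod N" for N :: nat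
  by (auto simp: mod_Suc split: if_splits)

context mesh
begin

lemma vertex_frontier: "x \<in> vertices Th \<Longrightarrow> x \<notin> \<Omega> \<Longrightarrow> x \<in> frontier \<Omega>"
  using Omega_open closure_Omega unfolding frontier_def vertices_def by (auto simp: interior_open intro: hull_inc)

text \<open>Lying on opposite sides of the edge from \<open>x\<close> to \<open>b\<close>, expressed
  as a rotation: the directions to \<open>a\<close>, \<open>b\<close>, \<open>c\<close> turn the
  same way around \<open>x\<close>.\<close>

lemma opposite_dets:
  assumes "{x, a, b} \<in> Th" "{x, b, c} \<in> Th" "{x, a, b} \<noteq> {x, b, c}"
    "det2 (a - x) (b - x) \<noteq> 0" "det2 (b - x) (c - x) \<noteq> 0"
  shows "det2 (a - x) (b - x) * det2 (b - x) (c - x) > 0"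
proof -
  have d: "det2 (b - x) (a - x) \<noteq> 0" using triangle_perm(3)[OF assms(4)] .
  have "lam {x, b, a} a c < 0"
    by (rule opposite_sides) (use assms d in \<open>auto simp: insert_commute\<close>)
  moreover have "lam {x, b, a} a c = det2 (x - c) (b - c) / det2 (x - a) (b - a)"
    using lam_eq[OF triangle_perm(2)[OF d], of c] by (simp add: insert_commute)
  moreover have "det2 (x - c) (b - c) = det2 (b - x) (c - x)" "det2 (x - a) (b - a) = - det2 (a - x) (b - x)"
    by (simp_all add: det2_def algebra_simps)
  ultimately have "- (det2 (b - x) (c - x) / det2 (a - x) (b - x)) < 0" by simp
  then show ?thesis by (auto simp: zero_less_divide_iff zero_less_mult_iff)
qed

text \<open>Indices are taken modulo \<^term>\<open>N\<close>, so that around an interior vertex the fan can be followed past its last triangle.\<close>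
lemma enum_fan:
  assumes le: "local_enum Th \<Omega> x N Ts" and x: "x \<in> vertices Th"
  obtains u where "N \<ge> 1"
    "\<And>j. x \<in> \<Omega> \<or> j < N \<Longrightarrow> Ts (j mod N) \<in> star Th x"
    "\<And>j. x \<in> \<Omega> \<or> j < N \<Longrightarrow> Ts (j mod N) = {x, u j, u (Suc j)}"
    "\<And>j. x \<in> \<Omega> \<or> j < N \<Longrightarrow> det2 (u j - x) (u (Suc j) - x) \<noteq> 0"
    "\<And>j. x \<in> \<Omega> \<or> Suc j < N \<Longrightarrow> Ts (j mod N) \<noteq> Ts (Suc j mod N)"
    "\<And>j. x \<in> \<Omega> \<or> Suc j < N \<Longrightarrow> det2 (u j - x) (u (Suc j) - x) * det2 (u (Suc j) - x) (u (Suc (Suc j)) - x) > 0"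
    "x \<in> \<Omega> \<Longrightarrow> u N = u 0 \<and> u (Suc N) = u 1"
    "x \<notin> \<Omega> \<Longrightarrow> closed_segment x (u 0) \<subseteq> frontier \<Omega> \<and> closed_segment x (u N) \<subseteq> frontier \<Omega>"
proof -
  define S where "S j = Ts (j mod N)" for j
  have bij: "bij_betw Ts {..<N} (star Th x)" using le unfolding local_enum_def by blast
  have "star Th x \<noteq> {}" using x unfolding star_def vertices_def by blast
  then have N1: "N \<ge> 1" using bij by (cases N) (auto simp: bij_betw_def)
  have star: "S j \<in> star Th x" for j unfolding S_def using bij N1 by (auto simp: bij_betw_def)
  then have ST: "S j \<in> Th" "x \<in> S j" for j unfolding star_def by auto
  have inj: "S i \<noteq> S j" if "i mod N \<noteq> j mod N" for i j
    unfolding S_def using bij that N1 by (auto simp: bij_betw_def inj_on_def)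
  have only: "\<exists>j<N. T = S j" if "T \<in> Th" "x \<in> T" for T
  proof -
    have "T \<in> Ts ` {..<N}" using that bij unfolding star_def bij_betw_def by blast
    then show ?thesis unfolding S_def by auto
  qed
  have fr: "x \<in> \<Omega> \<longleftrightarrow> x \<notin> frontier \<Omega>" using vertex_frontier[OF x] Omega_open by (auto simp: frontier_def interior_open)
  have N2: "N \<ge> 2" if "x \<in> \<Omega>"
  proof (rule ccontr)
    assume "\<not> N \<ge> 2"
    then have "N = 1" using N1 by simp
    then have "card (Ts 0 \<inter> Ts 0) = 2" using le that unfolding local_enum_def by auto
    moreover have "card (Ts 0) = 3" using triangle_card[OF tri[OF ST(1)[of 0]]] unfolding S_def by simp
    ultimately show False by simp
  qed
  have card: "card (S j \<inter> S (Suc j)) = 2" if "x \<in> \<Omega> \<or> Suc j < N" for j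
  proof (cases "Suc (j mod N) = N")
    case True
    moreover have "x \<in> \<Omega>"
    proof (rule ccontr)
      assume "x \<notin> \<Omega>" then have "Suc j < N" using that by blast
      then show False using True by simp
    qed
    ultimately show ?thesis using le N1 unfolding local_enum_def S_def mod_Suc by (metis diff_Suc_1)
  next
    case False
    moreover have "j mod N < N" using N1 by simp
    ultimately have "Suc (j mod N) < N" by simp
    then show ?thesis using le False unfolding local_enum_def S_def mod_Suc by simp
  qed
  define w where "w j = (SOME w. w \<noteq> x \<and> S j \<inter> S (Suc j) = {x, w})" for j
  have w: "w j \<noteq> x" "S j \<inter> S (Suc j) = {x, w j}" if j: "x \<in> \<Omega> \<or> Suc j < N" for j
  proof -
    obtain a b where ab: "S j \<inter> S (Suc j) = {a, b}" "a \<noteq> b" using card[OF j] by (auto simp: card_2_iff)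
    have "x \<in> S j \<inter> S (Suc j)" using ST by blast
    then consider "x = a" | "x = b" unfolding ab(1) by blast
    then have "\<exists>w. w \<noteq> x \<and> S j \<inter> S (Suc j) = {x, w}"
      by cases (use ab in \<open>metis insert_commute\<close>)+
    from someI_ex[OF this] show "w j \<noteq> x" "S j \<inter> S (Suc j) = {x, w j}" unfolding w_def by blast+
  qed
  have wS: "w j \<in> S j" "w j \<in> S (Suc j)" if "x \<in> \<Omega> \<or> Suc j < N" for j using w(2)[OF that] by blast+
  have adj: "S j \<noteq> S (Suc j)" if "x \<in> \<Omega> \<or> Suc j < N" for j
    using mod_Suc_neq[of N j] N2 that by (intro inj) linarith
  \<comment> \<open>With two triangles sharing the edge to \<open>w 0\<close>, the remaining edge of
    the first at \<open>x\<close> would belong to no other triangle, so \<open>x\<close> would be a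
    boundary point.\<close>
  have "N \<noteq> 2" if xO: "x \<in> \<Omega>"
  proof
    assume N: "N = 2"
    obtain a where a: "S 0 = {x, w 0, a}" "det2 (w 0 - x) (a - x) \<noteq> 0"
      using triangleE2[OF tri[OF ST(1)[of 0]] ST(2) wS(1)[of 0]] w(1)[of 0] xO by metis
    note d = det2_distinct[OF a(2)]
    have "T = S 0" if T: "T \<in> Th" "{x, a} \<subseteq> T" for T
    proof -
      obtain j where j: "j < 2" "T = S j" using only[of T] T N by auto
      have "a \<notin> S 1" using w(2)[of 0] \<open>x \<in> \<Omega>\<close> a(1) d by auto
      then show ?thesis using j T by (cases j) (auto simp: less_2_cases_iff)
    qed
    then have "closed_segment x a \<subseteq> frontier \<Omega>"
      using boundary_edge[OF ST(1)[of 0], of x a] a d by auto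
    then show False using fr \<open>x \<in> \<Omega>\<close> by auto
  qed
  then have N3: "N \<ge> 3" if "x \<in> \<Omega>" using N2 that by force
  \<comment> \<open>Otherwise three consecutive triangles, distinct at an interior vertex because
    \<open>N\<close> is at least 3, would share one edge.\<close>
  have ww: "w j \<noteq> w (Suc j)" if "x \<in> \<Omega> \<or> Suc (Suc j) < N" for j
  proof
    assume e: "w j = w (Suc j)"
    have v: "x \<in> \<Omega> \<or> Suc j < N" using that by auto
    have "S j \<noteq> S (Suc (Suc j))" using that N3 mod_Suc_Suc_neq[of N j] by (intro inj) linarith
    moreover have "S (Suc j) = S (Suc (Suc j))"
      using at_most_two[of "S j" "S (Suc j)" "S (Suc (Suc j))" x "w j"] ST wS[OF v] wS[OF that] w(1)[OF v] e
        adj[OF v] calculation by auto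
    ultimately show False using adj[OF that] by blast
  qed
  have nf: "\<not> closed_segment x (w j) \<subseteq> frontier \<Omega>" if "x \<in> \<Omega> \<or> Suc j < N" for j
    using shared_edge_not_frontier[OF ST(1)[of j] ST(1)[of "Suc j"] adj[OF that], of x "w j"] w(1)[OF that] wS[OF that] ST by auto
  have "\<exists>u. (\<forall>j. x \<in> \<Omega> \<or> j < N \<longrightarrow> u j \<in> S j \<and> u (Suc j) \<in> S j \<and> u j \<noteq> x \<and> u (Suc j) \<noteq> x \<and> u j \<noteq> u (Suc j)) \<and>
    (x \<in> \<Omega> \<longrightarrow> u N = u 0 \<and> u (Suc N) = u 1) \<and>
    (x \<notin> \<Omega> \<longrightarrow> closed_segment x (u 0) \<subseteq> frontier \<Omega> \<and> closed_segment x (u N) \<subseteq> frontier \<Omega>)"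
  proof (cases "x \<in> \<Omega>")
    case True
    have SN: "S (j + N) = S j" for j unfolding S_def by simp
    have wN: "w (j + N) = w j" for j unfolding w_def SN using SN[of "Suc j"] by simp
    \<comment> \<open>The common edge preceding triangle \<open>j\<close>; the full turn
      \<open>N\<close> keeps the index from being truncated at \<open>j = 0\<close>.\<close>
    define u where "u j = w (j + N - 1)" for j
    have u: "u (Suc j) = w j" for j unfolding u_def using wN[of j] by simp
    have u': "u j \<in> S j" for j
    proof -
      have "w (j + N - 1) \<in> S (Suc (j + N - 1))" using wS(2) True by blast
      moreover have "Suc (j + N - 1) = j + N" using N1 by simp
      ultimately show ?thesis unfolding u_def by (simp add: SN)
    qed
    have u'': "u j \<noteq> u (Suc j)" for j
    proof -
      have "Suc (j + N - 1) = j + N" using N1 by simp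
      then show ?thesis using ww[of "j + N - 1"] True wN[of j] unfolding u by (simp add: u_def)
    qed
    have "u N = w (N - 1 + N)" unfolding u_def using N1 by simp
    then have "u N = u 0" unfolding wN by (simp add: u_def)
    moreover have "u (Suc N) = u 1" using wN[of 0] u by simp
    moreover have "u j \<noteq> x" for j using w(1) True unfolding u_def by blast
    moreover have "u (Suc j) \<in> S j" for j unfolding u using wS(1) True by blast
    ultimately show ?thesis using True u' u'' by (intro exI[of _ u]) blast
  next
    case False
    then obtain a b where a: "a \<in> Ts 0" "a \<noteq> x" "closed_segment x a \<subseteq> frontier \<Omega>"
      and b: "b \<in> Ts (N - 1)" "b \<noteq> x" "closed_segment x b \<subseteq> frontier \<Omega>"
      using le fr unfolding local_enum_def by blast
    show ?thesis
    proof (cases "N = 1")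
      case True
      \<comment> \<open>With a single triangle the two boundary edges supplied by
        \<open>local_enum\<close> may be the same one, so the other is built from the third
        vertex.\<close>
      obtain c where c: "Ts 0 = {x, a, c}" "det2 (a - x) (c - x) \<noteq> 0"
        using triangleE2[OF tri[OF ST(1)[of 0]] ST(2)[of 0], of a] a unfolding S_def by auto
      note d = det2_distinct[OF c(2)]
      have "T = S 0" if "T \<in> Th" "{x, c} \<subseteq> T" for T using only[of T] that True by auto
      then have "closed_segment x c \<subseteq> frontier \<Omega>"
        using boundary_edge[OF ST(1)[of 0], of x c] c d by (auto simp: S_def)
      then show ?thesis using False True a c d
        by (intro exI[of _ "\<lambda>j. if j = 0 then a else c"]) (simp add: S_def)
    next
      case N: False
      have N': "N \<ge> 2" using N N1 by simp
      define u where "u j = (if j = 0 then a else if j < N then w (j - 1) else b)" for j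
      have u: "u j \<in> S j \<and> u j \<noteq> x" if j: "j < N" for j
      proof (cases j)
        case 0 then show ?thesis using a by (simp add: u_def S_def)
      next
        case (Suc i) then show ?thesis using wS(2)[of i] w(1)[of i] j by (simp add: u_def)
      qed
      have u': "u (Suc j) \<in> S j \<and> u (Suc j) \<noteq> x" if j: "j < N" for j
      proof (cases "Suc j < N")
        case True then show ?thesis using wS(1)[of j] w(1)[of j] by (simp add: u_def)
      next
        case False then have "j = N - 1" using j by simp
        then show ?thesis using b False j by (simp add: u_def S_def)
      qed
      have u'': "u j \<noteq> u (Suc j)" if j: "j < N" for j
      proof -
        consider "j = 0" | "j > 0" "Suc j < N" | "j > 0" "Suc j = N" using j by linarith
        then show ?thesis
        proof cases
          case 1 then show ?thesis using N' a(3) nf[of 0] by (auto simp: u_def)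
        next
          case 2 then show ?thesis using ww[of "j - 1"] by (simp add: u_def)
        next
          case 3 then show ?thesis using nf[of "j - 1"] b(3) by (auto simp: u_def)
        qed
      qed
      have "u 0 = a" "u N = b" using N1 by (simp_all add: u_def)
      then show ?thesis using False u u' u'' a(3) b(3) by (intro exI[of _ u]) simp
    qed
  qed
  then obtain u where u: "\<And>j. x \<in> \<Omega> \<or> j < N \<Longrightarrow> u j \<in> S j \<and> u (Suc j) \<in> S j \<and> u j \<noteq> x \<and> u (Suc j) \<noteq> x \<and> u j \<noteq> u (Suc j)"
    "x \<in> \<Omega> \<Longrightarrow> u N = u 0 \<and> u (Suc N) = u 1"
    "x \<notin> \<Omega> \<Longrightarrow> closed_segment x (u 0) \<subseteq> frontier \<Omega> \<and> closed_segment x (u N) \<subseteq> frontier \<Omega>" by blast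
  have Su: "S j = {x, u j, u (Suc j)}" "det2 (u j - x) (u (Suc j) - x) \<noteq> 0" if "x \<in> \<Omega> \<or> j < N" for j
    using triangle_three[OF tri[OF ST(1)[of j]] ST(2), of "u j" "u (Suc j)"] u(1)[OF that] by auto
  show ?thesis
  proof (rule that[of u])
    fix j assume j: "x \<in> \<Omega> \<or> Suc j < N"
    then have v: "x \<in> \<Omega> \<or> j < N" by auto
    show "det2 (u j - x) (u (Suc j) - x) * det2 (u (Suc j) - x) (u (Suc (Suc j)) - x) > 0"
      using opposite_dets[of x "u j" "u (Suc j)" "u (Suc (Suc j))"] ST(1)[of j] ST(1)[of "Suc j"] adj[OF j]
        Su[OF v] Su[OF j] by simp
    show "Ts (j mod N) \<noteq> Ts (Suc j mod N)" using adj[OF j] unfolding S_def .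
  next
    fix j assume "x \<in> \<Omega> \<or> j < N"
    then show "Ts (j mod N) \<in> star Th x" "Ts (j mod N) = {x, u j, u (Suc j)}" "det2 (u j - x) (u (Suc j) - x) \<noteq> 0"
      using star[of j] Su[of j] unfolding S_def by blast+
  qed (use N1 u(2,3) in blast)+
qed

end

text \<open>The choice \<open>enum\<close> satisfies \<open>local_enum\<close> only where an
  enumeration exists, and the constraint at singular vertices is phrased through that
  choice.\<close>

locale enumerated_mesh = mesh +
  assumes enums: "\<forall>x\<in>vertices Th. \<exists>N Ts. local_enum Th \<Omega> x N Ts"
begin

lemma local_enum_enum:
  assumes "x \<in> vertices Th" "enum Th \<Omega> x = (N, Ts)" shows "local_enum Th \<Omega> x N Ts"
proof -
  have "\<exists>P. case P of (N, Ts) \<Rightarrow> local_enum Th \<Omega> x N Ts" using enums assms(1) by auto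
  from someI_ex[OF this] show ?thesis using assms(2) unfolding enum_def by simp
qed

section \<open>The alternating sum at a singular vertex\<close>

lemma singular_sin_zero:
  assumes "x \<in> singular_vertices Th \<Omega>" "enum Th \<Omega> x = (N, Ts)" "x \<in> \<Omega> \<or> Suc j < N" "N \<ge> 1"
  shows "sin (tri_angle (Ts (j mod N)) x + tri_angle (Ts (Suc j mod N)) x) = 0"
proof (cases "x \<in> \<Omega>")
  case True
  let ?A = "{\<bar>sin (tri_angle (Ts j) x + tri_angle (Ts (Suc j mod N)) x)\<bar> | j. j < N}"
  have "Max (insert 0 ?A) = 0"
    using assms(1,2) True by (simp add: singular_vertices_def Theta_def Let_def)
  moreover have "finite ?A" by simp
  moreover have "\<bar>sin (tri_angle (Ts (j mod N)) x + tri_angle (Ts (Suc (j mod N) mod N)) x)\<bar> \<in> ?A"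
    using assms(4) by (intro CollectI exI[of _ "j mod N"]) simp
  ultimately have "\<bar>sin (tri_angle (Ts (j mod N)) x + tri_angle (Ts (Suc (j mod N) mod N)) x)\<bar> \<le> 0"
    by (metis (lifting) Max_ge finite_insert insertI2)
  then show ?thesis by (simp add: mod_Suc_eq)
next
  case False
  let ?A = "{\<bar>sin (tri_angle (Ts j) x + tri_angle (Ts (Suc j)) x)\<bar> | j. Suc j < N}"
  have "Max (insert 0 ?A) = 0"
    using assms(1,2) False by (simp add: singular_vertices_def Theta_def Let_def)
  moreover have "finite ?A" using finite_subset[of "{j. Suc j < N}" "{..<N}"] by (auto simp: subset_iff)
  moreover have "\<bar>sin (tri_angle (Ts j) x + tri_angle (Ts (Suc j)) x)\<bar> \<in> ?A"
    using assms(3) False by blast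
  ultimately have "\<bar>sin (tri_angle (Ts j) x + tri_angle (Ts (Suc j)) x)\<bar> \<le> 0"
    by (metis (lifting) Max_ge finite_insert insertI2)
  then show ?thesis using assms(3) False by simp
qed

text \<open>At a singular vertex the edge directions satisfy \<open>d (j + 2) = - k *\<^sub>R d j\<close>, so the two contributions
  of a common edge to the divergences on its two sides coincide and the alternating sum telescopes.\<close>
lemma alternating_sum_zero:
  assumes v: "v \<in> Vh3 Th \<Omega>" and x: "x \<in> singular_vertices Th \<Omega>" and en: "enum Th \<Omega> x = (N, Ts)"
  shows "(\<Sum>j<N. (-1) ^ j * div_piece v (Ts j) x) = 0"
proof -
  have xv: "x \<in> vertices Th" using x unfolding singular_vertices_def by blast
  obtain u where N1: "N \<ge> 1"
    and st: "\<And>j. x \<in> \<Omega> \<or> j < N \<Longrightarrow> Ts (j mod N) \<in> star Th x"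
    and S: "\<And>j. x \<in> \<Omega> \<or> j < N \<Longrightarrow> Ts (j mod N) = {x, u j, u (Suc j)}"
    and det: "\<And>j. x \<in> \<Omega> \<or> j < N \<Longrightarrow> det2 (u j - x) (u (Suc j) - x) \<noteq> 0"
    and opp: "\<And>j. x \<in> \<Omega> \<or> Suc j < N \<Longrightarrow> det2 (u j - x) (u (Suc j) - x) * det2 (u (Suc j) - x) (u (Suc (Suc j)) - x) > 0"
    and per: "x \<in> \<Omega> \<Longrightarrow> u N = u 0 \<and> u (Suc N) = u 1"
    and bd: "x \<notin> \<Omega> \<Longrightarrow> closed_segment x (u 0) \<subseteq> frontier \<Omega> \<and> closed_segment x (u N) \<subseteq> frontier \<Omega>"
    by (rule enum_fan[OF local_enum_enum[OF xv en] xv]) (rule that)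
  have ST: "Ts (j mod N) \<in> Th" if "x \<in> \<Omega> \<or> j < N" for j using st[OF that] unfolding star_def by blast
  define d where "d j = u j - x" for j
  define g where "g j = cubic_piece v (Ts (j mod N))" for j
  have gp: "poly2vec 3 (g j)" if "x \<in> \<Omega> \<or> j < N" for j unfolding g_def by (rule cubic_piece(1)[OF v ST[OF that]])
  have gv: "v p = g j p" if "x \<in> \<Omega> \<or> j < N" "p \<in> convex hull {x, u j, u (Suc j)}" for j p
    using cubic_piece(2)[OF v ST[OF that(1)]] that S[OF that(1)] unfolding g_def by simp
  define D where "D j = (SOME D. (g j has_derivative D) (at x))" for j
  have D: "(g j has_derivative D j) (at x)" if "x \<in> \<Omega> \<or> j < N" for j
  proof -
    have "\<exists>D. (g j has_derivative D) (at x)" using poly2vec3_differentiable[OF gp[OF that]] by blast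
    from someI_ex[OF this] show ?thesis unfolding D_def .
  qed
  \<comment> \<open>The divergence on triangle \<open>j\<close> is \<open>a j + b j\<close>:
    \<open>a j\<close> comes from the derivative along its first edge, \<open>b j\<close> from the
    one along its second.\<close>
  define a where "a j = det2 (D j (d j)) (d (Suc j)) / det2 (d j) (d (Suc j))" for j
  define b where "b j = det2 (d j) (D j (d (Suc j))) / det2 (d j) (d (Suc j))" for j
  have dv: "div_piece v (Ts j) x = a j + b j" if "j < N" for j
  proof -
    have j: "x \<in> \<Omega> \<or> j < N" using that by simp
    have "div_piece v (Ts j) x = divergence (g j) x" unfolding div_piece_def g_def using that by simp
    also have "\<dots> = fst (D j (1, 0)) + snd (D j (0, 1))" by (rule divergence_eqI[OF D[OF j]])
    also have "\<dots> = a j + b j"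
      using trace_det2[OF has_derivative_bounded_linear[OF D[OF j]], of "d j" "d (Suc j)"] det[OF j]
      unfolding a_def b_def d_def by (simp add: add_divide_distrib[symmetric])
    finally show ?thesis .
  qed
  have seg: "closed_segment x (u j) \<subseteq> convex hull {x, u j, u (Suc j)}" "closed_segment x (u (Suc j)) \<subseteq> convex hull {x, u j, u (Suc j)}" for j
    unfolding segment_convex_hull by (intro hull_mono; blast)+
  have col: "\<exists>k>0. d (Suc (Suc j)) = - k *\<^sub>R d j" if j: "x \<in> \<Omega> \<or> Suc j < N" for j
  proof -
    have j': "x \<in> \<Omega> \<or> j < N" using j by auto
    have "sin (tri_angle {x, u j, u (Suc j)} x + tri_angle {x, u (Suc j), u (Suc (Suc j))} x) = 0"
      using singular_sin_zero[OF x en j N1] S[OF j'] S[OF j] by simp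
    from sin_angle_sum_zero[OF opp[OF j] this]
    have "det2 (u j - x) (u (Suc (Suc j)) - x) = 0" .
    from collinear_opposite[OF this opp[OF j]] show ?thesis unfolding d_def by metis
  qed
  have ba: "b j = a (Suc j)" if j: "x \<in> \<Omega> \<or> Suc j < N" for j
  proof -
    have j': "x \<in> \<Omega> \<or> j < N" using j by auto
    obtain k where k: "k > 0" "d (Suc (Suc j)) = - k *\<^sub>R d j" using col[OF j] by blast
    have "g j p = g (Suc j) p" if p: "p \<in> closed_segment x (u (Suc j))" for p
    proof -
      have "v p = g j p" by (rule gv[OF j']) (use p seg(2) in blast)
      moreover have "v p = g (Suc j) p" by (rule gv[OF j]) (use p seg(1) in blast)
      ultimately show ?thesis by simp
    qed
    then have e: "D j (d (Suc j)) = D (Suc j) (d (Suc j))" unfolding d_def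
      by (rule directional_derivative_unique[OF D[OF j'] D[OF j]])
    \<comment> \<open>Replacing the direction of edge \<open>j + 2\<close> multiplies numerator and
      denominator of \<open>a (Suc j)\<close> by the same \<open>k\<close>, leaving
      \<open>b j\<close>.\<close>
    have s: "det2 p (- k *\<^sub>R q) = k * det2 q p" for p q by (simp add: det2_def algebra_simps)
    show ?thesis unfolding a_def b_def e k(2) s using k(1) by simp
  qed
  have tele: "(\<Sum>j<Suc M. (-1) ^ j * (a j + b j)) = a 0 + (-1) ^ M * b M" if "M < N" for M
    using that
  proof (induction M)
    case (Suc M)
    then have "b M = a (Suc M)" using ba by auto
    then show ?case using Suc by (simp add: algebra_simps)
  qed simp
  have "(\<Sum>j<N. (-1) ^ j * div_piece v (Ts j) x) = (\<Sum>j<Suc (N - 1). (-1) ^ j * (a j + b j))"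
    using N1 dv by (intro sum.cong) auto
  also have "\<dots> = a 0 + (-1) ^ (N - 1) * b (N - 1)" by (rule tele) (use N1 in simp)
  also have "\<dots> = 0"
  proof (cases "x \<in> \<Omega>")
    case True
    \<comment> \<open>Even-numbered directions are all parallel to \<open>d 0\<close>. If
      \<open>N\<close> were odd, \<open>d (Suc N) = d 1\<close> would be one of them, so
      \<open>N\<close> is even and the two ends of the telescoped sum cancel around the closed
      fan.\<close>
    have "\<exists>k. d (2 * m) = k *\<^sub>R d 0" for m
    proof (induction m)
      case 0 show ?case by (intro exI[of _ 1]) simp
    next
      case (Suc m)
      then obtain k where k: "d (2 * m) = k *\<^sub>R d 0" by blast
      obtain k' where "d (Suc (Suc (2 * m))) = - k' *\<^sub>R d (2 * m)" using col[of "2 * m"] True by blast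
      then show ?case using k by (intro exI[of _ "- k' * k"]) simp
    qed
    then have ev: "\<exists>k. d n = k *\<^sub>R d 0" if "even n" for n using that by (auto elim!: evenE)
    have "even N"
    proof (rule ccontr)
      assume "odd N"
      then obtain k where "d (Suc N) = k *\<^sub>R d 0" using ev[of "Suc N"] by auto
      then have "d (Suc 0) = k *\<^sub>R d 0" using per[OF True] unfolding d_def by simp
      then have "det2 (d 0) (d (Suc 0)) = 0" by (simp add: det2_def)
      then show False using det[of 0] True unfolding d_def by simp
    qed
    then have "(-1) ^ (N - 1) = (-1 :: real)" using N1 by (cases N) auto
    moreover have "b (N - 1) = a N" using ba[of "N - 1"] True N1 by simp
    moreover have "g N = g 0" unfolding g_def by simp
    then have "a N = a 0" unfolding a_def D_def d_def using per[OF True] by simp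
    ultimately show ?thesis by simp
  next
    case False
    \<comment> \<open>At a boundary vertex each end vanishes separately: the field is zero along the
      first and last edges, hence so are its derivatives along them.\<close>
    have z: "D j (y - x) = 0" if j: "j < N" and y: "closed_segment x y \<subseteq> frontier \<Omega>" "closed_segment x y \<subseteq> convex hull {x, u j, u (Suc j)}" for j y
    proof -
      have j': "x \<in> \<Omega> \<or> j < N" using j by simp
      have "g j p = (\<lambda>p. 0) p" if "p \<in> closed_segment x y" for p
      proof -
        have "v p = g j p" by (rule gv[OF j']) (use y that in blast)
        moreover have "v p = 0" by (rule Vh3_frontier[OF v]) (use y that in blast)
        ultimately show ?thesis by simp
      qed
      then show ?thesis by (rule directional_derivative_unique[OF D[OF j'] has_derivative_const])
    qed
    have "D 0 (d 0) = 0" unfolding d_def using z[of 0 "u 0"] bd[OF False] seg(1)[of 0] N1 by simp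
    moreover have "D (N - 1) (d (Suc (N - 1))) = 0"
      unfolding d_def using z[of "N - 1" "u N"] bd[OF False] seg(2)[of "N - 1"] N1 by simp
    ultimately show ?thesis unfolding a_def b_def by (simp add: det2_def)
  qed
  finally show ?thesis .
qed

end

section \<open>Triangle bubbles and triangle means\<close>

lemma poly2_diff: "poly2 k f \<Longrightarrow> poly2 k g \<Longrightarrow> poly2 k (\<lambda>p. f p - g p)"
  using poly2_add[OF _ poly2_cmult[of k g "-1"], of f] by simp

text \<open>All six Bernstein coefficients are combinations of vertex and midpoint values.\<close>

lemma poly2_2_unisolvent:
  assumes t: "is_triangle T" and q: "poly2 2 q"
    and v: "\<And>a. a \<in> T \<Longrightarrow> q a = 0" and m: "\<And>a. a \<in> T \<Longrightarrow> q (mid (T - {a})) = 0"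
  shows "q p = 0"
proof -
  obtain a b c where T: "T = {a, b, c}" "det2 (b - a) (c - a) \<noteq> 0" using t unfolding is_triangle_def by blast
  note d = det2_distinct[OF T(2)]
  have e: "T - {a} = {b, c}" "T - {b} = {a, c}" "T - {c} = {a, b}" using T(1) d by auto
  have s: "lam T a p + lam T b p + lam T c p = 1" "lam T a p *\<^sub>R a + lam T b p *\<^sub>R b + lam T c p *\<^sub>R c = p"
    using lam_sum_eq[OF t, of p] d unfolding T(1) by (simp_all add: add.assoc)
  have "q a = 0" "q b = 0" "q c = 0" using v T(1) by auto
  moreover have "q ((1/2) *\<^sub>R (b + c)) = 0" "q ((1/2) *\<^sub>R (a + c)) = 0" "q ((1/2) *\<^sub>R (a + b)) = 0"
    using m[of a] m[of b] m[of c] d unfolding e mid_def by (simp_all add: T(1))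
  ultimately show ?thesis using poly2_2_bernstein[OF q s(1), of a b c] unfolding s(2) by simp
qed

lemma grad_difference:
  assumes "is_triangle T" "a \<in> T" "x \<in> T" "y \<in> T"
  shows "grad T a \<bullet> (x - y) = (if a = x then 1 else 0) - (if a = y then 1 else 0)"
  using lam_diff[OF assms(1,2), of x y] lam_vertex[OF assms(1,2)] assms by simp

context mesh
begin

text \<open>The divergence of the triangle bubble times a constant vector \<open>c\<close> vanishes
  at the vertices, and at the midpoint opposite a vertex it is a quarter of the gradient there
  applied to \<open>c\<close>. The three gradients sum to zero; by the midpoint rule zero mean
  imposes the same single relation on the midpoint values of \<open>q\<close>.\<close>

lemma bubble_field:
  assumes T0: "T0 \<in> Th" and q: "poly2 2 q" "\<And>a. a \<in> T0 \<Longrightarrow> q a = 0" "integral (convex hull T0) q = 0"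
  obtains v where "v \<in> Vh3 Th \<Omega>" "\<And>T p. T \<in> Th \<Longrightarrow> div_piece v T p = (if T = T0 then q p else 0)"
proof -
  note t = tri[OF T0]
  obtain x y z where T: "T0 = {x, y, z}" "det2 (y - x) (z - x) \<noteq> 0" using t unfolding is_triangle_def by blast
  note d = det2_distinct[OF T(2)]
  have mem: "x \<in> T0" "y \<in> T0" "z \<in> T0" using T(1) by auto
  have e: "T0 - {x} = {y, z}" "T0 - {y} = {x, z}" "T0 - {z} = {x, y}" using T(1) d by auto
  define A B where "A = 4 * q (mid {y, z})" and "B = 4 * q (mid {x, z})"
  have "(\<Sum>a\<in>T0. q (mid (T0 - {a}))) = 0"
    using quadrature[OF t q(1)] q(3) area_pos[OF t] by simp
  moreover have "(\<Sum>a\<in>T0. q (mid (T0 - {a}))) = q (mid (T0 - {x})) + q (mid (T0 - {y})) + q (mid (T0 - {z}))"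
    using d by (subst T(1)) (simp add: add.assoc)
  ultimately have C: "4 * q (mid {x, y}) = - A - B" unfolding A_def B_def e by simp
  \<comment> \<open>The edge vectors from \<open>z\<close> are dual to the gradients at
    \<open>x\<close> and \<open>y\<close>, so this vector has the prescribed products
    \<open>A\<close> and \<open>B\<close>.\<close>
  define c where "c = A *\<^sub>R (x - z) + B *\<^sub>R (y - z)"
  have gc: "grad T0 x \<bullet> c = A" "grad T0 y \<bullet> c = B" "grad T0 z \<bullet> c = - A - B"
    using d mem grad_difference[OF t] unfolding c_def by (simp_all add: inner_add_right)
  define \<beta> where "\<beta> p = lam T0 x p * lam T0 y p * lam T0 z p" for p
  have "poly2 1 (lam T0 x)" "poly2 1 (lam T0 y)" "poly2 1 (lam T0 z)" using t mem by (auto intro: lam_poly2)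
  then have \<beta>p: "poly2 3 \<beta>" unfolding \<beta>_def[abs_def]
    by (intro poly2_mult[of 2 _ 1] poly2_mult[of 1 _ 1]) auto
  have \<beta>0: "\<beta> p = 0" if "a \<in> T0" "lam T0 a p = 0" for a p using that T(1) unfolding \<beta>_def by auto
  define g where "g T = (if T = T0 then (\<lambda>p. \<beta> p *\<^sub>R c) else (\<lambda>p. 0))" for T
  have poly: "poly2vec 3 (g T)" for T
    unfolding g_def using poly2vec_scaleR_field[OF \<beta>p] poly2vec_zero by simp
  have z: "\<beta> p = 0" if h: "S \<in> Th" "S \<noteq> T0" "p \<in> convex hull T0" "p \<in> convex hull S" for S p
  proof -
    have "\<not> T0 \<subseteq> S" using h(2) card_subset_eq[OF triangle_finite[OF tri[OF h(1)]], of T0]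
        triangle_card[OF t] triangle_card[OF tri[OF h(1)]] by auto
    then obtain a where "a \<in> T0" "a \<notin> S" by blast
    then show ?thesis using \<beta>0[of a p] lam_on_shared[OF T0 h(1,3,4), of a] by simp
  qed
  have comp: "g S p = g S' p" if "S \<in> Th" "S' \<in> Th" "p \<in> convex hull S" "p \<in> convex hull S'" for S S' p
    using that z[of S p] z[of S' p] unfolding g_def by (cases "S = T0"; cases "S' = T0") auto
  have bd: "g S p = 0" if S: "S \<in> Th" "p \<in> convex hull S" "p \<notin> \<Omega>" for S p
  proof (cases "S = T0")
    case True
    then obtain a where a: "a \<in> T0" "\<not> lam T0 a p > 0" using open_triangle_in_Omega[OF T0, of p] S by blast
    then have "lam T0 a p = 0" using in_hull_iff[OF t, of p] S True by force
    then show ?thesis using \<beta>0[OF a(1)] by (simp add: g_def)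
  next
    case False
    then show ?thesis unfolding g_def by (simp only: if_False)
  qed
  obtain v where v: "v \<in> Vh3 Th \<Omega>" "\<And>T. T \<in> Th \<Longrightarrow> div_piece v T = divergence (g T)"
    using Vh3_glue[of g, OF poly comp bd] by blast
  have der: "(\<beta> has_derivative (\<lambda>h. ((lam T0 y p * lam T0 z p) *\<^sub>R grad T0 x + (lam T0 x p * lam T0 z p) *\<^sub>R grad T0 y
     + (lam T0 x p * lam T0 y p) *\<^sub>R grad T0 z) \<bullet> h)) (at p)" for p
    unfolding \<beta>_def[abs_def]
    by (auto intro!: derivative_eq_intros lam_has_derivative t mem simp: inner_add_left algebra_simps)
  have dv: "div_piece v T0 p = lam T0 y p * lam T0 z p * A + lam T0 x p * lam T0 z p * B + lam T0 x p * lam T0 y p * (- A - B)" for p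
    unfolding v(2)[OF T0] g_def using divergence_scaleR_field[OF der, of c p] gc by (simp add: inner_add_left)
  have "div_piece v T0 p - q p = 0" for p
  proof (rule poly2_2_unisolvent[OF t])
    show "poly2 2 (\<lambda>p. div_piece v T0 p - q p)" by (intro poly2_diff div_piece_poly2 v T0 q)
    fix a assume a: "a \<in> T0"
    then consider "a = x" | "a = y" | "a = z" using T(1) by blast
    note cs = this
    show "div_piece v T0 a - q a = 0" using cs
      by cases (use q(2) mem d in \<open>simp_all add: dv lam_vertex[OF t]\<close>)
    have "div_piece v T0 (mid {y, z}) = A / 4" "div_piece v T0 (mid {x, z}) = B / 4" "div_piece v T0 (mid {x, y}) = (- A - B) / 4"
      unfolding dv using mem d by (simp_all add: lam_mid[OF t])
    then have m: "div_piece v T0 (mid {y, z}) = q (mid {y, z})" "div_piece v T0 (mid {x, z}) = q (mid {x, z})"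
      "div_piece v T0 (mid {x, y}) = q (mid {x, y})"
      using C by (simp_all add: A_def B_def)
    show "div_piece v T0 (mid (T0 - {a})) - q (mid (T0 - {a})) = 0"
      using cs by cases (simp_all add: e m)
  qed
  moreover have "div_piece v T p = 0" if "T \<in> Th" "T \<noteq> T0" for T p
    using v(2)[OF that(1)] that(2) by (simp add: g_def divergence_def)
  ultimately show ?thesis using v(1) that[of v] by simp
qed

section \<open>Prescribing the mean on each triangle\<close>

definition mean_transfer :: "pt set \<Rightarrow> pt set \<Rightarrow> bool" where
  "mean_transfer T T' \<longleftrightarrow> (\<exists>v\<in>Vh3 Th \<Omega>. \<forall>S\<in>Th. integral (convex hull S) (div_piece v S)
     = (if S = T then 1 else 0) - (if S = T' then 1 else 0))"

lemma mean_transfer_refl: "mean_transfer T T"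
  unfolding mean_transfer_def by (rule bexI[OF _ Vh3_zero(1)]) (simp add: Vh3_zero(3))

lemma mean_transfer_trans: "mean_transfer T T' \<Longrightarrow> mean_transfer T' T'' \<Longrightarrow> mean_transfer T T''"
proof -
  assume "mean_transfer T T'" "mean_transfer T' T''"
  then obtain v w where v: "v \<in> Vh3 Th \<Omega>" "\<And>S. S \<in> Th \<Longrightarrow> integral (convex hull S) (div_piece v S)
      = (if S = T then 1 else 0) - (if S = T' then 1 else 0)"
    and w: "w \<in> Vh3 Th \<Omega>" "\<And>S. S \<in> Th \<Longrightarrow> integral (convex hull S) (div_piece w S)
      = (if S = T' then 1 else 0) - (if S = T'' then 1 else 0)"
    unfolding mean_transfer_def by blast
  show ?thesis unfolding mean_transfer_def
    by (rule bexI[OF _ Vh3_add(1)[OF v(1) w(1)]]) (simp add: Vh3_add(3)[OF v(1) w(1)] v(2) w(2))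
qed

lemma mean_transfer_adjacent:
  assumes "T \<in> Th" "T' \<in> Th" "T \<noteq> T'" "T \<inter> T' = {z, y}" "z \<noteq> y"
  shows "mean_transfer T T'"
proof -
  have sub: "{z, y} \<subseteq> T" "{z, y} \<subseteq> T'" using assms(4) by blast+
  obtain d d' where d: "T = {z, y, d}" "T' = {z, y, d'}" "d \<noteq> d'"
    "det2 (y - z) (d - z) \<noteq> 0" "det2 (y - z) (d' - z) \<noteq> 0"
    using shared_edge_triangles[OF assms(1-3,5) sub] by metis
  \<comment> \<open>Normal to the common edge, which guarantees a nonzero flux through it.\<close>
  define c where "c = grad T d"
  define K where "K = - (area T / 3) * (grad T d \<bullet> c)"
  have K: "K \<noteq> 0" unfolding K_def c_def
    using grad_nonzero[OF tri[OF assms(1)], of d] area_pos[OF tri[OF assms(1)]] d(1) by simp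
  obtain v where v: "v \<in> Vh3 Th \<Omega>"
    "\<And>T d. T \<in> Th \<Longrightarrow> T = {z, y, d} \<Longrightarrow> integral (convex hull T) (div_piece v T) = - area T / 6 * (1 + 1) * (grad T d \<bullet> c)"
    "\<And>T. T \<in> Th \<Longrightarrow> \<not> {z, y} \<subseteq> T \<Longrightarrow> integral (convex hull T) (div_piece v T) = 0"
    by (rule edge_field[OF assms(1-3,5) sub, of 1 c 1]) (rule that)
  have "area T *\<^sub>R grad T d + area T' *\<^sub>R grad T' d' = 0"
    using area_grad_opposite[of z y d d'] assms d by simp
  then have "(area T *\<^sub>R grad T d + area T' *\<^sub>R grad T' d') \<bullet> c = 0" by simp
  then have "area T' * (grad T' d' \<bullet> c) = - area T * (grad T d \<bullet> c)" by (simp add: inner_add_left)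
  then have m: "integral (convex hull T) (div_piece v T) = K" "integral (convex hull T') (div_piece v T') = - K"
    using v(2)[OF assms(1) d(1)] v(2)[OF assms(2) d(2)] by (simp_all add: K_def)
  have "integral (convex hull S) (div_piece (\<lambda>p. (1 / K) *\<^sub>R v p) S) = (if S = T then 1 else 0) - (if S = T' then 1 else 0)"
    if S: "S \<in> Th" for S
  proof -
    consider "S = T" | "S = T'" | "S \<noteq> T" "S \<noteq> T'" "\<not> {z, y} \<subseteq> S"
      using at_most_two[OF assms(1,2) S assms(5) sub] assms(3) by blast
    then show ?thesis unfolding Vh3_scaleR(3)[OF v(1) S]
      by cases (use m K v(3)[OF S] assms(3) in auto)
  qed
  then show ?thesis unfolding mean_transfer_def using Vh3_scaleR(1)[OF v(1)] by blast
qed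

text \<open>A connected open subset of the plane stays connected after removal of the finitely many vertices, and
  outside the vertices two triangles only meet along a common edge.\<close>
lemma mean_transfer_all:
  assumes "T \<in> Th" "T' \<in> Th" shows "mean_transfer T T'"
proof (rule ccontr)
  assume n: "\<not> mean_transfer T T'"
  define C where "C = {S \<in> Th. mean_transfer T S}"
  define A where "A = (\<Union>S\<in>C. convex hull S)"
  define B where "B = (\<Union>S\<in>Th - C. convex hull S)"
  define W where "W = \<Omega> - vertices Th"
  have finV: "finite (vertices Th)" unfolding vertices_def using finite_Th tri triangle_finite by blast
  have "connected W" unfolding W_def
    by (rule connected_open_delete_finite[OF Omega_open Omega_connected _ finV]) simp
  have "finite C" unfolding C_def using finite_Th by simp
  then have "closed A" "closed B" unfolding A_def B_def C_def using finite_Th compact_hull compact_imp_closed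
    by (auto intro!: closed_UN)
  have cover: "W \<subseteq> A \<union> B"
    unfolding W_def A_def B_def using Omega_eq interior_subset[of "\<Union>T\<in>Th. convex hull T"] by blast
  have disj: "A \<inter> B \<inter> W = {}"
  proof (rule ccontr)
    assume "A \<inter> B \<inter> W \<noteq> {}"
    then obtain p S S' where p: "p \<in> W" "S \<in> C" "S' \<in> Th - C" "p \<in> convex hull S" "p \<in> convex hull S'"
      unfolding A_def B_def by blast
    have S: "S \<in> Th" "S' \<in> Th" "S \<noteq> S'" "mean_transfer T S" "\<not> mean_transfer T S'" using p C_def by auto
    have pin: "p \<in> convex hull (S \<inter> S')" using hull_inter[OF S(1-3)] p by blast
    have finS: "finite S" "card S = 3" "card S' = 3" "finite S'"
      using S tri triangle_finite triangle_card by auto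
    have "card (S \<inter> S') \<noteq> 3"
      using S(3) card_subset_eq[OF finS(1), of "S \<inter> S'"] card_subset_eq[OF finS(4), of "S \<inter> S'"] finS by auto
    moreover have "card (S \<inter> S') \<le> 3" using card_mono[OF finS(1), of "S \<inter> S'"] finS by simp
    moreover have "card (S \<inter> S') \<noteq> 0" using pin finS by auto
    moreover have "card (S \<inter> S') \<noteq> 1"
    proof
      assume "card (S \<inter> S') = 1"
      then obtain x where x: "S \<inter> S' = {x}" by (auto simp: card_1_singleton_iff)
      then have "p = x" using pin by simp
      moreover have "x \<in> S" using x by blast
      ultimately show False using p(1) S(1) unfolding W_def vertices_def by blast
    qed
    ultimately have "card (S \<inter> S') = 2" by linarith
    then obtain z y where "S \<inter> S' = {z, y}" "z \<noteq> y" by (auto simp: card_2_iff)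
    then show False using mean_transfer_adjacent[OF S(1-3)] mean_transfer_trans[OF S(4)] S(5) by blast
  qed
  have ne: "convex hull S \<inter> W \<noteq> {}" if S: "S \<in> Th" for S
  proof
    let ?U = "{p. \<forall>a\<in>S. lam S a p > 0}"
    note U = triangle_interior[OF tri[OF S]]
    assume "convex hull S \<inter> W = {}"
    moreover have "?U \<subseteq> \<Omega>" using open_triangle_in_Omega[OF S] by blast
    ultimately have "?U \<subseteq> vertices Th" using U(3) unfolding W_def by blast
    then have "finite ?U" using finV finite_subset by blast
    then show False using U(1,2) finite_imp_not_open by blast
  qed
  have "T \<in> C" "T' \<in> Th - C" unfolding C_def using assms mean_transfer_refl n by auto
  then have "A \<inter> W \<noteq> {}" "B \<inter> W \<noteq> {}" using ne[OF assms(1)] ne[OF assms(2)] unfolding A_def B_def by blast+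
  then show False using connected_closedD[OF \<open>connected W\<close> disj cover \<open>closed A\<close> \<open>closed B\<close>] by blast
qed

text \<open>Every triangle exchanges its mass with one fixed \<open>T0\<close>. What
  \<open>T0\<close> gives away altogether is the total of \<open>m\<close>, which is zero.\<close>

lemma prescribed_means:
  assumes "(\<Sum>T\<in>Th. m T) = 0"
  obtains v where "v \<in> Vh3 Th \<Omega>" "\<And>T. T \<in> Th \<Longrightarrow> integral (convex hull T) (div_piece v T) = m T"
proof -
  obtain T0 where T0: "T0 \<in> Th" using Th_nonempty by blast
  have "\<forall>T\<in>Th. \<exists>v\<in>Vh3 Th \<Omega>. \<forall>S\<in>Th. integral (convex hull S) (div_piece v S)
     = (if S = T then 1 else 0) - (if S = T0 then 1 else 0)"
    using mean_transfer_all[OF _ T0] unfolding mean_transfer_def by blast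
  then obtain v where v: "\<And>T. T \<in> Th \<Longrightarrow> v T \<in> Vh3 Th \<Omega>"
    "\<And>T S. T \<in> Th \<Longrightarrow> S \<in> Th \<Longrightarrow> integral (convex hull S) (div_piece (v T) S) = (if S = T then 1 else 0) - (if S = T0 then 1 else 0)"
    by metis
  have s: "(\<lambda>p. m T *\<^sub>R v T p) \<in> Vh3 Th \<Omega>" if "T \<in> Th" for T using Vh3_scaleR(1)[OF v(1)[OF that]] .
  note V = Vh3_sum[of Th "\<lambda>T p. m T *\<^sub>R v T p", OF finite_Th s]
  show ?thesis
  proof (rule that)
    show "(\<lambda>p. \<Sum>T\<in>Th. m T *\<^sub>R v T p) \<in> Vh3 Th \<Omega>" using V by blast
    fix S assume S: "S \<in> Th"
    have "integral (convex hull S) (div_piece (\<lambda>p. \<Sum>T\<in>Th. m T *\<^sub>R v T p) S)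
       = (\<Sum>T\<in>Th. m T * integral (convex hull S) (div_piece (v T) S))"
      using V S Vh3_scaleR(3)[OF v(1) S] by simp
    also have "\<dots> = (\<Sum>T\<in>Th. (if S = T then m T else 0) - m T * (if S = T0 then 1 else 0))"
      by (rule sum.cong) (use v(2)[OF _ S] in auto)
    also have "\<dots> = m S" using S finite_Th assms by (simp add: sum_subtractf flip: sum_distrib_right)
    finally show "integral (convex hull S) (div_piece (\<lambda>p. \<Sum>T\<in>Th. m T *\<^sub>R v T p) S) = m S" .
  qed
qed

end

section \<open>Divergence values at the vertices\<close>

text \<open>The identity \<open>(e \<bullet> s) * det2 e s' - (e \<bullet> s') * det2 e s = (e
  \<bullet> e) * det2 s s'\<close> is a sum of cotangents in disguise: on opposite sides of
  \<open>e\<close> the determinants have opposite signs, so the absolute values turn the difference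
  into a sum.\<close>

lemma Mcoef_collinear:
  assumes D: "det2 e s * det2 e s' < 0" and z: "det2 s s' = 0"
  shows "(e \<bullet> s) / \<bar>det2 e s\<bar> + (e \<bullet> s') / \<bar>det2 e s'\<bar> = 0"
proof -
  have "(e \<bullet> s) * det2 e s' - (e \<bullet> s') * det2 e s = (e \<bullet> e) * det2 s s'"
    by (simp add: det2_def inner_prod_def algebra_simps)
  then have i: "(e \<bullet> s) * det2 e s' = (e \<bullet> s') * det2 e s" using z by simp
  from D consider "det2 e s > 0" "det2 e s' < 0" | "det2 e s < 0" "det2 e s' > 0" by (auto simp: mult_less_0_iff)
  then show ?thesis using i by cases (simp_all add: field_simps)
qed

context mesh
begin

text \<open>Zero means and zero values at the other vertices are required so that corrections at
  different vertices can be added without disturbing each other or the means already fixed. Only the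
  values of \<open>a\<close> on triangles at \<open>z\<close> matter.\<close>

definition vertex_achievable :: "pt \<Rightarrow> (pt set \<Rightarrow> real) \<Rightarrow> bool" where
  "vertex_achievable z a \<longleftrightarrow> (\<exists>w\<in>Vh3 Th \<Omega>. \<forall>T\<in>Th. integral (convex hull T) (div_piece w T) = 0 \<and>
     (\<forall>\<sigma>\<in>T. div_piece w T \<sigma> = (if \<sigma> = z then a T else 0)))"

lemma vertex_achievable_add:
  assumes "vertex_achievable z a" "vertex_achievable z b"
  shows "vertex_achievable z (\<lambda>T. a T + b T)"
proof -
  obtain v where v: "v \<in> Vh3 Th \<Omega>" "\<forall>T\<in>Th. integral (convex hull T) (div_piece v T) = 0 \<and>
     (\<forall>\<sigma>\<in>T. div_piece v T \<sigma> = (if \<sigma> = z then a T else 0))" using assms(1) unfolding vertex_achievable_def by blast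
  obtain w where w: "w \<in> Vh3 Th \<Omega>" "\<forall>T\<in>Th. integral (convex hull T) (div_piece w T) = 0 \<and>
     (\<forall>\<sigma>\<in>T. div_piece w T \<sigma> = (if \<sigma> = z then b T else 0))" using assms(2) unfolding vertex_achievable_def by blast
  show ?thesis unfolding vertex_achievable_def
    by (rule bexI[OF _ Vh3_add(1)[OF v(1) w(1)]]) (simp add: Vh3_add(2,3)[OF v(1) w(1)] v(2) w(2))
qed

lemma vertex_achievable_cmult:
  assumes "vertex_achievable z a" shows "vertex_achievable z (\<lambda>T. r * a T)"
proof -
  obtain v where v: "v \<in> Vh3 Th \<Omega>" "\<forall>T\<in>Th. integral (convex hull T) (div_piece v T) = 0 \<and>
     (\<forall>\<sigma>\<in>T. div_piece v T \<sigma> = (if \<sigma> = z then a T else 0))" using assms(1) unfolding vertex_achievable_def by blast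
  show ?thesis unfolding vertex_achievable_def
    by (rule bexI[OF _ Vh3_scaleR(1)[OF v(1), of r]]) (simp add: Vh3_scaleR(2,3)[OF v(1)] v(2))
qed

lemma vertex_achievable_zero: "vertex_achievable z (\<lambda>T. 0)"
  unfolding vertex_achievable_def by (rule bexI[OF _ Vh3_zero(1)]) (simp add: Vh3_zero(2,3))

lemma vertex_achievable_sum:
  assumes "finite I" "\<And>i. i \<in> I \<Longrightarrow> vertex_achievable z (a i)"
  shows "vertex_achievable z (\<lambda>T. \<Sum>i\<in>I. a i T)"
  using assms
proof (induction I)
  case empty then show ?case by (simp add: vertex_achievable_zero)
next
  case (insert i I)
  then show ?case using vertex_achievable_add[of z "a i" "\<lambda>T. \<Sum>i\<in>I. a i T"] by simp
qed

lemma vertex_achievable_cong: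
  assumes "vertex_achievable z a" "\<And>T. T \<in> Th \<Longrightarrow> z \<in> T \<Longrightarrow> a T = b T"
  shows "vertex_achievable z b"
  using assms unfolding vertex_achievable_def by (metis (no_types, lifting))

text \<open>Witness: on each side of the edge, the field \<open>\<lambda>\<^sub>z\<^sup>2 \<lambda>\<^sub>y (y - z)\<close>; being tangential, it has no flux through the edge.\<close>
lemma edge_pair_achievable:
  assumes "T1 \<in> Th" "T2 \<in> Th" "T1 \<noteq> T2" "z \<noteq> y" "{z, y} \<subseteq> T1" "{z, y} \<subseteq> T2"
  shows "vertex_achievable z (\<lambda>T. if {z, y} \<subseteq> T then 1 else 0)"
proof -
  obtain v where v: "v \<in> Vh3 Th \<Omega>"
    "\<And>T. T \<in> Th \<Longrightarrow> {z, y} \<subseteq> T \<Longrightarrow> div_piece v T z = 1 * (grad T y \<bullet> (y - z))"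
    "\<And>T. T \<in> Th \<Longrightarrow> {z, y} \<subseteq> T \<Longrightarrow> div_piece v T y = 0 * (grad T z \<bullet> (y - z))"
    "\<And>T d. T \<in> Th \<Longrightarrow> d \<in> T \<Longrightarrow> d \<noteq> z \<Longrightarrow> d \<noteq> y \<Longrightarrow> div_piece v T d = 0"
    "\<And>T d. T \<in> Th \<Longrightarrow> T = {z, y, d} \<Longrightarrow> integral (convex hull T) (div_piece v T) = - area T / 6 * (1 + 0) * (grad T d \<bullet> (y - z))"
    "\<And>T p. T \<in> Th \<Longrightarrow> \<not> {z, y} \<subseteq> T \<Longrightarrow> div_piece v T p = 0"
    "\<And>T. T \<in> Th \<Longrightarrow> \<not> {z, y} \<subseteq> T \<Longrightarrow> integral (convex hull T) (div_piece v T) = 0"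
    by (rule edge_field[OF assms, of 1 "y - z" 0]) (rule that)
  show ?thesis unfolding vertex_achievable_def
  proof (intro bexI[OF _ v(1)] ballI conjI)
    fix T assume T: "T \<in> Th"
    show "integral (convex hull T) (div_piece v T) = 0"
    proof (cases "{z, y} \<subseteq> T")
      case True
      then obtain d where d: "T = {z, y, d}" "det2 (y - z) (d - z) \<noteq> 0"
        using triangleE2[OF tri[OF T], of z y] assms(4) by auto
      have "grad T d \<bullet> (y - z) = 0"
        using grad_difference[OF tri[OF T], of d y z] det2_distinct[OF d(2)] d(1) by auto
      then show ?thesis using v(5)[OF T d(1)] by simp
    qed (use v(7)[OF T] in simp)
    fix \<sigma> assume s: "\<sigma> \<in> T"
    show "div_piece v T \<sigma> = (if \<sigma> = z then if {z, y} \<subseteq> T then 1 else 0 else 0)"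
    proof (cases "{z, y} \<subseteq> T")
      case True
      have "grad T y \<bullet> (y - z) = 1"
        using grad_difference[OF tri[OF T], of y y z] True assms(4) by auto
      then show ?thesis using v(2)[OF T True] v(3)[OF T True] v(4)[OF T s] True by (cases "\<sigma> = y") auto
    next
      case False
      then have "(if {z, y} \<subseteq> T then 1 else 0) = (0::real)" by (simp only: if_False)
      then show ?thesis using v(6)[OF T False] by (simp only: if_cancel)
    qed
  qed
qed

end

section \<open>Propagation of achievable vertex values along a path\<close>

context enumerated_mesh
begin

definition admissible :: "pt \<Rightarrow> (pt set \<Rightarrow> real) \<Rightarrow> bool" where
  "admissible z a \<longleftrightarrow> (z \<in> singular_vertices Th \<Omega> \<longrightarrow>
     (case enum Th \<Omega> z of (N, Ts) \<Rightarrow> (\<Sum>j<N. (-1) ^ j * a (Ts j)) = 0))"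

lemma admissible_div_piece: "v \<in> Vh3 Th \<Omega> \<Longrightarrow> admissible z (\<lambda>T. div_piece v T z)"
  unfolding admissible_def using alternating_sum_zero by (auto split: prod.split)

text \<open>\<open>V00\<close> controls the means only on the star of \<open>z\<close>; on every
  other triangle the support condition forces the cubic piece, and with it the divergence, to
  vanish.\<close>

lemma local_interpolating_achievable:
  assumes z: "z \<in> vertices Th" and li: "local_interpolating Th \<Omega> z" and a: "admissible z a"
  shows "vertex_achievable z a"
proof -
  obtain N Ts where en: "enum Th \<Omega> z = (N, Ts)" by (cases "enum Th \<Omega> z")
  have bij: "bij_betw Ts {..<N} (star Th z)" using local_enum_enum[OF z en] unfolding local_enum_def by blast
  have "\<forall>b. (z \<in> singular_vertices Th \<Omega> \<longrightarrow> (\<Sum>j<N. (-1) ^ j * b j) = 0) \<longrightarrow>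
      (\<exists>v\<in>V00 Th \<Omega> z. \<forall>j<N. div_piece v (Ts j) z = b j)"
    using li unfolding local_interpolating_def en by simp
  from spec[OF this, of "\<lambda>j. a (Ts j)"]
  obtain v where v: "v \<in> V00 Th \<Omega> z" "\<forall>j<N. div_piece v (Ts j) z = a (Ts j)"
    using a unfolding admissible_def en by auto
  have vV: "v \<in> Vh3 Th \<Omega>" and supp: "\<And>p. p \<notin> patch Th z \<Longrightarrow> v p = 0"
    and mean: "\<And>T. T \<in> star Th z \<Longrightarrow> integral (convex hull T) (div_piece v T) = 0"
    and val: "\<And>T \<sigma>. T \<in> Th \<Longrightarrow> \<sigma> \<in> T \<Longrightarrow> \<sigma> \<noteq> z \<Longrightarrow> div_piece v T \<sigma> = 0"
    using v(1) unfolding V00_def by blast+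
  show ?thesis unfolding vertex_achievable_def
  proof (intro bexI[OF _ vV] ballI conjI)
    fix T assume T: "T \<in> Th"
    show "integral (convex hull T) (div_piece v T) = 0"
    proof (cases "z \<in> T")
      case True then show ?thesis using mean T by (simp add: star_def)
    next
      case False
      let ?U = "{p. \<forall>a\<in>T. lam T a p > 0}"
      note U = triangle_interior[OF tri[OF T]]
      have "cubic_piece v T p = (\<lambda>p. 0) p" if p: "p \<in> ?U" for p
      proof -
        have pT: "p \<in> convex hull T" using p U(3) by blast
        have "p \<notin> patch Th z"
        proof
          assume "p \<in> patch Th z"
          then obtain S where S: "S \<in> Th" "z \<in> S" "p \<in> convex hull S" unfolding patch_def star_def by blast
          \<comment> \<open>A point of \<open>T\<close> that also lies in another triangle has a
            vanishing coordinate in \<open>T\<close>, so the open triangle avoids the patch of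
            \<open>z\<close>.\<close>
          have "\<not> T \<subseteq> S" using S(2) False card_subset_eq[OF triangle_finite[OF tri[OF S(1)]], of T]
              triangle_card[OF tri[OF S(1)]] triangle_card[OF tri[OF T]] by auto
          then obtain b where b: "b \<in> T" "b \<notin> S" by blast
          then have "lam T b p = 0" using lam_on_shared[OF T S(1) pT S(3) b(1)] by simp
          then show False using p b(1) by auto
        qed
        then show ?thesis using supp cubic_piece(2)[OF vV T pT] by simp
      qed
      from poly2vec_unique[OF cubic_piece(1)[OF vV T] poly2vec_zero U(1,2) this]
      have "cubic_piece v T = (\<lambda>p. 0)" .
      then have "div_piece v T = (\<lambda>p. 0)" unfolding div_piece_def by (auto simp: divergence_def)
      then show ?thesis by simp
    qed
    fix \<sigma> assume s: "\<sigma> \<in> T"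
    show "div_piece v T \<sigma> = (if \<sigma> = z then a T else 0)"
    proof (cases "\<sigma> = z")
      case True
      then have "T \<in> Ts ` {..<N}" using bij T s unfolding star_def bij_betw_def by blast
      then show ?thesis using v(2) True by auto
    qed (use val[OF T s] in simp)
  qed
qed

text \<open>The field \<open>(\<lambda>\<^sub>z\<^sup>2 \<lambda>\<^sub>y - \<lambda>\<^sub>z \<lambda>\<^sub>y\<^sup>2) c\<close> has zero means; its divergence at \<^term>\<open>y\<close> is removed by the hypothesis on \<^term>\<open>y\<close>,
  applicable because the divergence of any discrete field is admissible.\<close>
lemma edge_transfer_achievable:
  assumes T: "T1 \<in> Th" "T2 \<in> Th" "T1 \<noteq> T2" "z \<noteq> y" "{z, y} \<subseteq> T1" "{z, y} \<subseteq> T2"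
    and y: "\<And>a. admissible y a \<Longrightarrow> vertex_achievable y a"
  shows "vertex_achievable z (\<lambda>T. if {z, y} \<subseteq> T then grad T y \<bullet> c else 0)"
proof -
  obtain v where v: "v \<in> Vh3 Th \<Omega>"
    "\<And>T. T \<in> Th \<Longrightarrow> {z, y} \<subseteq> T \<Longrightarrow> div_piece v T z = 1 * (grad T y \<bullet> c)"
    "\<And>T d. T \<in> Th \<Longrightarrow> d \<in> T \<Longrightarrow> d \<noteq> z \<Longrightarrow> d \<noteq> y \<Longrightarrow> div_piece v T d = 0"
    "\<And>T d. T \<in> Th \<Longrightarrow> T = {z, y, d} \<Longrightarrow> integral (convex hull T) (div_piece v T) = - area T / 6 * (1 + - 1) * (grad T d \<bullet> c)"
    "\<And>T p. T \<in> Th \<Longrightarrow> \<not> {z, y} \<subseteq> T \<Longrightarrow> div_piece v T p = 0"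
    "\<And>T. T \<in> Th \<Longrightarrow> \<not> {z, y} \<subseteq> T \<Longrightarrow> integral (convex hull T) (div_piece v T) = 0"
    by (rule edge_field[OF T, of 1 c "-1"]) (rule that)
  obtain w where w: "w \<in> Vh3 Th \<Omega>" "\<And>T. T \<in> Th \<Longrightarrow> integral (convex hull T) (div_piece w T) = 0"
    "\<And>T \<sigma>. T \<in> Th \<Longrightarrow> \<sigma> \<in> T \<Longrightarrow> div_piece w T \<sigma> = (if \<sigma> = y then div_piece v T y else 0)"
    using y[OF admissible_div_piece[OF v(1), of y]] unfolding vertex_achievable_def by blast
  note w' = Vh3_scaleR[OF w(1), where r = "-1"]
  note u = Vh3_add[OF v(1) w'(1)]
  show ?thesis unfolding vertex_achievable_def
  proof (intro bexI[OF _ u(1)] ballI conjI)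
    fix T assume T: "T \<in> Th"
    have "integral (convex hull T) (div_piece v T) = 0"
    proof (cases "{z, y} \<subseteq> T")
      case True
      then obtain d where d: "T = {z, y, d}" "det2 (y - z) (d - z) \<noteq> 0"
        using triangleE2[OF tri[OF T], of z y] assms(4) by auto
      then show ?thesis using v(4)[OF T d(1)] by simp
    qed (use v(6)[OF T] in simp)
    then show "integral (convex hull T) (div_piece (\<lambda>p. v p + - 1 *\<^sub>R w p) T) = 0"
      unfolding u(3)[OF T] w'(3)[OF T] w(2)[OF T] by simp
    fix \<sigma> assume s: "\<sigma> \<in> T"
    have e: "div_piece (\<lambda>p. v p + - 1 *\<^sub>R w p) T \<sigma> = (if \<sigma> = y then 0 else div_piece v T \<sigma>)"
      unfolding u(2)[OF T] w'(2)[OF T] w(3)[OF T s] by simp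
    show "div_piece (\<lambda>p. v p + - 1 *\<^sub>R w p) T \<sigma> = (if \<sigma> = z then if {z, y} \<subseteq> T then grad T y \<bullet> c else 0 else 0)"
    proof (cases "{z, y} \<subseteq> T")
      case True
      then show ?thesis unfolding e using v(2)[OF T True] v(3)[OF T s] assms(4) by auto
    next
      case False
      then have "(if {z, y} \<subseteq> T then grad T y \<bullet> c else 0) = 0" by (simp only: if_False)
      then show ?thesis unfolding e using v(5)[OF T False] by (simp only: if_cancel)
    qed
  qed
qed

text \<open>The direction \<open>d - z\<close> lies along the edge of \<open>T\<close> on which the
  coordinate of \<open>y\<close> vanishes, so only \<open>T'\<close> sees a divergence at
  \<open>z\<close>; nonzero \<open>Mcoef\<close> ensures that it does.\<close>

lemma single_triangle_achievable:
  assumes e: "{z, y} \<in> interior_edges Th \<Omega>" and M: "Mcoef Th z y \<noteq> 0"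
    and y: "\<And>a. admissible y a \<Longrightarrow> vertex_achievable y a"
  obtains T where "T \<in> star Th z" "vertex_achievable z (\<lambda>S. if S = T then 1 else 0)"
proof -
  obtain T T' where T: "z \<noteq> y" "T \<in> Th" "T' \<in> Th" "T \<noteq> T'" "{S \<in> Th. {z, y} \<subseteq> S} = {T, T'}"
    using interior_edge_two[OF e] by blast
  then have sub: "{z, y} \<subseteq> T" "{z, y} \<subseteq> T'" by blast+
  obtain d d' where d: "T = {z, y, d}" "T' = {z, y, d'}" "d \<noteq> d'"
    "det2 (y - z) (d - z) \<noteq> 0" "det2 (y - z) (d' - z) \<noteq> 0"
    using shared_edge_triangles[OF T(2-4,1) sub] by metis
  have "det2 (d - z) (y - z) * det2 (y - z) (d' - z) > 0"
    by (rule opposite_dets) (use T d triangle_perm(3)[OF d(4)] in \<open>auto simp: insert_commute\<close>)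
  then have opp: "det2 (y - z) (d - z) * det2 (y - z) (d' - z) < 0"
    using det2_anti[of "d - z" "y - z"] by simp
  have "Mcoef Th z y = cot (tri_angle T z) + cot (tri_angle T' z)"
    unfolding Mcoef_def T(5) using T(4) by simp
  also have "\<dots> = ((y - z) \<bullet> (d - z)) / \<bar>det2 (y - z) (d - z)\<bar> + ((y - z) \<bullet> (d' - z)) / \<bar>det2 (y - z) (d' - z)\<bar>"
    unfolding d(1,2) tri_angle_cot[OF d(4)] tri_angle_cot[OF d(5)] ..
  finally have det: "det2 (d - z) (d' - z) \<noteq> 0" using Mcoef_collinear[OF opp] M by metis
  \<comment> \<open>The value left on \<open>T'\<close>. It equals the coordinate of
    \<open>y\<close> in \<open>T'\<close> at \<open>d\<close>, a quotient whose numerator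
    \<open>det2 (d - z) (d' - z)\<close> is the determinant just shown nonzero.\<close>
  define \<kappa> where "\<kappa> = grad T' y \<bullet> (d - z)"
  have dp: "det2 (d' - y) (z - y) \<noteq> 0" using triangle_perm(1)[OF d(5)] .
  have "\<kappa> = lam T' y d - lam T' y z" unfolding \<kappa>_def using lam_diff[OF tri[OF T(3)], of y d z] sub by simp
  also have "\<dots> = lam T' y d" using lam_vertex[OF tri[OF T(3)], of y z] sub T(1) by simp
  also have "\<dots> = det2 (d' - d) (z - d) / det2 (d' - y) (z - y)"
    using lam_eq[OF dp, of d] unfolding d(2) by (simp add: insert_commute)
  also have "det2 (d' - d) (z - d) = det2 (d - z) (d' - z)" by (simp add: det2_def algebra_simps)
  finally have \<kappa>: "\<kappa> \<noteq> 0" using det dp by simp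
  have 0: "grad T y \<bullet> (d - z) = 0"
    using grad_difference[OF tri[OF T(2)], of y d z] d(1) T(1) det2_distinct[OF d(4)] by auto
  have "vertex_achievable z (\<lambda>S. (1 / \<kappa>) * (if {z, y} \<subseteq> S then grad S y \<bullet> (d - z) else 0))"
    by (intro vertex_achievable_cmult edge_transfer_achievable[OF T(2-4,1) sub y])
  then have "vertex_achievable z (\<lambda>S. if S = T' then 1 else 0)"
  proof (rule vertex_achievable_cong)
    fix S assume S: "S \<in> Th"
    then consider "S = T" | "S = T'" | "S \<noteq> T'" "\<not> {z, y} \<subseteq> S" using T(5) by blast
    then show "(1 / \<kappa>) * (if {z, y} \<subseteq> S then grad S y \<bullet> (d - z) else 0) = (if S = T' then 1 else 0)"
    proof cases
      case 1 then show ?thesis using 0 sub T(4) by simp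
    next
      case 2 then show ?thesis using \<kappa> sub by (simp add: \<kappa>_def)
    next
      case 3 then show ?thesis by (simp only: if_False mult_zero_right)
    qed
  qed
  moreover have "T' \<in> star Th z" unfolding star_def using T(3) sub by simp
  ultimately show ?thesis using that by blast
qed

text \<open>An edge pair gives the value 1 on two neighbouring triangles. Subtracting a known single
  value leaves the single value on the neighbour, so one triangle yields all of the star, in both
  directions along the fan.\<close>

lemma star_achievable:
  assumes z: "z \<in> vertices Th" and T: "T \<in> star Th z" "vertex_achievable z (\<lambda>S. if S = T then 1 else 0)"
  shows "vertex_achievable z a"
proof -
  obtain N Ts where le: "local_enum Th \<Omega> z N Ts" using enums z by blast
  have bij: "bij_betw Ts {..<N} (star Th z)" using le unfolding local_enum_def by blast
  obtain u where N1: "N \<ge> 1"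
    and st: "\<And>j. z \<in> \<Omega> \<or> j < N \<Longrightarrow> Ts (j mod N) \<in> star Th z"
    and S: "\<And>j. z \<in> \<Omega> \<or> j < N \<Longrightarrow> Ts (j mod N) = {z, u j, u (Suc j)}"
    and det: "\<And>j. z \<in> \<Omega> \<or> j < N \<Longrightarrow> det2 (u j - z) (u (Suc j) - z) \<noteq> 0"
    and ne: "\<And>j. z \<in> \<Omega> \<or> Suc j < N \<Longrightarrow> Ts (j mod N) \<noteq> Ts (Suc j mod N)"
    by (rule enum_fan[OF le z]) (rule that)
  define P where "P j = vertex_achievable z (\<lambda>S. if S = Ts j then 1 else 0)" for j
  have pair: "vertex_achievable z (\<lambda>S. (if S = Ts j then 1 else 0) + (if S = Ts (Suc j) then 1 else 0))" if j: "Suc j < N" for j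
  proof -
    have TT: "Ts j \<in> Th" "Ts (Suc j) \<in> Th" "Ts j \<noteq> Ts (Suc j)" "z \<noteq> u (Suc j)"
      "{z, u (Suc j)} \<subseteq> Ts j" "{z, u (Suc j)} \<subseteq> Ts (Suc j)"
      using st[of j] st[of "Suc j"] ne[of j] S[of j] S[of "Suc j"] j det2_distinct[OF det[of j]] by (auto simp: star_def)
    show ?thesis
    proof (rule vertex_achievable_cong[OF edge_pair_achievable[OF TT]])
      fix S assume "S \<in> Th"
      then consider "S = Ts j" | "S = Ts (Suc j)" | "S \<noteq> Ts j" "S \<noteq> Ts (Suc j)" "\<not> {z, u (Suc j)} \<subseteq> S"
        using at_most_two[OF TT(1,2) _ TT(4-6), of S] TT(3) by blast
      then show "(if {z, u (Suc j)} \<subseteq> S then 1 else 0) = (if S = Ts j then 1 else 0) + (if S = Ts (Suc j) then 1 else 0 :: real)"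
        by cases (use TT(3,5,6) in auto)
    qed
  qed
  have step: "P j \<longleftrightarrow> P (Suc j)" if j: "Suc j < N" for j
  proof
    assume "P j"
    from vertex_achievable_add[OF pair[OF j] vertex_achievable_cmult[OF this[unfolded P_def], of "-1"]]
    show "P (Suc j)" unfolding P_def by simp
  next
    assume "P (Suc j)"
    from vertex_achievable_add[OF pair[OF j] vertex_achievable_cmult[OF this[unfolded P_def], of "-1"]]
    show "P j" unfolding P_def by simp
  qed
  have "P j \<longleftrightarrow> P 0" if "j < N" for j using that
  proof (induction j)
    case (Suc j) then show ?case using step[of j] by simp
  qed simp
  moreover obtain j0 where "j0 < N" "T = Ts j0" using T(1) bij unfolding bij_betw_def by blast
  then have "P j0" "j0 < N" unfolding P_def using T(2) by auto
  ultimately have all: "P j" if "j < N" for j using that by blast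
  have single: "vertex_achievable z (\<lambda>S. if S = T' then 1 else 0)" if T': "T' \<in> star Th z" for T'
  proof -
    obtain j where "j < N" "T' = Ts j" using T' bij unfolding bij_betw_def by blast
    then show ?thesis using all[of j] unfolding P_def by simp
  qed
  have fin: "finite (star Th z)" unfolding star_def using finite_Th by simp
  have "vertex_achievable z (\<lambda>S. \<Sum>T'\<in>star Th z. a T' * (if S = T' then 1 else 0))"
    by (intro vertex_achievable_sum fin vertex_achievable_cmult single)
  then show ?thesis
  proof (rule vertex_achievable_cong)
    fix S assume "S \<in> Th" "z \<in> S"
    then have "S \<in> star Th z" by (simp add: star_def)
    then show "(\<Sum>T'\<in>star Th z. a T' * (if S = T' then 1 else 0)) = a S"
      using fin by (simp add: if_distrib[of "(*) _"] cong: if_cong)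
  qed
qed

text \<open>Induction runs backwards from \<open>r\<close>. The claim at a path vertex must cover
  all admissible data, since the data to be removed at the next vertex are not known
  beforehand.\<close>

lemma path_achievable:
  assumes "acceptable_path Th \<Omega> ys z r" "local_interpolating Th \<Omega> r" "admissible z a"
  shows "vertex_achievable z a"
proof -
  have ys: "ys \<noteq> []" "hd ys = z" "last ys = r" "set ys \<subseteq> vertices Th"
    and e: "\<And>i. Suc i < length ys \<Longrightarrow> {ys ! i, ys ! Suc i} \<in> interior_edges Th \<Omega> \<and> Mcoef Th (ys ! i) (ys ! Suc i) \<noteq> 0"
    using assms(1) unfolding acceptable_path_def by blast+
  have "\<forall>a. admissible (ys ! i) a \<longrightarrow> vertex_achievable (ys ! i) a" if "i \<le> length ys - 1" for i
    using that
  proof (induction i rule: inc_induct)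
    case base
    have "ys ! (length ys - 1) = r" using ys(1,3) by (simp add: last_conv_nth)
    moreover have "r \<in> vertices Th" using ys last_in_set by blast
    ultimately show ?case using local_interpolating_achievable[OF _ assms(2)] by simp
  next
    case (step i)
    then have i: "Suc i < length ys" by simp
    have v: "ys ! i \<in> vertices Th" using ys(4) i by (meson nth_mem subsetD Suc_lessD)
    obtain T where T: "T \<in> star Th (ys ! i)" "vertex_achievable (ys ! i) (\<lambda>S. if S = T then 1 else 0)"
      using single_triangle_achievable[of "ys ! i" "ys ! Suc i"] e[OF i] step.IH by metis
    show ?case using star_achievable[OF v T] by blast
  qed
  from this[of 0] show ?thesis using ys(1,2) assms(3) by (simp add: hd_conv_nth)
qed

lemma divergence_surjective:
  assumes ach: "\<And>z a. z \<in> vertices Th \<Longrightarrow> admissible z a \<Longrightarrow> vertex_achievable z a"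
    and q: "q \<in> Qh2 Th \<Omega>"
  obtains v where "v \<in> Vh3 Th \<Omega>" "\<And>T p. T \<in> Th \<Longrightarrow> div_piece v T p = q T p"
proof -
  have qp: "\<And>T. T \<in> Th \<Longrightarrow> poly2 2 (q T)" and q0: "(\<Sum>T\<in>Th. integral (convex hull T) (q T)) = 0"
    and qs': "\<forall>x\<in>singular_vertices Th \<Omega>. case enum Th \<Omega> x of (N, Ts) \<Rightarrow> (\<Sum>j<N. (-1) ^ j * q (Ts j) x) = 0"
    using q unfolding Qh2_def by simp_all
  note qs = bspec[OF qs']
  obtain v1 where v1: "v1 \<in> Vh3 Th \<Omega>" "\<And>T. T \<in> Th \<Longrightarrow> integral (convex hull T) (div_piece v1 T) = integral (convex hull T) (q T)"
    using prescribed_means[OF q0] by blast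
  have finV: "finite (vertices Th)" unfolding vertices_def using finite_Th tri triangle_finite by blast
  \<comment> \<open>\<open>q\<close> meets the alternating condition by definition and the
    divergence of \<open>v1\<close> by \<open>alternating_sum_zero\<close>, so their difference does
    too.\<close>
  have "admissible z (\<lambda>T. q T z - div_piece v1 T z)" for z
  proof (cases "enum Th \<Omega> z")
    case (Pair N Ts)
    have "(\<Sum>j<N. (-1) ^ j * (q (Ts j) z - div_piece v1 (Ts j) z)) = 0" if "z \<in> singular_vertices Th \<Omega>"
      using qs[OF that] alternating_sum_zero[OF v1(1) that Pair] Pair by (simp add: right_diff_distrib sum_subtractf)
    then show ?thesis unfolding admissible_def Pair by simp
  qed
  then have "\<forall>z\<in>vertices Th. \<exists>w\<in>Vh3 Th \<Omega>. \<forall>T\<in>Th. integral (convex hull T) (div_piece w T) = 0 \<and>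
     (\<forall>\<sigma>\<in>T. div_piece w T \<sigma> = (if \<sigma> = z then q T z - div_piece v1 T z else 0))"
    using ach unfolding vertex_achievable_def by blast
  then obtain w where w: "\<And>z. z \<in> vertices Th \<Longrightarrow> w z \<in> Vh3 Th \<Omega>"
    "\<And>z T. z \<in> vertices Th \<Longrightarrow> T \<in> Th \<Longrightarrow> integral (convex hull T) (div_piece (w z) T) = 0"
    "\<And>z T \<sigma>. z \<in> vertices Th \<Longrightarrow> T \<in> Th \<Longrightarrow> \<sigma> \<in> T \<Longrightarrow> div_piece (w z) T \<sigma> = (if \<sigma> = z then q T z - div_piece v1 T z else 0)"
    by metis
  define v2 where "v2 p = (\<Sum>z\<in>vertices Th. w z p)" for p
  have V2: "v2 \<in> Vh3 Th \<Omega>" "\<And>T p. T \<in> Th \<Longrightarrow> div_piece v2 T p = (\<Sum>z\<in>vertices Th. div_piece (w z) T p)"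
    "\<And>T. T \<in> Th \<Longrightarrow> integral (convex hull T) (div_piece v2 T) = (\<Sum>z\<in>vertices Th. integral (convex hull T) (div_piece (w z) T))"
    using Vh3_sum[of "vertices Th" w, OF finV w(1)] unfolding v2_def[abs_def] by blast+
  define v12 where "v12 p = v1 p + v2 p" for p
  note V12 = Vh3_add[OF v1(1) V2(1), folded v12_def]
  have V12v: "v12 \<in> Vh3 Th \<Omega>" using V12(1) unfolding v12_def[abs_def] .
  define r where "r T p = q T p - div_piece v12 T p" for T p
  have rp: "poly2 2 (r T)" if "T \<in> Th" for T
    unfolding r_def[abs_def] by (intro poly2_diff qp div_piece_poly2 V12v that)
  have rv: "r T \<sigma> = 0" if T: "T \<in> Th" "\<sigma> \<in> T" for T \<sigma>
  proof -
    have s: "\<sigma> \<in> vertices Th" using T unfolding vertices_def by blast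
    have "div_piece v2 T \<sigma> = (\<Sum>z\<in>vertices Th. if \<sigma> = z then q T z - div_piece v1 T z else 0)"
      unfolding V2(2)[OF T(1)] using w(3)[OF _ T] by (intro sum.cong) auto
    also have "\<dots> = q T \<sigma> - div_piece v1 T \<sigma>" using finV s by simp
    finally show ?thesis unfolding r_def using V12(2)[OF T(1)] by (simp add: v12_def[abs_def])
  qed
  have rm: "integral (convex hull T) (r T) = 0" if T: "T \<in> Th" for T
  proof -
    have "integral (convex hull T) (r T) = integral (convex hull T) (q T) - integral (convex hull T) (div_piece v12 T)"
      unfolding r_def[abs_def] by (rule Henstock_Kurzweil_Integration.integral_diff)
        (use div_piece_integrable[OF V12v T] triangle_integrable[OF tri[OF T] poly2_continuous[OF qp[OF T]]] in auto)
    also have "integral (convex hull T) (div_piece v12 T) = integral (convex hull T) (q T)"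
      using V12(3)[OF T] v1(2)[OF T] V2(3)[OF T] w(2)[OF _ T] by (simp add: v12_def[abs_def])
    finally show ?thesis by simp
  qed
  have "\<exists>b\<in>Vh3 Th \<Omega>. \<forall>S\<in>Th. \<forall>p. div_piece b S p = (if S = T then r T p else 0)" if T: "T \<in> Th" for T
    using bubble_field[OF T rp[OF T] rv[OF T] rm[OF T]] by metis
  then obtain b where b: "\<And>T. T \<in> Th \<Longrightarrow> b T \<in> Vh3 Th \<Omega>"
    "\<And>T S p. T \<in> Th \<Longrightarrow> S \<in> Th \<Longrightarrow> div_piece (b T) S p = (if S = T then r T p else 0)"
    by metis
  define v3 where "v3 p = (\<Sum>T\<in>Th. b T p)" for p
  have V3: "v3 \<in> Vh3 Th \<Omega>" "\<And>T p. T \<in> Th \<Longrightarrow> div_piece v3 T p = (\<Sum>S\<in>Th. div_piece (b S) T p)"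
    using Vh3_sum[of Th b, OF finite_Th b(1)] unfolding v3_def[abs_def] by blast+
  show ?thesis
  proof (rule that)
    show "(\<lambda>p. v12 p + v3 p) \<in> Vh3 Th \<Omega>" by (rule Vh3_add(1)[OF V12v V3(1)])
    fix T p assume T: "T \<in> Th"
    have "div_piece v3 T p = (\<Sum>S\<in>Th. if T = S then r S p else 0)"
      unfolding V3(2)[OF T] using b(2)[OF _ T] by (intro sum.cong) auto
    also have "\<dots> = r T p" using T finite_Th by simp
    finally show "div_piece (\<lambda>p. v12 p + v3 p) T p = q T p"
      unfolding Vh3_add(2)[OF V12v V3(1) T] by (simp add: r_def)
  qed
qed

lemma divergence_in_Qh2: "v \<in> Vh3 Th \<Omega> \<Longrightarrow> div_piece v \<in> Qh2 Th \<Omega>"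
  unfolding Qh2_def using div_piece_poly2 total_mean_zero alternating_sum_zero by (auto split: prod.split)

end

theorem mainTheorem13:
  fixes Th :: "pt set set" and \<Omega> :: "pt set"
  assumes mesh: "conforming_mesh Th \<Omega>"
    and enums: "\<forall>x\<in>vertices Th. \<exists>N Ts. local_enum Th \<Omega> x N Ts"
    and paths: "\<forall>z\<in>vertices Th. \<exists>r\<in>vertices Th. local_interpolating Th \<Omega> r \<and>
                    (\<exists>ys. acceptable_path Th \<Omega> ys z r)"
  shows "(\<forall>v\<in>Vh3 Th \<Omega>. \<exists>q\<in>Qh2 Th \<Omega>. \<forall>T\<in>Th. \<forall>p\<in>convex hull T. div_piece v T p = q T p) \<and>
         (\<forall>q\<in>Qh2 Th \<Omega>. \<exists>v\<in>Vh3 Th \<Omega>. \<forall>T\<in>Th. \<forall>p\<in>convex hull T. div_piece v T p = q T p)"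
proof -
  interpret enumerated_mesh Th \<Omega> by unfold_locales (fact mesh, fact enums)
  have "vertex_achievable z a" if "z \<in> vertices Th" "admissible z a" for z a
    using paths path_achievable that by blast
  then have "\<exists>v\<in>Vh3 Th \<Omega>. \<forall>T\<in>Th. \<forall>p\<in>convex hull T. div_piece v T p = q T p" if "q \<in> Qh2 Th \<Omega>" for q
    using divergence_surjective[OF _ that] by metis
  then show ?thesis using divergence_in_Qh2 by blast
qed

end
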